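(* Let $\gamma\in(-\infty,1)$, $a=1-\gamma$, and let $K:(0,\infty)\times(0,\infty)\to[0,\infty)$ be continuous, symmetric ($K(x,y)=K(y,x)$) and homogeneous of degree $\gamma$ ($K(\alpha x,\alpha y)=\alpha^\gamma K(x,y)$ for all $x,y,\alpha>0$). Assume that there are constants $K_0>0$ and $\delta\in(0,1)$ such that $|x^aK(x,1)-1|\le K_0x^\delta$ for every $x\in(0,2)$. Then there exist $\rho_*>0$ and constants $c_1,c_2>0$ such that for every $\rho\in(0,\rho_* )$ there is a positive continuous function $\Phi_\rho:(0,\infty)\to(0,\infty)$ which solves $$\xi^2\Phi_\rho(\xi)=\int_0^\xi\int_{\xi-\eta}^\infty K(\eta,\zeta)\,\eta\,\Phi_\rho(\eta)\Phi_\rho(\zeta)\,\mathrm d\zeta\,\mathrm d\eta\qquad\text{for all }\xi>0,$$ with $$\int_0^\infty\xi\,\Phi_\rho(\xi)\,\mathrm d\xi=1,\qquad \int_0^\infty\xi^\gamma\,\Phi_\rho(\xi)\,\mathrm d\xi=\frac{\rho}{1+\rho},$$ and which satisfies in addition $$\frac{c_1\rho}{\xi^2}e^{-\frac2a\xi^{-a}}\le\Phi_\rho(\xi)\le\frac{c_2\rho}{\xi^2}e^{-\frac1{2a}\xi^{-a}}\qquad\text{as }\xi\to0$$ (that is, for all sufficiently small $\xi>0$), and $$\Phi_\rho(\xi)=\frac{k_\rho\,\rho}{\xi^{2+\rho}}+o\Bigl(\frac1{\xi^{2+\rho}}\Bigr)\qquad\text{as }\xi\to\infty,$$ for a constant $k_\rho$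 such that $k_\rho\to1$ as $\rho\to0$.
   Context: The function $\Phi_\rho$ is a self-similar profile for Smoluchowski's coagulation equation with rate kernel $K$. No further definitions are needed. *)

theory Defs
  imports "HOL-Analysis.Analysis" "HOL-Library.Landau_Symbols"
begin

end

theory Submission imports Defs begin

text \<open>
  With \<open>f(x) = x\<^sup>2 \<Phi>(x)\<close> and \<open>k(x,y) = K(x,y) / (x y\<^sup>2)\<close> the equation reads
  \<open>f(\<xi>) = \<integral>\<integral> k(x,y) f(x) f(y)\<close> over \<open>x < \<xi> < x + y\<close>, and the kernel satisfies
  \<open>k(x,y) \<approx> x\<^sup>-\<^sup>1\<^sup>-\<^sup>a / y\<close> for \<open>x \<le> y\<close> and \<open>k(x,y) \<approx> y\<^sup>-\<^sup>2\<^sup>-\<^sup>a\<close> for \<open>y \<le> x\<close>. Put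
  \<open>A(\<xi>) = \<integral>\<^sub>0\<^sup>\<xi> x\<^sup>-\<^sup>1\<^sup>-\<^sup>a f\<close> and \<open>Q(\<xi>) = \<integral>\<^sub>\<xi>\<^sup>\<infinity> f / x\<close>. The right-hand side is \<open>A Q\<close> up to a small
  relative error for small \<open>\<xi>\<close>, which gives \<open>A' = \<xi>\<^sup>-\<^sup>1\<^sup>-\<^sup>a Q A\<close> and the decay \<open>exp (- \<xi>\<^sup>-\<^sup>a / a)\<close>, and it is
  \<open>(1 + \<rho>) A Q\<close> up to a small error for large \<open>\<xi>\<close>. So if the total moment \<open>A(\<infinity>)\<close> equals
  \<open>\<rho> / (1 + \<rho>)\<close>, then \<open>- \<xi> Q' \<approx> \<rho> Q\<close>, which gives the tail \<open>\<xi>\<^sup>-\<^sup>\<rho>\<close>.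
  The solution is therefore sought with logarithmic derivatives of \<open>A\<close> on \<open>(0,1]\<close> and of \<open>Q\<close> on
  \<open>[1,\<infinity>)\<close> as unknowns: \<open>f = b (1 + v) A\<close> on \<open>(0,1]\<close> and \<open>f = \<rho> (1 + z) Q\<close> on \<open>(1,\<infinity>)\<close>. Fixing
  \<open>Q(1) = b\<close> and \<open>A(\<infinity>) = \<rho> / (1 + \<rho>)\<close> determines \<open>f\<close> explicitly from the pair \<open>(v, z)\<close>, and dividing
  the right-hand side by \<open>b A\<close> and \<open>\<rho> Q\<close> is a contraction in the norm \<open>sup |v| + sup \<xi>\<^sup>\<delta> |z|\<close> for
  small \<open>\<rho>\<close>. All solutions obtained this way have mass \<open>b + O(\<rho>)\<close>; the scaling invariance of the
  equation, which preserves the moment, normalises the mass to one.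
\<close>

text \<open>Logarithmic derivatives give exact formulas where direct estimates are awkward. Near
  zero A is exponentially small at a rate that depends on f, but f / A is of order one. At large
  arguments f has size \<rho> while Q is of order one, because the integral of x^(-1-\<rho>) over
  (1, \<infinity>) is 1/\<rho>. An error quadratic in f is then O(\<rho>^2) against a main term
  \<rho> Q, and this is the source of the factor \<rho> in the contraction. One term has no such
  factor: the deviation of A(\<xi>) from A(\<infinity>), divided by \<rho>. It is at most a fixed
  multiple of b/a and is made small by the choice of b, which the scaling invariance leaves free. A
  second obstacle is the term \<rho> Q A. It requires f to be nearly constant on (\<xi> - y, \<xi>),
  while sup norms control no increments. The ansatz supplies this, since f - \<rho> Q = \<rho> z Q
  decays relative to Q. The two pieces are glued at 1 without any matching condition; continuity
  there follows afterwards from the equation.\<close>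

section \<open>Integration and contraction tools\<close>

text \<open>Negative unit powers are kept as powers, so that exponents can be added.\<close>
declare powr_neg_one' [simp del] powr_one' [simp del]

text \<open>Banach's fixed point theorem for the norm given by the least d with |v i| \<le> d *
  \<omega> i, stated pointwise so that no function space has to be set up. Both \<open>v0\<close>
  and \<open>T v0\<close> are bounded by \<omega>, so the first step is at most 2 * \<omega>;
  summing the geometric series gives the 4 in \<open>closed\<close>, which is asked only for
  sequences converging at this rate.\<close>

lemma weighted_contraction:
  fixes T :: "('i \<Rightarrow> real) \<Rightarrow> 'i \<Rightarrow> real" and \<omega> :: "'i \<Rightarrow> real"
  assumes ne: "v0 \<in> S" and T: "\<And>v. v \<in> S \<Longrightarrow> T v \<in> S"
    and bd: "\<And>v i. v \<in> S \<Longrightarrow> \<bar>v i\<bar> \<le> \<omega> i"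
    and contr: "\<And>v w d. v \<in> S \<Longrightarrow> w \<in> S \<Longrightarrow> 0 \<le> d \<Longrightarrow> (\<And>i. \<bar>v i - w i\<bar> \<le> d * \<omega> i)
       \<Longrightarrow> (\<And>i. \<bar>T v i - T w i\<bar> \<le> d / 2 * \<omega> i)"
    and closed: "\<And>f v. (\<And>n::nat. f n \<in> S) \<Longrightarrow> (\<And>n i. \<bar>f n i - v i\<bar> \<le> 4 * (1/2)^n * \<omega> i) \<Longrightarrow> v \<in> S"
  shows "\<exists>v\<in>S. T v = v"
proof -
  define f where "f n = (T ^^ n) v0" for n
  have fS: "f n \<in> S" for n unfolding f_def by (induction n) (auto intro: ne T)
  have fSuc: "f (Suc n) = T (f n)" for n by (simp add: f_def)
  have pert_bound: "0 \<le> \<omega> i" for i using bd[OF ne, of i] by linarith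
  have step: "\<bar>f (Suc n) i - f n i\<bar> \<le> 2 * (1/2)^n * \<omega> i" for n i
  proof (induction n arbitrary: i)
    case 0
    show ?case using bd[OF fS[of 0], of i] bd[OF fS[of 1], of i] by (simp add: abs_if split: if_splits)
  next
    case (Suc n)
    show ?case using contr[OF fS fS, of "2 * (1/2)^n" "Suc n" n i] Suc.IH
      by (simp add: fSuc)
  qed
  have diff: "\<bar>f (n + m) i - f n i\<bar> \<le> 4 * (1/2)^n * (1 - (1/2)^m) * \<omega> i" for n m i
  proof (induction m)
    case (Suc m)
    have "\<bar>f (n + Suc m) i - f n i\<bar> \<le> 2 * (1/2)^(n+m) * \<omega> i + 4 * (1/2)^n * (1 - (1/2)^m) * \<omega> i"
      using step[of "n+m" i] Suc.IH by (simp del: power_Suc)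
    also have "\<dots> = 4 * (1/2)^n * (1 - (1/2)^Suc m) * \<omega> i"
      by (simp add: power_add algebra_simps)
    finally show ?case .
  qed simp
  have diff2: "\<bar>f m i - f n i\<bar> \<le> 4 * (1/2)^n * \<omega> i" if "n \<le> m" for n m i
  proof -
    have "4 * (1/2)^n * (1 - (1/2)^(m-n)) * \<omega> i \<le> 4 * (1/2)^n * 1 * \<omega> i"
      using pert_bound[of i] by (intro mult_right_mono mult_left_mono) auto
    moreover have "\<bar>f m i - f n i\<bar> \<le> 4 * (1/2)^n * (1 - (1/2)^(m-n)) * \<omega> i"
      using diff[of n "m-n" i] that by simp
    ultimately show ?thesis by linarith
  qed
  have lim0: "(\<lambda>n. 4 * (1/2)^n * \<omega> i) \<longlonglongrightarrow> 0" for i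
    by (auto intro!: tendsto_eq_intros LIMSEQ_realpow_zero)
  have "Cauchy (\<lambda>n. f n i)" for i
  proof (rule metric_CauchyI)
    fix e :: real assume "0 < e"
    then obtain N where N: "\<And>n. n \<ge> N \<Longrightarrow> \<bar>4 * (1/2)^n * \<omega> i\<bar> < e / 2"
      using LIMSEQ_D[OF lim0[of i], of "e/2"] by auto
    have "dist (f m i) (f n i) < e" if "m \<ge> N" "n \<ge> N" for m n
      using diff2[OF that(1), of i] diff2[OF that(2), of i] N[of N] unfolding dist_real_def by linarith
    then show "\<exists>M. \<forall>m\<ge>M. \<forall>n\<ge>M. dist (f m i) (f n i) < e" by blast
  qed
  then have "convergent (\<lambda>n. f n i)" for i by (simp add: Cauchy_convergent_iff)
  then obtain v where v: "\<And>i. (\<lambda>n. f n i) \<longlonglongrightarrow> v i" unfolding convergent_def by metis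
  have close: "\<bar>f n i - v i\<bar> \<le> 4 * (1/2)^n * \<omega> i" for n i
  proof (rule LIMSEQ_le_const2)
    show "(\<lambda>m. \<bar>f n i - f m i\<bar>) \<longlonglongrightarrow> \<bar>f n i - v i\<bar>" by (intro tendsto_intros v)
    show "\<exists>N. \<forall>m\<ge>N. \<bar>f n i - f m i\<bar> \<le> 4 * (1/2)^n * \<omega> i"
      using diff2[of n _ i] by (auto simp: abs_minus_commute)
  qed
  have vS: "v \<in> S" by (rule closed[OF fS close])
  have "T v i = v i" for i
  proof (rule LIMSEQ_unique)
    show "(\<lambda>n. f (Suc n) i) \<longlonglongrightarrow> v i" by (rule LIMSEQ_Suc[OF v])
    show "(\<lambda>n. f (Suc n) i) \<longlonglongrightarrow> T v i"
    proof (rule LIM_zero_cancel, rule Lim_null_comparison)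
      show "\<forall>\<^sub>F n in sequentially. norm (f (Suc n) i - T v i) \<le> 4 * (1/2)^n * \<omega> i"
      proof (intro always_eventually allI)
        fix n
        have "\<bar>T (f n) i - T v i\<bar> \<le> 4 * (1/2)^n / 2 * \<omega> i"
          by (rule contr[OF fS vS]) (use close in auto)
        also have "\<dots> \<le> 4 * (1/2)^n * \<omega> i" using pert_bound[of i] by (intro mult_right_mono) auto
        finally show "norm (f (Suc n) i - T v i) \<le> 4 * (1/2)^n * \<omega> i" by (simp add: fSuc)
      qed
      show "(\<lambda>n. 4 * (1/2)^n * \<omega> i) \<longlonglongrightarrow> 0" by (rule lim0)
    qed
  qed
  then show ?thesis using vS by auto
qed

section \<open>Integrals over half-lines, product domains and triangles\<close>

lemma powr_mult_powr: "p + q = r \<Longrightarrow> x powr p * x powr q = (x powr r :: real)"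
  by (auto simp flip: powr_add)

lemma nn_integral_powr_tail:
  assumes "0 < s" "0 < \<xi>"
  shows "(\<integral>\<^sup>+x. ennreal (indicator {\<xi>..} x * x powr (-1-s)) \<partial>lborel) = ennreal (\<xi> powr (-s) / s)"
proof -
  have "(\<integral>\<^sup>+x. ennreal (x powr (-1-s)) * indicator {\<xi>..} x \<partial>lborel) = ennreal (0 - (- (\<xi> powr (-s) / s)))"
  proof (rule nn_integral_FTC_atLeast)
    show "DERIV (\<lambda>x. - (x powr (-s) / s)) x :> x powr (-1-s)" if "\<xi> \<le> x" for x
    proof -
      \<comment> \<open>The derivative rule produces the exponent \<open>-s-1\<close>; this rewrite
        brings it to the form used in all statements.\<close>
      have "-s-1 = -1-s" by simp
      note [simp] = arg_cong[OF this, of "\<lambda>t. x powr t"]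
      show ?thesis
        using that assms by (auto intro!: derivative_eq_intros simp: field_simps)
    qed
    show "((\<lambda>x. - (x powr (-s) / s)) \<longlongrightarrow> 0) at_top"
    proof -
      have "((\<lambda>x. x powr (-s)) \<longlongrightarrow> 0) at_top"
        using assms tendsto_neg_powr[of "-s" "\<lambda>x. x" at_top] by (simp add: filterlim_ident)
      from tendsto_mult_left[OF this, of "-1/s"] show ?thesis by simp
    qed
  qed (use assms in auto)
  then show ?thesis by (simp add: ennreal_mult' ennreal_indicator mult.commute)
qed

text \<open>The weights below are all bounded on (0,1] and decay like a power above 1, so this
  single criterion integrates them.\<close>

lemma nn_integral_piecewise_le:
  fixes p :: "real \<Rightarrow> real"
  assumes s: "0 < s" and c: "0 \<le> c" "0 \<le> C"
    and 1: "\<And>x. 0 < x \<Longrightarrow> x \<le> 1 \<Longrightarrow> p x \<le> c" and 2: "\<And>x. 1 < x \<Longrightarrow> p x \<le> C * x powr (-1-s)"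
    and 3: "\<And>x. x \<le> 0 \<Longrightarrow> p x \<le> 0"
  shows "(\<integral>\<^sup>+x. ennreal (p x) \<partial>lborel) \<le> ennreal (c + C / s)"
proof -
  have "(\<integral>\<^sup>+x. ennreal (p x) \<partial>lborel) \<le>
     (\<integral>\<^sup>+x. ennreal c * indicator {0<..1} x + ennreal C * ennreal (indicator {1..} x * x powr (-1-s)) \<partial>lborel)"
  proof (rule nn_integral_mono)
    fix x :: real
    consider "x \<le> 0" | "0 < x" "x \<le> 1" | "1 < x" by linarith
    then show "ennreal (p x) \<le> ennreal c * indicator {0<..1} x + ennreal C * ennreal (indicator {1..} x * x powr (-1-s))"
    proof cases
      case 1 then show ?thesis using 3[of x] by (simp add: ennreal_neg)
    next
      case 2 then show ?thesis using 1[OF 2] by (simp add: ennreal_leI add_increasing2)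
    next
      case 3 then show ?thesis using 2[OF 3] c
        by (simp add: ennreal_leI add_increasing flip: ennreal_mult)
    qed
  qed
  also have "\<dots> = ennreal c * 1 + ennreal C * ennreal (1 / s)"
    using nn_integral_powr_tail[OF s, of 1]
    by (subst nn_integral_add) (auto simp: nn_integral_cmult nn_integral_cmult_indicator)
  also have "\<dots> = ennreal (c + C / s)" using s c by (simp flip: ennreal_mult ennreal_plus)
  finally show ?thesis .
qed

lemma nn_integral_pair_product:
  fixes p q :: "real \<Rightarrow> real"
  assumes [measurable]: "p \<in> borel_measurable borel" "q \<in> borel_measurable borel"
    and nn: "\<And>x. 0 \<le> p x" "\<And>x. 0 \<le> q x"
    and P: "(\<integral>\<^sup>+x. ennreal (p x) \<partial>lborel) \<le> ennreal P" and Q: "(\<integral>\<^sup>+x. ennreal (q x) \<partial>lborel) \<le> ennreal Q"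
    and "0 \<le> P" "0 \<le> Q"
  shows "(\<integral>\<^sup>+(x,y). ennreal (p x * q y) \<partial>(lborel \<Otimes>\<^sub>M lborel)) \<le> ennreal (P * Q)"
proof -
  have "(\<integral>\<^sup>+(x,y). ennreal (p x * q y) \<partial>(lborel \<Otimes>\<^sub>M lborel)) = (\<integral>\<^sup>+x. \<integral>\<^sup>+y. ennreal (p x * q y) \<partial>lborel \<partial>lborel)"
    by (subst lborel.nn_integral_fst[symmetric]) auto
  also have "\<dots> = (\<integral>\<^sup>+x. ennreal (p x) \<partial>lborel) * (\<integral>\<^sup>+x. ennreal (q x) \<partial>lborel)"
    using nn by (simp add: ennreal_mult nn_integral_cmult nn_integral_multc)
  also have "\<dots> \<le> ennreal P * ennreal Q" by (intro mult_mono P Q) auto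
  finally show ?thesis using assms by (simp add: ennreal_mult)
qed

lemma integral_pair_product:
  fixes p q :: "real \<Rightarrow> real"
  assumes p: "integrable lborel p" and q: "integrable lborel q"
  shows "integrable (lborel \<Otimes>\<^sub>M lborel) (\<lambda>(x,y). p x * q y)"
    and "(\<integral>(x,y). p x * q y \<partial>(lborel \<Otimes>\<^sub>M lborel)) = (\<integral>x. p x \<partial>lborel) * (\<integral>y. q y \<partial>lborel)"
proof -
  have [measurable]: "p \<in> borel_measurable borel" "q \<in> borel_measurable borel" using p q by auto
  show int: "integrable (lborel \<Otimes>\<^sub>M lborel) (\<lambda>(x,y). p x * q y)"
  proof (rule lborel_pair.Fubini_integrable)
    show "integrable lborel (\<lambda>x. \<integral>y. norm (case (x,y) of (x,y) \<Rightarrow> p x * q y) \<partial>lborel)"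
      using p by (simp add: abs_mult)
  qed (use q in auto)
  have "(\<integral>(x,y). p x * q y \<partial>(lborel \<Otimes>\<^sub>M lborel)) = (\<integral>x. \<integral>y. p x * q y \<partial>lborel \<partial>lborel)"
    using lborel_pair.integral_fst'[OF int] by simp
  then show "(\<integral>(x,y). p x * q y \<partial>(lborel \<Otimes>\<^sub>M lborel)) = (\<integral>x. p x \<partial>lborel) * (\<integral>y. q y \<partial>lborel)"
    by simp
qed

text \<open>For x in (0, \<xi>) the section of the triangle is the interval (\<xi> - x, \<xi>) of
  length x. The resulting factor x weakens the singularity of the kernel at zero by one
  power.\<close>

lemma nn_integral_triangle_fst:
  fixes p :: "real \<Rightarrow> real"
  assumes [measurable]: "p \<in> borel_measurable borel" and "\<And>x. 0 \<le> p x"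
  shows "(\<integral>\<^sup>+(x,y). ennreal (if 0 < x \<and> x < \<xi> \<and> y < \<xi> \<and> \<xi> < x + y then p x else 0) \<partial>(lborel \<Otimes>\<^sub>M lborel))
     = (\<integral>\<^sup>+x. ennreal (indicator {0<..<\<xi>} x * (x * p x)) \<partial>lborel)"
proof -
  have "(\<integral>\<^sup>+(x,y). ennreal (if 0 < x \<and> x < \<xi> \<and> y < \<xi> \<and> \<xi> < x + y then p x else 0) \<partial>(lborel \<Otimes>\<^sub>M lborel))
     = (\<integral>\<^sup>+x. \<integral>\<^sup>+y. ennreal (if 0 < x \<and> x < \<xi> \<and> y < \<xi> \<and> \<xi> < x + y then p x else 0) \<partial>lborel \<partial>lborel)"
    by (subst lborel.nn_integral_fst[symmetric]) auto
  also have "\<dots> = (\<integral>\<^sup>+x. \<integral>\<^sup>+y. ennreal (indicator {0<..<\<xi>} x * p x) * indicator {\<xi>-x<..<\<xi>} y \<partial>lborel \<partial>lborel)"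
    by (intro nn_integral_cong) (auto split: split_indicator)
  also have "\<dots> = (\<integral>\<^sup>+x. ennreal (indicator {0<..<\<xi>} x * (x * p x)) \<partial>lborel)"
    using assms by (intro nn_integral_cong) (auto simp: nn_integral_cmult_indicator mult.commute simp flip: ennreal_mult split: split_indicator)
  finally show ?thesis .
qed

lemma nn_integral_triangle_snd:
  fixes p :: "real \<Rightarrow> real"
  assumes [measurable]: "p \<in> borel_measurable borel" and "\<And>x. 0 \<le> p x"
  shows "(\<integral>\<^sup>+(x,y). ennreal (if 0 < y \<and> x < \<xi> \<and> y < \<xi> \<and> \<xi> < x + y then p y else 0) \<partial>(lborel \<Otimes>\<^sub>M lborel))
     = (\<integral>\<^sup>+x. ennreal (indicator {0<..<\<xi>} x * (x * p x)) \<partial>lborel)"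
proof -
  have "(\<integral>\<^sup>+(x,y). ennreal (if 0 < y \<and> x < \<xi> \<and> y < \<xi> \<and> \<xi> < x + y then p y else 0) \<partial>(lborel \<Otimes>\<^sub>M lborel))
     = (\<integral>\<^sup>+y. \<integral>\<^sup>+x. ennreal (if 0 < y \<and> x < \<xi> \<and> y < \<xi> \<and> \<xi> < x + y then p y else 0) \<partial>lborel \<partial>lborel)"
    by (subst lborel_pair.nn_integral_snd[symmetric]) auto
  also have "\<dots> = (\<integral>\<^sup>+x. \<integral>\<^sup>+y. ennreal (indicator {0<..<\<xi>} x * p x) * indicator {\<xi>-x<..<\<xi>} y \<partial>lborel \<partial>lborel)"
    by (intro nn_integral_cong) (auto split: split_indicator)
  also have "\<dots> = (\<integral>\<^sup>+x. ennreal (indicator {0<..<\<xi>} x * (x * p x)) \<partial>lborel)"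
    using assms by (intro nn_integral_cong) (auto simp: nn_integral_cmult_indicator mult.commute simp flip: ennreal_mult split: split_indicator)
  finally show ?thesis .
qed

text \<open>The majorant enters through its \<open>nn_integral\<close>, so that integrability and
  the numerical bound come from one computation.\<close>

lemma integrable_dominated:
  fixes p q :: "'a \<Rightarrow> real"
  assumes "p \<in> borel_measurable M" "\<And>x. \<bar>p x\<bar> \<le> q x"
    "(\<integral>\<^sup>+x. ennreal (q x) \<partial>M) \<le> ennreal B" "0 \<le> B"
  shows "integrable M p" "\<bar>\<integral>x. p x \<partial>M\<bar> \<le> B"
proof -
  have le: "(\<integral>\<^sup>+x. ennreal (norm (p x)) \<partial>M) \<le> ennreal B"
    using assms(2,3) by (intro order_trans[OF nn_integral_mono assms(3)]) (auto intro: ennreal_leI)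
  then show int: "integrable M p"
    using assms(1) by (intro integrableI_bounded) (auto simp: less_top[symmetric] top_unique)
  have "ennreal (norm (\<integral>x. p x \<partial>M)) \<le> ennreal B"
    using integral_norm_bound_ennreal[OF int] le by (rule order_trans)
  then show "\<bar>\<integral>x. p x \<partial>M\<bar> \<le> B" using assms(4) by simp
qed

lemma nn_integral_add_le:
  assumes "p \<in> borel_measurable M" "q \<in> borel_measurable M" "\<And>x. 0 \<le> p x" "\<And>x. 0 \<le> q x"
    "(\<integral>\<^sup>+x. ennreal (p x) \<partial>M) \<le> ennreal P" "(\<integral>\<^sup>+x. ennreal (q x) \<partial>M) \<le> ennreal Q" "0 \<le> P" "0 \<le> Q"
  shows "(\<integral>\<^sup>+x. ennreal (p x + q x) \<partial>M) \<le> ennreal (P + Q)"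
proof -
  have "(\<integral>\<^sup>+x. ennreal (p x + q x) \<partial>M) = (\<integral>\<^sup>+x. ennreal (p x) \<partial>M) + (\<integral>\<^sup>+x. ennreal (q x) \<partial>M)"
    using assms by (subst nn_integral_add[symmetric]) auto
  also have "\<dots> \<le> ennreal P + ennreal Q" by (intro add_mono assms)
  finally show ?thesis using assms by simp
qed

lemma nn_integral_cmult_le:
  assumes "p \<in> borel_measurable M" "0 \<le> c"
    "(\<integral>\<^sup>+x. ennreal (p x) \<partial>M) \<le> ennreal P" "0 \<le> P"
  shows "(\<integral>\<^sup>+x. ennreal (c * p x) \<partial>M) \<le> ennreal (c * P)"
proof -
  have "(\<integral>\<^sup>+x. ennreal (c * p x) \<partial>M) = ennreal c * (\<integral>\<^sup>+x. ennreal (p x) \<partial>M)"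
    using assms by (subst nn_integral_cmult[symmetric]) (auto simp: ennreal_mult')
  also have "\<dots> \<le> ennreal c * ennreal P" by (intro mult_left_mono assms) auto
  finally show ?thesis using assms by (simp add: ennreal_mult)
qed

text \<open>The exact, signed counterpart of the triangle estimate. It evaluates a main term, where
  the section length y turns y^(-2-a) into the weight y^(-1-a) of A.\<close>

lemma integral_triangle_snd:
  fixes p :: "real \<Rightarrow> real"
  assumes [measurable]: "p \<in> borel_measurable borel" and z: "\<And>y. y \<le> 0 \<Longrightarrow> p y = 0"
    and int: "integrable lborel (\<lambda>y. y * p y)"
  shows "integrable (lborel \<Otimes>\<^sub>M lborel) (\<lambda>(x,y). if x < \<xi> \<and> y < \<xi> \<and> \<xi> < x + y then p y else 0)" (is "integrable _ ?f")
    and "(\<integral>(x,y). (if x < \<xi> \<and> y < \<xi> \<and> \<xi> < x + y then p y else 0) \<partial>(lborel \<Otimes>\<^sub>M lborel))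
      = (\<integral>y. indicator {..<\<xi>} y * (y * p y) \<partial>lborel)"
proof -
  have eq: "?f = (\<lambda>(x,y). (indicator {..<\<xi>} y * p y) * indicator {\<xi>-y<..<\<xi>} x)"
    by (auto simp: fun_eq_iff split: split_indicator)
  have inner: "(\<integral>x. (indicator {..<\<xi>} y * p y) * indicator {\<xi>-y<..<\<xi>} x \<partial>lborel) = indicator {..<\<xi>} y * (y * p y)" for y
    using z[of y] by (cases "y \<le> 0") auto
  have fin: "integrable lborel (\<lambda>y. indicator {..<\<xi>} y * (y * p y))"
    using integrable_mult_indicator[OF _ int, of "{..<\<xi>}"] by simp
  have fin_interval: "integrable lborel (indicat_real {u<..<v})" for u v :: real
    by (cases "u \<le> v") auto
  have "integrable (lborel \<Otimes>\<^sub>M lborel) (\<lambda>(y, x). if x < \<xi> \<and> y < \<xi> \<and> \<xi> < x + y then p y else 0)"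
  proof (rule lborel_pair.Fubini_integrable)
    have "(\<integral>x. norm (if x < \<xi> \<and> y < \<xi> \<and> \<xi> < x + y then p y else 0) \<partial>lborel) = \<bar>indicator {..<\<xi>} y * (y * p y)\<bar>" for y
    proof -
      have "(\<integral>x. norm (if x < \<xi> \<and> y < \<xi> \<and> \<xi> < x + y then p y else 0) \<partial>lborel)
        = (\<integral>x. (indicator {..<\<xi>} y * \<bar>p y\<bar>) * indicator {\<xi>-y<..<\<xi>} x \<partial>lborel)"
        by (intro Bochner_Integration.integral_cong) (auto split: split_indicator)
      then show ?thesis using z[of y] by (cases "y \<le> 0") (auto simp: abs_mult split: split_indicator)
    qed
    then show "integrable lborel (\<lambda>y. \<integral>x. norm (case (y,x) of (y,x) \<Rightarrow> if x < \<xi> \<and> y < \<xi> \<and> \<xi> < x + y then p y else 0) \<partial>lborel)"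
      using fin by simp
    have "(\<lambda>x. if x < \<xi> \<and> y < \<xi> \<and> \<xi> < x + y then p y else 0) = (\<lambda>x. (indicator {..<\<xi>} y * p y) * indicator {\<xi>-y<..<\<xi>} x)" for y
      by (auto simp: fun_eq_iff split: split_indicator)
    then show "AE y in lborel. integrable lborel (\<lambda>x. case (y,x) of (y,x) \<Rightarrow> if x < \<xi> \<and> y < \<xi> \<and> \<xi> < x + y then p y else 0)"
      by (intro AE_I2) (use fin_interval in simp)
  qed measurable
  then show int2: "integrable (lborel \<Otimes>\<^sub>M lborel) ?f"
    by (drule_tac lborel_pair.integrable_product_swap) simp
  show "(\<integral>(x,y). (if x < \<xi> \<and> y < \<xi> \<and> \<xi> < x + y then p y else 0) \<partial>(lborel \<Otimes>\<^sub>M lborel))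
      = (\<integral>y. indicator {..<\<xi>} y * (y * p y) \<partial>lborel)"
  proof -
    have "(\<integral>x. (if x < \<xi> \<and> y < \<xi> \<and> \<xi> < x + y then p y else 0) \<partial>lborel) = indicator {..<\<xi>} y * (y * p y)" for y
      unfolding inner[symmetric] by (intro Bochner_Integration.integral_cong) (auto split: split_indicator)
    then show ?thesis
      using lborel_pair.integral_snd[of "\<lambda>x y. (if x < \<xi> \<and> y < \<xi> \<and> \<xi> < x + y then p y else 0)"] int2 by simp
  qed
qed

text \<open>Nonnegativity of the derivative makes it integrable as soon as both boundary limits
  exist. The ansatz provides antiderivatives with known limits, so no separate integrability proof
  is required for it.\<close>

lemma integral_FTC_Ioo:
  fixes F f :: "real \<Rightarrow> real"
  assumes "l < r" and "\<And>x. l < x \<Longrightarrow> x < r \<Longrightarrow> DERIV F x :> f x"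
    and "\<And>x. l < x \<Longrightarrow> x < r \<Longrightarrow> isCont f x" and "\<And>x. l < x \<Longrightarrow> x < r \<Longrightarrow> 0 \<le> f x"
    and "(F \<longlongrightarrow> A) (at_right l)" "(F \<longlongrightarrow> B) (at_left r)"
  shows "integrable lborel (\<lambda>x. indicator {l<..<r} x * f x)"
    and "(\<integral>x. indicator {l<..<r} x * f x \<partial>lborel) = B - A"
proof -
  have e: "einterval (ereal l) (ereal r) = {l<..<r}" by (auto simp: einterval_def)
  note * = interval_integral_FTC_nonneg[of "ereal l" "ereal r" F f A B]
  have 1: "set_integrable lborel (einterval l r) f" "(LBINT x=ereal l..ereal r. f x) = B - A"
    by (rule *; use assms in \<open>simp add: ereal_tendsto_simps1\<close>)+
  show "integrable lborel (\<lambda>x. indicator {l<..<r} x * f x)" using 1(1) by (simp add: e set_integrable_def)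
  show "(\<integral>x. indicator {l<..<r} x * f x \<partial>lborel) = B - A"
    using 1(2) assms(1) by (simp add: interval_lebesgue_integral_def e set_lebesgue_integral_def)
qed

lemma integral_FTC_Ioi:
  fixes F f :: "real \<Rightarrow> real"
  assumes "\<And>x. l < x \<Longrightarrow> DERIV F x :> f x"
    and "\<And>x. l < x \<Longrightarrow> isCont f x" and "\<And>x. l < x \<Longrightarrow> 0 \<le> f x"
    and "(F \<longlongrightarrow> A) (at_right l)" "(F \<longlongrightarrow> B) at_top"
  shows "integrable lborel (\<lambda>x. indicator {l<..} x * f x)"
    and "(\<integral>x. indicator {l<..} x * f x \<partial>lborel) = B - A"
proof -
  have e: "einterval (ereal l) \<infinity> = {l<..}" by (auto simp: einterval_def)
  note * = interval_integral_FTC_nonneg[of "ereal l" \<infinity> F f A B]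
  have 1: "set_integrable lborel (einterval l \<infinity>) f" "(LBINT x=ereal l..\<infinity>. f x) = B - A"
    by (rule *; use assms in \<open>simp add: ereal_tendsto_simps1\<close>)+
  show "integrable lborel (\<lambda>x. indicator {l<..} x * f x)" using 1(1) by (simp add: e set_integrable_def)
  show "(\<integral>x. indicator {l<..} x * f x \<partial>lborel) = B - A"
    using 1(2) assms(1) by (simp add: interval_lebesgue_integral_def e set_lebesgue_integral_def)
qed

text \<open>The inequality 1 + t \<le> exp t at t = q - p. The factor \<open>exp r\<close> retains
  the decay common to both exponentials.\<close>

lemma exp_diff_le:
  fixes p q r :: real
  assumes "p \<le> r" "q \<le> r"
  shows "\<bar>exp p - exp q\<bar> \<le> \<bar>p - q\<bar> * exp r"
proof -
  have *: "exp p - exp q \<le> (p - q) * exp r" if "q \<le> p" "p \<le> r" for p q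
  proof -
    have "1 - exp (q - p) \<le> p - q" using exp_ge_add_one_self[of "q - p"] by linarith
    then have "exp p * (1 - exp (q - p)) \<le> exp p * (p - q)" by (intro mult_left_mono) auto
    also have "\<dots> \<le> exp r * (p - q)" using that by (intro mult_right_mono) auto
    finally show ?thesis by (simp add: algebra_simps flip: exp_add)
  qed
  show ?thesis using *[of q p] *[of p q] assms by (cases "q \<le> p") auto
qed

lemma poly_exp_bounded:
  fixes c p :: real
  assumes "0 < c"
  shows "\<exists>C. \<forall>t\<ge>0. (1 + t) powr p * exp (- c * t) \<le> C"
proof -
  have "((\<lambda>t::real. (1 + t) powr p * exp (- c * t)) \<longlongrightarrow> 0) at_top"
    using assms by real_asymp
  then have "\<forall>\<^sub>F t in at_top. (1 + t) powr p * exp (- c * t) < 1"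
    by (auto simp: order_tendsto_iff)
  then obtain N where N: "\<And>t. N \<le> t \<Longrightarrow> (1 + t) powr p * exp (- c * t) < 1"
    by (auto simp: eventually_at_top_linorder)
  have "bdd_above ((\<lambda>t. (1 + t) powr p * exp (- c * t)) ` {0..max 0 N})"
    by (intro compact_imp_bounded[THEN bounded_imp_bdd_above] compact_continuous_image continuous_intros) auto
  then obtain C where "\<forall>t\<in>{0..max 0 N}. (1 + t) powr p * exp (- c * t) \<le> C"
    unfolding bdd_above_def by auto
  then have "(1 + t) powr p * exp (- c * t) \<le> max C 1" if "0 \<le> t" for t
    using N[of t] that by (cases "t \<le> max 0 N") force+
  then show ?thesis by blast
qed

text \<open>Uniform convergence at a geometric rate; this is the continuity part of the closedness
  required by the fixed point theorem.\<close>

lemma continuous_on_dominated_limit: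
  fixes f :: "nat \<Rightarrow> real \<Rightarrow> real"
  assumes "\<And>n. continuous_on A (f n)" "\<And>n x. x \<in> A \<Longrightarrow> \<bar>f n x - g x\<bar> \<le> (1/2)^n"
  shows "continuous_on A g"
proof (rule uniform_limit_theorem)
  show "\<forall>\<^sub>F n in sequentially. continuous_on A (f n)" using assms(1) by simp
  show "uniform_limit A f g sequentially"
  proof (rule uniform_limitI)
    fix e :: real assume "0 < e"
    have "(\<lambda>n. (1/2::real)^n) \<longlonglongrightarrow> 0" by (rule LIMSEQ_realpow_zero) auto
    then have "\<forall>\<^sub>F n in sequentially. (1/2)^n < e" using \<open>0 < e\<close> by (rule order_tendstoD(2))
    then show "\<forall>\<^sub>F n in sequentially. \<forall>x\<in>A. dist (f n x) (g x) < e"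
    proof eventually_elim
      case (elim n)
      then show ?case using assms(2)[of _ n] by (auto simp: dist_real_def intro: le_less_trans)
    qed
  qed
qed simp

section \<open>The kernel and the coagulation operator\<close>

text \<open>The rescaled kernel k with everything that the fixed point argument uses; homogeneity
  and symmetry of K are already absorbed into \<open>k_left\<close> and \<open>k_right\<close>. The
  condition \<delta> < a keeps x^(-1-a+\<delta>) integrable at infinity and makes the moment of the
  tail beyond \<xi>, of order \<xi>^(-a), subordinate to \<xi>^(-\<delta>). Since k vanishes unless
  both arguments are positive, all integrals can run over the whole plane.\<close>

locale coagulation_kernel =
  fixes k :: "real \<Rightarrow> real \<Rightarrow> real" and a \<delta> K0 :: real
  assumes a_pos: "0 < a" and \<delta>_pos: "0 < \<delta>" and \<delta>_less_1: "\<delta> < 1" and \<delta>_less_a: "\<delta> < a" and K0_nonneg: "0 \<le> K0"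
    and k_meas [measurable]: "(\<lambda>(x, y). k x y) \<in> borel_measurable (borel \<Otimes>\<^sub>M borel)"
    and k_nonneg: "\<And>x y. 0 \<le> k x y"
    and k_zero: "\<And>x y. x \<le> 0 \<or> y \<le> 0 \<Longrightarrow> k x y = 0"
    and k_left: "\<And>x y. 0 < x \<Longrightarrow> x \<le> y \<Longrightarrow>
      \<bar>k x y - x powr (-1-a) * y powr (-1)\<bar> \<le> K0 * x powr (-1-a+\<delta>) * y powr (-1-\<delta>)"
    and k_right: "\<And>x y. 0 < y \<Longrightarrow> y \<le> x \<Longrightarrow>
      \<bar>k x y - y powr (-2-a)\<bar> \<le> K0 * y powr (-2-a+\<delta>) * x powr (-\<delta>)"
begin

section \<open>Kernel bounds, weights and their integrals\<close>

lemma k_left_le: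
  assumes "0 < x" "x \<le> y"
  shows "k x y \<le> (1 + K0) * x powr (-1-a) * y powr (-1)"
proof -
  have "x powr (-1-a+\<delta>) * y powr (-1-\<delta>) = (x powr (-1-a) * y powr (-1)) * (x powr \<delta> * y powr (-\<delta>))"
    unfolding powr_mult_powr[of "-1-a" \<delta> "-1-a+\<delta>" x, OF refl, symmetric]
      powr_mult_powr[of "-1" "-\<delta>" "-1-\<delta>" y, OF diff_conv_add_uminus[symmetric], symmetric]
    by (simp only: mult_ac)
  also have "\<dots> \<le> (x powr (-1-a) * y powr (-1)) * 1"
    using assms \<delta>_pos by (intro mult_left_mono) (auto simp: powr_minus divide_simps powr_mono2)
  finally have "K0 * (x powr (-1-a+\<delta>) * y powr (-1-\<delta>)) \<le> K0 * (x powr (-1-a) * y powr (-1))"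
    using K0_nonneg by (intro mult_left_mono) auto
  then show ?thesis using k_left[OF assms] by (simp add: algebra_simps abs_le_iff)
qed

lemma k_right_le:
  assumes "0 < y" "y \<le> x"
  shows "k x y \<le> (1 + K0) * y powr (-2-a)"
proof -
  have "y powr (-2-a+\<delta>) * x powr (-\<delta>) = y powr (-2-a) * (y powr \<delta> * x powr (-\<delta>))"
    by (simp add: powr_add[symmetric] powr_diff powr_minus field_simps)
  also have "\<dots> \<le> y powr (-2-a) * 1"
    using assms \<delta>_pos by (intro mult_left_mono) (auto simp: powr_minus divide_simps powr_mono2)
  finally have "K0 * (y powr (-2-a+\<delta>) * x powr (-\<delta>)) \<le> K0 * y powr (-2-a)"
    using K0_nonneg by (intro mult_left_mono) auto
  then show ?thesis using k_right[OF assms] by (simp add: algebra_simps abs_le_iff)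
qed

text \<open>The bound for \<open>f\<close>. On \<open>(0,1]\<close> any power above \<open>a + 1\<close> would do: the actual decay is exponential.\<close>

definition W :: "real \<Rightarrow> real \<Rightarrow> real" where
  "W \<rho> x = (if x \<le> 0 then 0 else if x \<le> 1 then x powr (a + 2) else x powr (-\<rho>))"

lemma W_meas [measurable]: "W \<rho> \<in> borel_measurable borel"
  unfolding W_def by measurable

lemma W_nonneg: "0 \<le> W \<rho> x" and W_le_1: "0 \<le> \<rho> \<Longrightarrow> W \<rho> x \<le> 1"
  using a_pos powr_mono2[of "a+2" x 1] powr_mono[of "-\<rho>" 0 x] by (auto simp: W_def)

lemma W_ge_1: "1 \<le> x \<Longrightarrow> W \<rho> x = x powr (-\<rho>)"
  by (auto simp: W_def)

lemma W_le_2W: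
  assumes "0 \<le> \<rho>" "\<rho> \<le> 1" "1 \<le> \<xi>" "\<xi> / 2 \<le> x"
  shows "W \<rho> x \<le> 2 * W \<rho> \<xi>"
proof -
  have *: "y powr (-\<rho>) \<le> 2 * \<xi> powr (-\<rho>)" if "\<xi> / 2 \<le> y" for y
  proof -
    have "\<xi> powr \<rho> \<le> (2 * y) powr \<rho>" using assms that by (intro powr_mono2) auto
    also have "\<dots> = 2 powr \<rho> * y powr \<rho>" using assms that by (simp add: powr_mult)
    also have "\<dots> \<le> 2 * y powr \<rho>" using powr_mono[of \<rho> 1 2] assms by (intro mult_right_mono) auto
    finally show ?thesis using assms that by (simp add: powr_minus divide_simps)
  qed
  show ?thesis
  proof (cases "x \<le> 1")
    case True
    \<comment> \<open>Here \<xi> \<le> 2, so the power bound taken at the point 1 shows that W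
      \<rho> \<xi> is at least 1/2.\<close>
    then have "\<xi> / 2 \<le> 1" using assms by simp
    from *[OF this] have "1 \<le> 2 * W \<rho> \<xi>" using assms by (simp add: W_ge_1)
    then show ?thesis using W_le_1[OF assms(1), of x] by simp
  qed (use * assms in \<open>auto simp: W_def\<close>)
qed

text \<open>A bound for the integral of \<open>x * h \<rho> x\<close> that is uniform in \<rho>: 2
  from (0,1] and 2 / (a - \<delta>) from the tail.\<close>

definition H :: real where "H = 2 + 2 / (a - \<delta>)"

lemma H_ge: "2 \<le> H" using \<delta>_less_a by (auto simp: H_def)

text \<open>One majorant for three effects at the smaller argument: the kernel x^(-2-a), its error
  x^(-2-a+\<delta>), and the factor 1 + y^\<delta> in the modulus of f. Multiplied by x it also
  covers the kernel x^(-1-a).\<close>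

definition h :: "real \<Rightarrow> real \<Rightarrow> real" where
  "h \<rho> x = x powr (-2-a) * (1 + x powr \<delta>) * W \<rho> x"

lemma h_meas [measurable]: "h \<rho> \<in> borel_measurable borel"
  unfolding h_def by measurable

lemma h_nonneg: "0 \<le> h \<rho> x"
  by (simp add: h_def W_nonneg)

lemma xh_nonneg: "0 \<le> x * h \<rho> x"
  by (cases "x \<le> 0") (simp_all add: h_nonneg, simp add: h_def W_def)

lemma h_le_small:
  assumes "0 < x" "x \<le> 1" shows "h \<rho> x \<le> 2"
proof -
  have "x powr (-2-a) * x powr (a+2) = 1" using assms by (simp flip: powr_add)
  then have "h \<rho> x = 1 + x powr \<delta>" using assms by (simp add: h_def W_def)
  then show ?thesis using powr_mono2[of \<delta> x 1] \<delta>_pos assms by simp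
qed

lemma xh_integral:
  assumes "0 \<le> \<rho>"
  shows "(\<integral>\<^sup>+x. ennreal (x * h \<rho> x) \<partial>lborel) \<le> ennreal H"
  unfolding H_def
proof (rule nn_integral_piecewise_le)
  show "x * h \<rho> x \<le> 2" if "0 < x" "x \<le> 1" for x
    using mult_mono[of x 1 "h \<rho> x" 2] h_le_small[OF that] that by (simp add: h_nonneg)
  show "x * h \<rho> x \<le> 2 * x powr (-1-(a-\<delta>))" if "1 < x" for x
  proof -
    have "x * h \<rho> x = (x * x powr (-2-a)) * ((1 + x powr \<delta>) * W \<rho> x)" by (simp add: h_def)
    also have "x * x powr (-2-a) = x powr (-1-a)"
      using that powr_add[of x 1 "-2-a"] by simp
    also have "(1 + x powr \<delta>) * W \<rho> x \<le> (2 * x powr \<delta>) * 1"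
      using that \<delta>_pos ge_one_powr_ge_zero[of x \<delta>] by (intro mult_mono W_le_1 assms W_nonneg) auto
    then have "x powr (-1-a) * ((1 + x powr \<delta>) * W \<rho> x) \<le> x powr (-1-a) * ((2 * x powr \<delta>) * 1)"
      by (intro mult_left_mono) auto
    also have "\<dots> = 2 * (x powr (-1-a) * x powr \<delta>)" by simp
    also have "x powr (-1-a) * x powr \<delta> = x powr (-1-(a-\<delta>))" by (rule powr_mult_powr) simp
    finally show ?thesis .
  qed
  show "x * h \<rho> x \<le> 0" if "x \<le> 0" for x using that by (simp add: mult_nonpos_nonneg h_nonneg)
qed (use \<delta>_less_a in auto)

text \<open>The bound blows up as \<rho> tends to 0 and serves integrability only. Quantitative
  estimates use the weight with exponent -1-\<delta>, whose integral is bounded uniformly in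
  \<rho>.\<close>

lemma yW_integral:
  assumes "0 < \<rho>"
  shows "(\<integral>\<^sup>+x. ennreal (x powr (-1) * W \<rho> x) \<partial>lborel) \<le> ennreal (1 + 1 / \<rho>)"
proof (rule nn_integral_piecewise_le)
  show "x powr (-1) * W \<rho> x \<le> 1" if "0 < x" "x \<le> 1" for x
  proof -
    have "x powr (-1) * W \<rho> x = x powr (a+1)" using that powr_mult_powr[of "-1" "a+2" "a+1" x] by (simp add: W_def)
    also have "\<dots> \<le> 1" using powr_mono2[of "a+1" x 1] that a_pos by simp
    finally show ?thesis .
  qed
  show "x powr (-1) * W \<rho> x \<le> 1 * x powr (-1-\<rho>)" if "1 < x" for x
    using that by (simp add: W_def flip: powr_add)
qed (use assms in \<open>auto simp: W_def\<close>)

lemma yW\<delta>_integral: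
  assumes "0 \<le> \<rho>"
  shows "(\<integral>\<^sup>+x. ennreal (x powr (-1-\<delta>) * W \<rho> x) \<partial>lborel) \<le> ennreal (1 + 1 / \<delta>)"
proof (rule nn_integral_piecewise_le)
  show "x powr (-1-\<delta>) * W \<rho> x \<le> 1" if "0 < x" "x \<le> 1" for x
  proof -
    have "x powr (-1-\<delta>) * W \<rho> x = x powr (a+1-\<delta>)" using that powr_mult_powr[of "-1-\<delta>" "a+2" "a+1-\<delta>" x] by (simp add: W_def)
    also have "\<dots> \<le> 1" using powr_mono2[of "a+1-\<delta>" x 1] that \<delta>_less_a by simp
    finally show ?thesis .
  qed
  show "x powr (-1-\<delta>) * W \<rho> x \<le> 1 * x powr (-1-\<delta>)" if "1 < x" for x
    using mult_left_mono[OF W_le_1[OF assms, of x], of "x powr (-1-\<delta>)"] by simp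
qed (use \<delta>_pos in \<open>auto simp: W_def\<close>)

lemma W_integral:
  assumes "0 \<le> \<rho>" "0 \<le> R"
  shows "(\<integral>\<^sup>+x. ennreal (indicator {0<..<R} x * W \<rho> x) \<partial>lborel) \<le> ennreal R"
proof -
  have "(\<integral>\<^sup>+x. ennreal (indicator {0<..<R} x * W \<rho> x) \<partial>lborel) \<le> (\<integral>\<^sup>+x. indicator {0<..<R} x \<partial>lborel)"
    using W_le_1[OF assms(1)] by (intro nn_integral_mono) (auto simp: indicator_def)
  also have "\<dots> = ennreal R" using assms by simp
  finally show ?thesis .
qed

lemma xW_le_h:
  assumes "0 < x"
  shows "x powr (-1-a) * W \<rho> x \<le> x * h \<rho> x" "x powr (-2-a) * W \<rho> x \<le> h \<rho> x"
    "x powr (-1-a+\<delta>) * W \<rho> x \<le> x * h \<rho> x" "x powr (-2-a+\<delta>) * W \<rho> x \<le> h \<rho> x"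
proof -
  have e: "x * x powr (-2-a) = x powr (-1-a)" using assms powr_add[of x 1 "-2-a"] by simp
  have "x powr (-2-a) * 1 * W \<rho> x \<le> x powr (-2-a) * (1 + x powr \<delta>) * W \<rho> x"
    by (intro mult_right_mono mult_left_mono W_nonneg) auto
  then show 1: "x powr (-2-a) * W \<rho> x \<le> h \<rho> x" by (simp add: h_def)
  have "x powr (-2-a) * x powr \<delta> * W \<rho> x \<le> x powr (-2-a) * (1 + x powr \<delta>) * W \<rho> x"
    by (intro mult_right_mono mult_left_mono W_nonneg) auto
  then show 2: "x powr (-2-a+\<delta>) * W \<rho> x \<le> h \<rho> x" by (simp add: h_def powr_add)
  show "x powr (-1-a) * W \<rho> x \<le> x * h \<rho> x" using mult_left_mono[OF 1, of x] assms
    by (simp add: e flip: mult.assoc)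
  show "x powr (-1-a+\<delta>) * W \<rho> x \<le> x * h \<rho> x" using mult_left_mono[OF 2, of x] assms e
    by (simp add: powr_add flip: mult.assoc)
qed

section \<open>The weighted norm, the functionals \<open>lower\<close> and \<open>upper\<close>, and
  the operator\<close>

definition Wbounded :: "real \<Rightarrow> real \<Rightarrow> (real \<Rightarrow> real) \<Rightarrow> bool" where
  "Wbounded \<rho> c f \<longleftrightarrow> f \<in> borel_measurable borel \<and> 0 \<le> c \<and> (\<forall>x. \<bar>f x\<bar> \<le> c * W \<rho> x)"

lemma Wbounded_diff: "Wbounded \<rho> c f \<Longrightarrow> Wbounded \<rho> d g \<Longrightarrow> Wbounded \<rho> (c + d) (\<lambda>x. f x - g x)"
  unfolding Wbounded_def by (auto simp: distrib_right intro: order_trans[OF abs_triangle_ineq4] add_mono)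

text \<open>The functions \<open>A\<close> and \<open>Q\<close> above. \<open>A(\<infinity>)\<close> is the \<open>\<gamma>\<close>-moment of \<open>\<Phi> = f / x\<^sup>2\<close> and \<open>Q(0)\<close> is its mass. The functions \<open>f\<close> vanish on
  the negative axis, where \<open>powr\<close> has no meaning.\<close>

definition lower :: "(real \<Rightarrow> real) \<Rightarrow> real \<Rightarrow> real" where
  "lower f \<xi> = (\<integral>x. indicator {..<\<xi>} x * (x powr (-1-a) * f x) \<partial>lborel)"

definition upper :: "(real \<Rightarrow> real) \<Rightarrow> real \<Rightarrow> real" where
  "upper f \<xi> = (\<integral>y. indicator {\<xi>..} y * (y powr (-1) * f y) \<partial>lborel)"

lemma lower_integrable:
  assumes "0 \<le> \<rho>" "Wbounded \<rho> c f"
  shows "integrable lborel (\<lambda>x. x powr (-1-a) * f x)"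
proof (rule integrable_dominated(1))
  show "(\<lambda>x. x powr (-1-a) * f x) \<in> borel_measurable lborel" using assms(2) unfolding Wbounded_def by auto
  show "\<bar>x powr (-1-a) * f x\<bar> \<le> c * (x * h \<rho> x)" for x
  proof (cases "x \<le> 0")
    case True then have "f x = 0" using assms(2)[unfolded Wbounded_def] spec[of "\<lambda>x. \<bar>f x\<bar> \<le> c * W \<rho> x" x] by (simp add: W_def)
    with True show ?thesis using assms(2) xh_nonneg[of x \<rho>] by (simp add: Wbounded_def)
  next
    case False
    have "\<bar>x powr (-1-a) * f x\<bar> \<le> x powr (-1-a) * (c * W \<rho> x)"
      using assms(2) unfolding Wbounded_def by (auto simp: abs_mult intro!: mult_left_mono)
    also have "\<dots> \<le> c * (x * h \<rho> x)"
      using mult_left_mono[OF xW_le_h(1)[of x \<rho>], of c] False assms(2) by (simp add: Wbounded_def mult.left_commute)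
    finally show ?thesis .
  qed
  have "(\<integral>\<^sup>+x. ennreal (c * (x * h \<rho> x)) \<partial>lborel) = ennreal c * (\<integral>\<^sup>+x. ennreal (x * h \<rho> x) \<partial>lborel)"
    using assms(2) xh_nonneg by (auto simp: Wbounded_def ennreal_mult nn_integral_cmult)
  also have "\<dots> \<le> ennreal c * ennreal H" by (intro mult_left_mono xh_integral assms) auto
  also have "\<dots> = ennreal (c * H)" using H_ge assms(2) by (simp add: Wbounded_def ennreal_mult)
  finally show "(\<integral>\<^sup>+x. ennreal (c * (x * h \<rho> x)) \<partial>lborel) \<le> ennreal (c * H)" .
  show "0 \<le> c * H" using H_ge assms(2) by (simp add: Wbounded_def)
qed

lemma upper_integrable:
  assumes "0 < \<rho>" "Wbounded \<rho> c f"
  shows "integrable lborel (\<lambda>x. x powr (-1) * f x)"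
proof (rule integrable_dominated(1))
  show "(\<lambda>x. x powr (-1) * f x) \<in> borel_measurable lborel" using assms(2) unfolding Wbounded_def by auto
  show "\<bar>x powr (-1) * f x\<bar> \<le> c * (x powr (-1) * W \<rho> x)" for x
    using assms(2) mult_left_mono[of "\<bar>f x\<bar>" "c * W \<rho> x" "x powr (-1)"]
    unfolding Wbounded_def by (auto simp: abs_mult mult.left_commute)
  have "(\<integral>\<^sup>+x. ennreal (c * (x powr (-1) * W \<rho> x)) \<partial>lborel) = ennreal c * (\<integral>\<^sup>+x. ennreal (x powr (-1) * W \<rho> x) \<partial>lborel)"
    using assms(2) W_nonneg by (auto simp: Wbounded_def ennreal_mult nn_integral_cmult)
  also have "\<dots> \<le> ennreal c * ennreal (1 + 1 / \<rho>)" by (intro mult_left_mono yW_integral assms) auto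
  also have "\<dots> = ennreal (c * (1 + 1 / \<rho>))" using assms by (simp add: Wbounded_def ennreal_mult)
  finally show "(\<integral>\<^sup>+x. ennreal (c * (x powr (-1) * W \<rho> x)) \<partial>lborel) \<le> ennreal (c * (1 + 1 / \<rho>))" .
  show "0 \<le> c * (1 + 1 / \<rho>)" using assms by (simp add: Wbounded_def)
qed

text \<open>Kept bilinear, with separate arguments, so that the difference of two solutions can be
  estimated one slot at a time.\<close>

definition coag_op :: "(real \<Rightarrow> real) \<Rightarrow> (real \<Rightarrow> real) \<Rightarrow> real \<Rightarrow> real" where
  "coag_op f g \<xi> = (\<integral>(x,y). (if x < \<xi> \<and> \<xi> < x + y then k x y * f x * g y else 0) \<partial>(lborel \<Otimes>\<^sub>M lborel))"

text \<open>The domain x < R omits the constraint on x + y, so that one integrable function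
  dominates the integrands for all \<xi> \<le> R. This is what dominated convergence in \<xi>
  needs.\<close>

lemma kernel_product_integrable:
  assumes \<rho>: "0 < \<rho>" and f: "Wbounded \<rho> c f" and g: "Wbounded \<rho> d g" and R: "0 \<le> R"
  shows "integrable (lborel \<Otimes>\<^sub>M lborel) (\<lambda>(x,y). if x < R then k x y * f x * g y else 0)"
proof -
  have [measurable]: "f \<in> borel_measurable borel" "g \<in> borel_measurable borel"
    using f g by (auto simp: Wbounded_def)
  \<comment> \<open>The first product dominates the kernel for x \<le> y, the second for y \<le>
    x.\<close>
  define p where "p x y = (1 + K0) * c * d * ((x * h \<rho> x) * (y powr (-1) * W \<rho> y)
      + (indicator {0<..<R} x * W \<rho> x) * (h \<rho> y * indicator {0<..} y))" for x y
  have ennreal_le_2: "ennreal t \<le> 2" if "t \<le> 2" for t using ennreal_leI[OF that] by simp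
  \<comment> \<open>On (0,1] the weight h is at most 2, and above 1 it is at most x * h.\<close>
  have hint: "(\<integral>\<^sup>+x. ennreal (h \<rho> x * indicator {0<..} x) \<partial>lborel) \<le> ennreal (2 + H)"
  proof -
    have "(\<integral>\<^sup>+x. ennreal (h \<rho> x * indicator {0<..} x) \<partial>lborel)
        \<le> (\<integral>\<^sup>+x. 2 * indicator {0<..1} x + ennreal (x * h \<rho> x) \<partial>lborel)"
    proof (rule nn_integral_mono)
      fix x :: real
      show "ennreal (h \<rho> x * indicator {0<..} x) \<le> 2 * indicator {0<..1} x + ennreal (x * h \<rho> x)"
        using h_le_small[of x \<rho>] xh_nonneg[of x \<rho>] h_nonneg[of \<rho> x] mult_right_mono[of 1 x "h \<rho> x"]
        by (cases "x \<le> 0"; cases "x \<le> 1")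
          (auto simp: add_increasing2 ennreal_leI ennreal_le_2 add_increasing2)
    qed
    also have "\<dots> \<le> 2 + ennreal H"
      using xh_integral[of \<rho>] \<rho> by (subst nn_integral_add) (auto simp: nn_integral_cmult_indicator)
    finally show ?thesis using H_ge by simp
  qed
  have 1: "(\<integral>\<^sup>+(x,y). ennreal ((x * h \<rho> x) * (y powr (-1) * W \<rho> y)) \<partial>(lborel \<Otimes>\<^sub>M lborel)) \<le> ennreal (H * (1 + 1/\<rho>))"
    by (rule nn_integral_pair_product)
      (use \<rho> H_ge xh_integral[of \<rho>] yW_integral[of \<rho>] xh_nonneg W_nonneg in auto)
  have 2: "(\<integral>\<^sup>+(x,y). ennreal ((indicator {0<..<R} x * W \<rho> x) * (h \<rho> y * indicator {0<..} y)) \<partial>(lborel \<Otimes>\<^sub>M lborel))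
      \<le> ennreal (R * (2 + H))"
    by (rule nn_integral_pair_product)
      (use \<rho> R H_ge W_integral[of \<rho> R] hint h_nonneg W_nonneg in auto)
  have c0: "0 \<le> (1 + K0) * c * d" using f g K0_nonneg by (auto simp: Wbounded_def)
  show ?thesis
  proof (rule integrable_dominated(1))
    show "\<bar>case z of (x,y) \<Rightarrow> if x < R then k x y * f x * g y else 0\<bar> \<le> (case z of (x,y) \<Rightarrow> p x y)" for z
    proof (cases z)
      case (Pair x y)
      have p0: "0 \<le> p x y" unfolding p_def
        by (rule mult_nonneg_nonneg[OF c0 add_nonneg_nonneg])
          (rule mult_nonneg_nonneg, (simp_all add: xh_nonneg W_nonneg h_nonneg))+
      show ?thesis
      proof (cases "x \<le> 0 \<or> y \<le> 0 \<or> R \<le> x")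
        case True then show ?thesis using p0 Pair k_zero by auto
      next
        case False
        then have x: "0 < x" "0 < y" "x < R" by auto
        have "\<bar>k x y * f x * g y\<bar> = k x y * (\<bar>f x\<bar> * \<bar>g y\<bar>)" using k_nonneg[of x y] by (simp add: abs_mult)
        also have "\<dots> \<le> k x y * ((c * W \<rho> x) * (d * W \<rho> y))"
          using f g k_nonneg[of x y] W_nonneg by (intro mult_left_mono mult_mono) (auto simp: Wbounded_def)
        also have "\<dots> \<le> ((1+K0) * (x powr (-1-a) * y powr (-1) + y powr (-2-a))) * ((c * W \<rho> x) * (d * W \<rho> y))"
        proof (rule mult_right_mono)
          have "0 \<le> (1+K0) * (x powr (-1-a) * y powr (-1))" "0 \<le> (1+K0) * y powr (-2-a)"
            using K0_nonneg by auto
          then show "k x y \<le> (1+K0) * (x powr (-1-a) * y powr (-1) + y powr (-2-a))"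
            using k_left_le[of x y] k_right_le[of y x] x
            by (cases "x \<le> y") (auto simp: algebra_simps)
          show "0 \<le> (c * W \<rho> x) * (d * W \<rho> y)" using f g W_nonneg by (auto simp: Wbounded_def)
        qed
        also have "\<dots> = (1 + K0) * c * d * ((x powr (-1-a) * W \<rho> x) * (y powr (-1) * W \<rho> y)
            + W \<rho> x * (y powr (-2-a) * W \<rho> y))" by (simp add: algebra_simps)
        also have "\<dots> \<le> (1 + K0) * c * d * ((x * h \<rho> x) * (y powr (-1) * W \<rho> y) + W \<rho> x * h \<rho> y)"
          using x by (intro mult_left_mono add_mono mult_right_mono xW_le_h c0 W_nonneg mult_nonneg_nonneg) auto
        also have "\<dots> = p x y" using x by (simp add: p_def)
        finally show ?thesis using Pair x by simp
      qed
    qed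
    have "(\<integral>\<^sup>+z. ennreal (case z of (x,y) \<Rightarrow> p x y) \<partial>(lborel \<Otimes>\<^sub>M lborel)) =
      (\<integral>\<^sup>+z. ennreal ((1 + K0) * c * d) * (ennreal (case z of (x,y) \<Rightarrow> (x * h \<rho> x) * (y powr (-1) * W \<rho> y))
      + ennreal (case z of (x,y) \<Rightarrow> (indicator {0<..<R} x * W \<rho> x) * (h \<rho> y * indicator {0<..} y))) \<partial>(lborel \<Otimes>\<^sub>M lborel))"
      using c0 xh_nonneg W_nonneg h_nonneg
      by (intro nn_integral_cong) (auto simp: p_def simp flip: ennreal_mult ennreal_plus)
    also have "\<dots> = ennreal ((1 + K0) * c * d) * ((\<integral>\<^sup>+(x,y). ennreal ((x * h \<rho> x) * (y powr (-1) * W \<rho> y)) \<partial>(lborel \<Otimes>\<^sub>M lborel))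
       + (\<integral>\<^sup>+(x,y). ennreal ((indicator {0<..<R} x * W \<rho> x) * (h \<rho> y * indicator {0<..} y)) \<partial>(lborel \<Otimes>\<^sub>M lborel)))"
      by (subst nn_integral_cmult, measurable, subst nn_integral_add, measurable) (simp add: split_beta')
    also have "\<dots> \<le> ennreal ((1 + K0) * c * d) * (ennreal (H * (1 + 1/\<rho>)) + ennreal (R * (2 + H)))"
      by (intro mult_left_mono add_mono 1 2) auto
    also have "\<dots> = ennreal ((1 + K0) * c * d * (H * (1 + 1/\<rho>) + R * (2 + H)))"
      using c0 H_ge \<rho> R by (simp flip: ennreal_plus ennreal_mult)
    finally show "(\<integral>\<^sup>+z. ennreal (case z of (x,y) \<Rightarrow> p x y) \<partial>(lborel \<Otimes>\<^sub>M lborel))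
       \<le> ennreal ((1 + K0) * c * d * (H * (1 + 1/\<rho>) + R * (2 + H)))" .
    show "0 \<le> (1 + K0) * c * d * (H * (1 + 1/\<rho>) + R * (2 + H))" using c0 H_ge \<rho> R by auto
  qed measurable
qed

lemma Wbounded_nonpos: "Wbounded \<rho> c f \<Longrightarrow> x \<le> 0 \<Longrightarrow> f x = 0"
  using spec[of "\<lambda>x. \<bar>f x\<bar> \<le> c * W \<rho> x" x] by (simp add: Wbounded_def W_def)

lemma WboundedD: assumes "Wbounded \<rho> c f" shows "f \<in> borel_measurable borel" "0 \<le> c" "\<bar>f x\<bar> \<le> c * W \<rho> x"
  using assms by (auto simp: Wbounded_def)

lemma Wbounded_scale: "Wbounded \<rho> c f \<Longrightarrow> Wbounded \<rho> (\<bar>t\<bar> * c) (\<lambda>x. t * f x)"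
  by (auto simp: Wbounded_def abs_mult mult.assoc intro!: mult_left_mono)

lemma coag_op_integrable:
  assumes \<rho>: "0 < \<rho>" and f: "Wbounded \<rho> c f" and g: "Wbounded \<rho> d g"
  shows "integrable (lborel \<Otimes>\<^sub>M lborel) (\<lambda>(x,y). if x < \<xi> \<and> \<xi> < x + y then k x y * f x * g y else 0)"
proof (rule Bochner_Integration.integrable_bound[OF kernel_product_integrable[OF \<rho> f g, of "\<bar>\<xi>\<bar>"]])
  have [measurable]: "f \<in> borel_measurable borel" "g \<in> borel_measurable borel" using f g by (auto simp: Wbounded_def)
  show "(\<lambda>(x,y). if x < \<xi> \<and> \<xi> < x + y then k x y * f x * g y else 0) \<in> borel_measurable (lborel \<Otimes>\<^sub>M lborel)"
    by measurable
qed (auto intro!: AE_I2)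

lemma coag_op_diff_left:
  assumes \<rho>: "0 < \<rho>" and "Wbounded \<rho> c f" "Wbounded \<rho> c' f'" and g: "Wbounded \<rho> d g"
  shows "coag_op (\<lambda>x. f x - f' x) g \<xi> = coag_op f g \<xi> - coag_op f' g \<xi>"
  unfolding coag_op_def Bochner_Integration.integral_diff[OF coag_op_integrable[OF \<rho> assms(2) g] coag_op_integrable[OF \<rho> assms(3) g], symmetric]
  by (intro Bochner_Integration.integral_cong) (auto simp: algebra_simps)

lemma coag_op_diff_right:
  assumes \<rho>: "0 < \<rho>" and "Wbounded \<rho> c f" "Wbounded \<rho> c' f'" and g: "Wbounded \<rho> d g"
  shows "coag_op g (\<lambda>x. f x - f' x) \<xi> = coag_op g f \<xi> - coag_op g f' \<xi>"
  unfolding coag_op_def Bochner_Integration.integral_diff[OF coag_op_integrable[OF \<rho> g assms(2)] coag_op_integrable[OF \<rho> g assms(3)], symmetric]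
  by (intro Bochner_Integration.integral_cong) (auto simp: algebra_simps)

lemma coag_op_scale_left: "coag_op (\<lambda>x. t * f x) g \<xi> = t * coag_op f g \<xi>"
  unfolding coag_op_def unfolding integral_mult_right_zero[symmetric]
  by (intro Bochner_Integration.integral_cong) (auto simp: algebra_simps)

lemma lower_set_integrable:
  assumes "0 \<le> \<rho>" "Wbounded \<rho> c f" "S \<in> sets borel"
  shows "integrable lborel (\<lambda>x. indicator S x * (x powr (-1-a) * f x))"
  using integrable_mult_indicator[OF _ lower_integrable[OF assms(1,2)], of S] assms by simp

lemma upper_set_integrable:
  assumes "0 < \<rho>" "Wbounded \<rho> c f" "S \<in> sets borel"
  shows "integrable lborel (\<lambda>x. indicator S x * (x powr (-1) * f x))"
  using integrable_mult_indicator[OF _ upper_integrable[OF assms(1,2)], of S] assms by simp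

lemma lower_diff:
  assumes "0 \<le> \<rho>" "Wbounded \<rho> c f" "Wbounded \<rho> d g"
  shows "lower (\<lambda>x. f x - g x) \<xi> = lower f \<xi> - lower g \<xi>"
  unfolding lower_def Bochner_Integration.integral_diff[OF lower_set_integrable[OF assms(1,2), of "{..<\<xi>}", simplified]
    lower_set_integrable[OF assms(1,3), of "{..<\<xi>}", simplified], symmetric]
  by (intro Bochner_Integration.integral_cong) (auto simp: algebra_simps)

lemma upper_diff:
  assumes "0 < \<rho>" "Wbounded \<rho> c f" "Wbounded \<rho> d g"
  shows "upper (\<lambda>x. f x - g x) \<xi> = upper f \<xi> - upper g \<xi>"
  unfolding upper_def Bochner_Integration.integral_diff[OF upper_set_integrable[OF assms(1,2), of "{\<xi>..}", simplified]
    upper_set_integrable[OF assms(1,3), of "{\<xi>..}", simplified], symmetric]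
  by (intro Bochner_Integration.integral_cong) (auto simp: algebra_simps)

lemma lower_scale: "lower (\<lambda>x. t * f x) \<xi> = t * lower f \<xi>"
  unfolding lower_def unfolding integral_mult_right_zero[symmetric]
  by (intro Bochner_Integration.integral_cong) (auto simp: algebra_simps)

text \<open>For small \<open>\<xi>\<close> the function \<open>\<psi>\<close> will be \<open>f / A(\<xi>)\<close>; only its behaviour below \<open>\<xi>\<close> matters.\<close>

lemma coag_op_small_estimate:
  assumes \<rho>: "0 < \<rho>" and \<xi>: "0 < \<xi>" "\<xi> \<le> 1" and \<psi>: "Wbounded \<rho> c' \<psi>" and g: "Wbounded \<rho> d g" and c: "0 \<le> c"
    and \<psi>1: "\<And>x. 0 < x \<Longrightarrow> x < \<xi> \<Longrightarrow> \<bar>\<psi> x\<bar> \<le> c"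
    and \<psi>2: "(\<integral>\<^sup>+x. ennreal (indicator {0<..<\<xi>} x * (x powr (-1-a) * \<bar>\<psi> x\<bar>)) \<partial>lborel) \<le> ennreal c"
  shows "\<bar>coag_op \<psi> g \<xi> - lower \<psi> \<xi> * upper g \<xi>\<bar> \<le> (K0 * (1 + 1/\<delta>) + (1 + K0) * (1 + H)) * c * d"
proof -
  have [measurable]: "\<psi> \<in> borel_measurable borel" "g \<in> borel_measurable borel" using \<psi> g by (auto simp: Wbounded_def)
  have d: "0 \<le> d" and gd: "\<And>x. \<bar>g x\<bar> \<le> d * W \<rho> x" using g by (auto simp: Wbounded_def)
  define D where "D x y = (if x < \<xi> \<and> \<xi> < x + y then k x y * \<psi> x * g y else 0)
    - (indicator {..<\<xi>} x * (x powr (-1-a) * \<psi> x)) * (indicator {\<xi>..} y * (y powr (-1) * g y))" for x y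
  note pp = integral_pair_product[OF lower_set_integrable[OF less_imp_le[OF \<rho>] \<psi>, of "{..<\<xi>}"]
    upper_set_integrable[OF \<rho> g, of "{\<xi>..}"]]
  have eq: "coag_op \<psi> g \<xi> - lower \<psi> \<xi> * upper g \<xi> = (\<integral>(x,y). D x y \<partial>(lborel \<Otimes>\<^sub>M lborel))"
    unfolding coag_op_def lower_def upper_def D_def using pp coag_op_integrable[OF \<rho> \<psi> g, of \<xi>]
    by (subst pp(2)[symmetric], simp, simp, subst Bochner_Integration.integral_diff[symmetric]) (auto simp: split_beta')
  \<comment> \<open>\<open>q1\<close> dominates the kernel error on y \<ge> \<xi>, \<open>q2\<close>
    the triangle with x \<le> y, and \<open>q3\<close> the triangle with y \<le> x.\<close>
  define q1 where "q1 x y = (indicator {0<..<\<xi>} x * (x powr (-1-a) * \<bar>\<psi> x\<bar>)) * (y powr (-1-\<delta>) * W \<rho> y)" for x y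
  define q2 where "q2 x y = (if 0 < x \<and> x < \<xi> \<and> y < \<xi> \<and> \<xi> < x + y then x powr (-2-a) * \<bar>\<psi> x\<bar> else 0)" for x y
  define q3 where "q3 x y = (if 0 < y \<and> x < \<xi> \<and> y < \<xi> \<and> \<xi> < x + y then y powr (-2-a) * W \<rho> y else 0)" for x y
  have [measurable]: "(\<lambda>(x,y). q1 x y) \<in> borel_measurable (lborel \<Otimes>\<^sub>M lborel)"
    "(\<lambda>(x,y). q2 x y) \<in> borel_measurable (lborel \<Otimes>\<^sub>M lborel)" "(\<lambda>(x,y). q3 x y) \<in> borel_measurable (lborel \<Otimes>\<^sub>M lborel)"
    unfolding q1_def q2_def q3_def by measurable
  have nn: "0 \<le> q1 x y" "0 \<le> q2 x y" "0 \<le> q3 x y" for x y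
    by (auto simp: q1_def q2_def q3_def W_nonneg)
  have i1: "(\<integral>\<^sup>+(x,y). ennreal (q1 x y) \<partial>(lborel \<Otimes>\<^sub>M lborel)) \<le> ennreal (c * (1 + 1/\<delta>))"
    unfolding q1_def by (rule nn_integral_pair_product) (use c \<delta>_pos \<psi>2 yW\<delta>_integral[of \<rho>] \<rho> W_nonneg in auto)
  have i2: "(\<integral>\<^sup>+(x,y). ennreal (q2 x y) \<partial>(lborel \<Otimes>\<^sub>M lborel)) \<le> ennreal c"
  proof -
    have "(\<integral>\<^sup>+(x,y). ennreal (q2 x y) \<partial>(lborel \<Otimes>\<^sub>M lborel)) =
       (\<integral>\<^sup>+x. ennreal (indicator {0<..<\<xi>} x * (x * (x powr (-2-a) * \<bar>\<psi> x\<bar>))) \<partial>lborel)"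
      unfolding q2_def by (rule nn_integral_triangle_fst) auto
    also have "\<dots> = (\<integral>\<^sup>+x. ennreal (indicator {0<..<\<xi>} x * (x powr (-1-a) * \<bar>\<psi> x\<bar>)) \<partial>lborel)"
    proof (rule nn_integral_cong)
      fix x :: real
      have "x * x powr (-2-a) = x powr (-1-a)" if "0 < x" using that powr_mult_powr[of 1 "-2-a" "-1-a" x] by (simp add: powr_one')
      then show "ennreal (indicator {0<..<\<xi>} x * (x * (x powr (-2-a) * \<bar>\<psi> x\<bar>))) = ennreal (indicator {0<..<\<xi>} x * (x powr (-1-a) * \<bar>\<psi> x\<bar>))"
        by (auto simp: indicator_def simp flip: mult.assoc)
    qed
    finally show ?thesis using \<psi>2 by simp
  qed
  have i3: "(\<integral>\<^sup>+(x,y). ennreal (q3 x y) \<partial>(lborel \<Otimes>\<^sub>M lborel)) \<le> ennreal H"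
  proof -
    have "(\<integral>\<^sup>+(x,y). ennreal (q3 x y) \<partial>(lborel \<Otimes>\<^sub>M lborel)) =
       (\<integral>\<^sup>+x. ennreal (indicator {0<..<\<xi>} x * (x * (x powr (-2-a) * W \<rho> x))) \<partial>lborel)"
      unfolding q3_def by (rule nn_integral_triangle_snd) (auto simp: W_nonneg)
    also have "\<dots> \<le> (\<integral>\<^sup>+x. ennreal (x * h \<rho> x) \<partial>lborel)"
      using xW_le_h(2) xh_nonneg by (intro nn_integral_mono ennreal_leI) (auto simp: indicator_def intro: mult_left_mono)
    also have "\<dots> \<le> ennreal H" using \<rho> by (intro xh_integral) auto
    finally show ?thesis .
  qed
  have "\<bar>\<integral>z. (case z of (x,y) \<Rightarrow> D x y) \<partial>(lborel \<Otimes>\<^sub>M lborel)\<bar> \<le>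
     K0 * d * (c * (1 + 1/\<delta>)) + ((1 + K0) * d * c + (1 + K0) * c * d * H)"
  proof (rule integrable_dominated(2)[where q = "\<lambda>z. K0 * d * (case z of (x,y) \<Rightarrow> q1 x y) +
      ((1 + K0) * d * (case z of (x,y) \<Rightarrow> q2 x y) + (1 + K0) * c * d * (case z of (x,y) \<Rightarrow> q3 x y))"])
    show "(\<lambda>z. case z of (x,y) \<Rightarrow> D x y) \<in> borel_measurable (lborel \<Otimes>\<^sub>M lborel)" unfolding D_def by measurable
    show "(\<integral>\<^sup>+ z. ennreal (K0 * d * (case z of (x,y) \<Rightarrow> q1 x y) +
      ((1 + K0) * d * (case z of (x,y) \<Rightarrow> q2 x y) + (1 + K0) * c * d * (case z of (x,y) \<Rightarrow> q3 x y))) \<partial>(lborel \<Otimes>\<^sub>M lborel))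
      \<le> ennreal (K0 * d * (c * (1 + 1/\<delta>)) + ((1 + K0) * d * c + (1 + K0) * c * d * H))"
      using i1 i2 i3 K0_nonneg \<delta>_pos c d H_ge nn
      by (intro nn_integral_add_le nn_integral_cmult_le) (auto simp: split_beta')
    show "\<bar>case z of (x,y) \<Rightarrow> D x y\<bar> \<le> K0 * d * (case z of (x,y) \<Rightarrow> q1 x y) +
      ((1 + K0) * d * (case z of (x,y) \<Rightarrow> q2 x y) + (1 + K0) * c * d * (case z of (x,y) \<Rightarrow> q3 x y))" for z
    proof (cases z)
      case (Pair x y)
      have n: "0 \<le> K0 * d * q1 x y" "0 \<le> (1 + K0) * d * q2 x y" "0 \<le> (1 + K0) * c * d * q3 x y"
        using nn K0_nonneg c d by auto
      have "\<bar>D x y\<bar> \<le> K0 * d * q1 x y + ((1 + K0) * d * q2 x y + (1 + K0) * c * d * q3 x y)"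
      proof -
        consider "x \<le> 0 \<or> y \<le> 0 \<or> \<xi> \<le> x \<or> (y < \<xi> \<and> x + y \<le> \<xi>)" | "0 < x" "x < \<xi>" "\<xi> \<le> y"
          | "0 < x" "0 < y" "x < \<xi>" "y < \<xi>" "\<xi> < x + y" "x \<le> y"
          | "0 < x" "0 < y" "x < \<xi>" "y < \<xi>" "\<xi> < x + y" "y \<le> x" by linarith
        then show ?thesis
        proof cases
          case 1
          then have "D x y = 0" using Wbounded_nonpos[OF \<psi>, of x] Wbounded_nonpos[OF g, of y] \<xi>
            by (auto simp: D_def)
          then show ?thesis using n by simp
        next
          case 2
          then have "D x y = (k x y - x powr (-1-a) * y powr (-1)) * (\<psi> x * g y)"
            by (simp add: D_def algebra_simps)
          also have "\<bar>\<dots>\<bar> \<le> (K0 * x powr (-1-a+\<delta>) * y powr (-1-\<delta>)) * (\<bar>\<psi> x\<bar> * (d * W \<rho> y))"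
            unfolding abs_mult using 2 k_left[of x y] gd[of y] K0_nonneg by (intro mult_mono) auto
          also have "\<dots> = x powr \<delta> * (K0 * x powr (-1-a) * y powr (-1-\<delta>) * (\<bar>\<psi> x\<bar> * (d * W \<rho> y)))"
            by (simp add: powr_add)
          \<comment> \<open>The factor x^\<delta> of the kernel error is discarded, which is
            possible as x < \<xi> \<le> 1.\<close>
          also have "\<dots> \<le> 1 * (K0 * x powr (-1-a) * y powr (-1-\<delta>) * (\<bar>\<psi> x\<bar> * (d * W \<rho> y)))"
            using 2 \<xi> \<delta>_pos K0_nonneg d W_nonneg powr_mono2[of \<delta> x 1] by (intro mult_right_mono) auto
          also have "\<dots> = K0 * d * q1 x y" using 2 by (simp add: q1_def)
          finally show ?thesis using n by linarith
        next
          case 3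
          then have "\<bar>D x y\<bar> = k x y * (\<bar>\<psi> x\<bar> * \<bar>g y\<bar>)"
            using k_nonneg[of x y] by (simp add: D_def abs_mult)
          also have "\<dots> \<le> ((1 + K0) * x powr (-1-a) * x powr (-1)) * (\<bar>\<psi> x\<bar> * (d * 1))"
          proof (intro mult_mono)
            \<comment> \<open>Trading y^(-1) for x^(-1) leaves a function of x alone; the section
              length x then restores the weight x^(-1-a).\<close>
            have "y powr (-1) \<le> x powr (-1)" using 3 by (intro powr_mono2') auto
            then have "(1 + K0) * x powr (-1-a) * y powr (-1) \<le> (1 + K0) * x powr (-1-a) * x powr (-1)"
              using K0_nonneg by (intro mult_left_mono) auto
            then show "k x y \<le> (1 + K0) * x powr (-1-a) * x powr (-1)" using k_left_le[of x y] 3 by linarith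
            show "\<bar>g y\<bar> \<le> d * 1" using gd[of y] mult_left_mono[OF W_le_1[of \<rho> y] d] \<rho> by linarith
          qed (use K0_nonneg in auto)
          also have "\<dots> = (1 + K0) * d * (x powr (-1-a) * x powr (-1) * \<bar>\<psi> x\<bar>)" by simp
          also have "x powr (-1-a) * x powr (-1) = x powr (-2-a)" by (rule powr_mult_powr) simp
          also have "x powr (-2-a) * \<bar>\<psi> x\<bar> = q2 x y" using 3 by (simp add: q2_def)
          finally show ?thesis using n by linarith
        next
          case 4
          then have "\<bar>D x y\<bar> = k x y * (\<bar>\<psi> x\<bar> * \<bar>g y\<bar>)"
            using k_nonneg[of x y] by (simp add: D_def abs_mult)
          also have "\<dots> \<le> ((1 + K0) * y powr (-2-a)) * (c * (d * W \<rho> y))"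
            using 4 k_right_le[of y x] \<psi>1[of x] gd[of y] c K0_nonneg by (intro mult_mono) auto
          also have "\<dots> = (1 + K0) * c * d * q3 x y" using 4 by (simp add: q3_def)
          finally show ?thesis using n by linarith
        qed
      qed
      then show ?thesis using Pair by simp
    qed
    show "0 \<le> K0 * d * (c * (1 + 1/\<delta>)) + ((1 + K0) * d * c + (1 + K0) * c * d * H)"
      using K0_nonneg \<delta>_pos c d H_ge by auto
  qed
  also have "\<dots> = (K0 * (1 + 1/\<delta>) + (1 + K0) * (1 + H)) * c * d" by (simp add: algebra_simps)
  finally show ?thesis unfolding eq .
qed

text \<open>For almost every (x, y) the integrand is eventually constant along the sequence: the
  exceptions lie on the null lines x = \<xi> and x + y = \<xi>. No continuity of f or g is used, so
  the operator also smooths a profile that jumps at 1.\<close>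

lemma coag_op_continuous:
  assumes \<rho>: "0 < \<rho>" and f: "Wbounded \<rho> c f" and g: "Wbounded \<rho> d g"
  shows "continuous_on UNIV (coag_op f g)"
  unfolding continuous_on_sequentially
proof (intro allI ballI impI, elim conjE)
  have [measurable]: "f \<in> borel_measurable borel" "g \<in> borel_measurable borel" using f g by (auto simp: Wbounded_def)
  fix X :: "nat \<Rightarrow> real" and \<xi> assume lim: "X \<longlonglongrightarrow> \<xi>"
  then obtain R where R: "\<And>n. X n \<le> R" "0 \<le> R"
    using convergent_imp_Bseq[of X] unfolding convergent_def Bseq_def by (metis abs_le_D1 less_imp_le real_norm_def)
  have "(\<lambda>n. \<integral>z. (case z of (x,y) \<Rightarrow> if x < X n \<and> X n < x + y then k x y * f x * g y else 0) \<partial>(lborel \<Otimes>\<^sub>M lborel))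
     \<longlonglongrightarrow> (\<integral>z. (case z of (x,y) \<Rightarrow> if x < \<xi> \<and> \<xi> < x + y then k x y * f x * g y else 0) \<partial>(lborel \<Otimes>\<^sub>M lborel))"
  proof (rule integral_dominated_convergence)
    show "integrable (lborel \<Otimes>\<^sub>M lborel) (\<lambda>z. norm (case z of (x,y) \<Rightarrow> if x < R then k x y * f x * g y else 0))"
      by (intro integrable_norm kernel_product_integrable[OF \<rho> f g] R)
    show "AE z in lborel \<Otimes>\<^sub>M lborel. (\<lambda>n. case z of (x,y) \<Rightarrow> if x < X n \<and> X n < x + y then k x y * f x * g y else 0)
      \<longlonglongrightarrow> (case z of (x,y) \<Rightarrow> if x < \<xi> \<and> \<xi> < x + y then k x y * f x * g y else 0)"
    proof -
      have "AE z in lborel \<Otimes>\<^sub>M lborel. fst z \<noteq> \<xi> \<and> \<xi> \<noteq> fst z + snd z"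
      proof (rule lborel_pair.AE_pair_measure)
        show "{z \<in> space (lborel \<Otimes>\<^sub>M lborel). fst z \<noteq> \<xi> \<and> \<xi> \<noteq> fst z + snd z} \<in> sets (lborel \<Otimes>\<^sub>M lborel)"
          by measurable
        have "AE x in lborel. x \<noteq> \<xi>" by (rule AE_lborel_singleton)
        then show "AE x in lborel. AE y in lborel. fst (x,y) \<noteq> \<xi> \<and> \<xi> \<noteq> fst (x,y) + snd (x,y)"
        proof eventually_elim
          case (elim x)
          have "AE y in lborel. y \<noteq> \<xi> - x" by (rule AE_lborel_singleton)
          then show ?case by eventually_elim (use elim in auto)
        qed
      qed
      then show ?thesis
      proof (rule AE_mp, intro AE_I2 impI)
        fix z :: "real \<times> real" assume z: "fst z \<noteq> \<xi> \<and> \<xi> \<noteq> fst z + snd z"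
        obtain x y where xy: "z = (x,y)" by (cases z)
        have "\<forall>\<^sub>F n in sequentially. (x < X n \<longleftrightarrow> x < \<xi>)"
        proof (cases "x < \<xi>")
          case True then show ?thesis using order_tendstoD(1)[OF lim, of x] by (auto elim: eventually_mono)
        next
          case False then show ?thesis using order_tendstoD(2)[OF lim, of x] z xy by (auto elim: eventually_mono)
        qed
        moreover have "\<forall>\<^sub>F n in sequentially. (X n < x + y \<longleftrightarrow> \<xi> < x + y)"
        proof (cases "\<xi> < x + y")
          case True then show ?thesis using order_tendstoD(2)[OF lim, of "x+y"] by (auto elim: eventually_mono)
        next
          case False then show ?thesis using order_tendstoD(1)[OF lim, of "x+y"] z xy by (auto elim: eventually_mono)
        qed
        ultimately have "\<forall>\<^sub>F n in sequentially. (if x < X n \<and> X n < x + y then k x y * f x * g y else 0)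
           = (if x < \<xi> \<and> \<xi> < x + y then k x y * f x * g y else 0)" by eventually_elim auto
        then show "(\<lambda>n. case z of (x,y) \<Rightarrow> if x < X n \<and> X n < x + y then k x y * f x * g y else 0)
          \<longlonglongrightarrow> (case z of (x,y) \<Rightarrow> if x < \<xi> \<and> \<xi> < x + y then k x y * f x * g y else 0)"
          using xy by (simp add: tendsto_eventually)
      qed
    qed
    show "AE z in lborel \<Otimes>\<^sub>M lborel. norm (case z of (x,y) \<Rightarrow> if x < X n \<and> X n < x + y then k x y * f x * g y else 0)
      \<le> norm (case z of (x,y) \<Rightarrow> if x < R then k x y * f x * g y else 0)" for n
      using R(1)[of n] by (intro AE_I2) (auto split: if_splits)
  qed measurable
  then show "(coag_op f g \<circ> X) \<longlonglongrightarrow> coag_op f g \<xi>" by (simp add: coag_op_def comp_def)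
qed

section \<open>The operator at large arguments\<close>

text \<open>The second condition replaces a modulus of continuity: since \<open>Q\<close> varies slowly, so does \<open>f\<close>. It is linear in
  \<open>f\<close>, so that it also makes sense for differences of solutions.\<close>

definition regular :: "real \<Rightarrow> real \<Rightarrow> (real \<Rightarrow> real) \<Rightarrow> bool" where
  "regular \<rho> c f \<longleftrightarrow> Wbounded \<rho> c f \<and> (\<forall>x>1. \<bar>f x - \<rho> * upper f x\<bar> \<le> c * x powr (-\<delta>) * W \<rho> x)"

lemma powr_half_le:
  assumes "0 < \<xi>" "\<xi> / 2 \<le> x"
  shows "x powr (-\<delta>) \<le> 2 * \<xi> powr (-\<delta>)"
proof -
  have "\<xi> powr \<delta> \<le> (2 * x) powr \<delta>" using assms \<delta>_pos by (intro powr_mono2) auto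
  also have "\<dots> = 2 powr \<delta> * x powr \<delta>" using assms by (simp add: powr_mult)
  also have "\<dots> \<le> 2 * x powr \<delta>" using powr_mono[of \<delta> 1 2] \<delta>_less_1
    by (intro mult_right_mono) (auto simp: powr_one')
  finally show ?thesis using assms by (simp add: powr_minus divide_simps)
qed

text \<open>The integral of y^(-1-\<rho>) over (\<xi>, \<infinity>) is \<xi>^(-\<rho>) / \<rho>. The
  prefactor \<rho> cancels the denominator and the bound stays uniform in \<rho>.\<close>

lemma upper_abs_le:
  assumes "0 < \<rho>" "Wbounded \<rho> c f" "1 \<le> \<xi>"
  shows "\<bar>\<rho> * upper f \<xi>\<bar> \<le> c * W \<rho> \<xi>"
proof -
  note f = WboundedD[OF assms(2)]
  have [measurable]: "f \<in> borel_measurable borel" by (rule f)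
  have "\<bar>upper f \<xi>\<bar> \<le> c * (\<xi> powr (-\<rho>) / \<rho>)" unfolding upper_def
  proof (rule integrable_dominated(2))
    show "\<bar>indicator {\<xi>..} y * (y powr (-1) * f y)\<bar> \<le> c * (indicator {\<xi>..} y * y powr (-1-\<rho>))" for y
    proof (cases "\<xi> \<le> y")
      case True
      then have "y powr (-1) * \<bar>f y\<bar> \<le> y powr (-1) * (c * W \<rho> y)" by (intro mult_left_mono f) auto
      also have "\<dots> = c * (y powr (-1) * y powr (-\<rho>))" using True assms by (simp add: W_ge_1)
      also have "y powr (-1) * y powr (-\<rho>) = y powr (-1-\<rho>)" by (rule powr_mult_powr) simp
      finally show ?thesis using True by (simp add: abs_mult)
    qed simp
    show "(\<integral>\<^sup>+y. ennreal (c * (indicator {\<xi>..} y * y powr (-1-\<rho>))) \<partial>lborel) \<le> ennreal (c * (\<xi> powr (-\<rho>) / \<rho>))"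
      using assms f nn_integral_powr_tail[of \<rho> \<xi>] by (intro nn_integral_cmult_le) auto
    show "0 \<le> c * (\<xi> powr (-\<rho>) / \<rho>)" using f assms by auto
  qed measurable
  then have "\<rho> * \<bar>upper f \<xi>\<bar> \<le> \<rho> * (c * (\<xi> powr (-\<rho>) / \<rho>))" using assms by (intro mult_left_mono) auto
  then show ?thesis using assms by (simp add: abs_mult W_ge_1)
qed

text \<open>On the interval of integration y \<ge> \<xi> / 2; this costs one factor 2 for 1/y and
  one for the weight, hence the 4.\<close>

lemma upper_increment:
  assumes "0 < \<rho>" "\<rho> \<le> 1" "Wbounded \<rho> c f" "1 \<le> x" "x \<le> \<xi>" "\<xi> / 2 \<le> x"
  shows "\<bar>upper f x - upper f \<xi>\<bar> \<le> 4 * c * W \<rho> \<xi> * ((\<xi> - x) / \<xi>)"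
proof -
  note f = WboundedD[OF assms(3)]
  have [measurable]: "f \<in> borel_measurable borel" by (rule f)
  have "upper f x - upper f \<xi> = (\<integral>y. indicator {x..<\<xi>} y * (y powr (-1) * f y) \<partial>lborel)"
    unfolding upper_def Bochner_Integration.integral_diff[OF upper_set_integrable[OF assms(1,3), of "{x..}", simplified]
      upper_set_integrable[OF assms(1,3), of "{\<xi>..}", simplified], symmetric]
    using assms by (intro Bochner_Integration.integral_cong) (auto split: split_indicator)
  also have "\<bar>\<dots>\<bar> \<le> (4 * c * W \<rho> \<xi> / \<xi>) * (\<xi> - x)"
  proof (rule integrable_dominated(2))
    show "\<bar>indicator {x..<\<xi>} y * (y powr (-1) * f y)\<bar> \<le> (4 * c * W \<rho> \<xi> / \<xi>) * indicator {x..<\<xi>} y" for y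
    proof (cases "y \<in> {x..<\<xi>}")
      case True
      then have y: "x \<le> y" "y < \<xi>" by auto
      have "y powr (-1) \<le> (\<xi>/2) powr (-1)" using y assms by (intro powr_mono2') auto
      then have "y powr (-1) \<le> 2 / \<xi>" using assms by (simp add: powr_neg_one)
      moreover have "\<bar>f y\<bar> \<le> c * (2 * W \<rho> \<xi>)"
        using f(3)[of y] mult_left_mono[OF W_le_2W[of \<rho> \<xi> y], of c] assms y f(2) by auto
      ultimately have "y powr (-1) * \<bar>f y\<bar> \<le> 2 / \<xi> * (c * (2 * W \<rho> \<xi>))"
        using assms by (intro mult_mono) auto
      then show ?thesis using True by (simp add: abs_mult)
    qed simp
    have c: "0 \<le> 4 * c * W \<rho> \<xi> / \<xi>" using f W_nonneg[of \<rho> \<xi>] assms by auto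
    have "(\<integral>\<^sup>+y. ennreal (indicator {x..<\<xi>} y) \<partial>lborel) = ennreal (\<xi> - x)"
      using assms by (simp add: ennreal_indicator)
    then show "(\<integral>\<^sup>+y. ennreal (4 * c * W \<rho> \<xi> / \<xi> * indicator {x..<\<xi>} y) \<partial>lborel)
      \<le> ennreal (4 * c * W \<rho> \<xi> / \<xi> * (\<xi> - x))"
      using assms c by (intro nn_integral_cmult_le) auto
    show "0 \<le> 4 * c * W \<rho> \<xi> / \<xi> * (\<xi> - x)" by (rule mult_nonneg_nonneg[OF c]) (use assms in simp)
  qed measurable
  finally show ?thesis by simp
qed

text \<open>Regularity replaces f x by \<rho> Q(x), after which only the increment of Q between x
  and \<xi> remains, and Q has an explicit derivative. No increment of f is ever estimated
  directly.\<close>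

lemma regular_modulus:
  assumes \<rho>: "0 < \<rho>" "\<rho> \<le> 1" and f: "regular \<rho> c f" and \<xi>: "1 \<le> \<xi>" and x: "\<xi> / 2 \<le> x" "x < \<xi>" and y: "0 < y" "y < \<xi>" "\<xi> < x + y"
  shows "\<bar>f x - \<rho> * upper f \<xi>\<bar> \<le> 6 * c * W \<rho> \<xi> * \<xi> powr (-\<delta>) * (1 + y powr \<delta>)"
proof -
  have f': "Wbounded \<rho> c f" using f by (simp add: regular_def)
  note fb = WboundedD[OF f']
  have W2: "W \<rho> x \<le> 2 * W \<rho> \<xi>" using \<rho> \<xi> x by (intro W_le_2W) auto
  have cW: "0 \<le> c * W \<rho> \<xi>" using fb(2) W_nonneg by simp
  show ?thesis
  proof (cases "x \<le> 1")
    case True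
    have "\<bar>f x\<bar> \<le> c * (2 * W \<rho> \<xi>)" using fb(3)[of x] mult_left_mono[OF W2 fb(2)] by linarith
    then have 1: "\<bar>f x - \<rho> * upper f \<xi>\<bar> \<le> 3 * (c * W \<rho> \<xi>)" using upper_abs_le[OF \<rho>(1) f' \<xi>] by linarith
    \<comment> \<open>In this case \<xi> < 2, so \<xi>^(-\<delta>) is at least 1/2 and plain size
      bounds suffice.\<close>
    have "1 = (1::real) powr (-\<delta>)" by simp
    also have "\<dots> \<le> 2 * \<xi> powr (-\<delta>)" using True x \<xi> by (intro powr_half_le) auto
    finally have "1 \<le> 2 * \<xi> powr (-\<delta>)" .
    then have "1 * 1 \<le> (2 * \<xi> powr (-\<delta>)) * (1 + y powr \<delta>)" by (intro mult_mono) auto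
    then have "3 * (c * W \<rho> \<xi>) * (1 * 1) \<le> 3 * (c * W \<rho> \<xi>) * (2 * \<xi> powr (-\<delta>) * (1 + y powr \<delta>))"
      using cW by (intro mult_left_mono) auto
    with 1 show ?thesis by (simp add: mult_ac)
  next
    case False
    have "\<bar>f x - \<rho> * upper f x\<bar> \<le> c * x powr (-\<delta>) * W \<rho> x" using f False by (auto simp: regular_def)
    also have "\<dots> \<le> c * (2 * \<xi> powr (-\<delta>)) * (2 * W \<rho> \<xi>)"
      using fb(2) W2 powr_half_le[of \<xi> x] x \<xi> W_nonneg by (intro mult_mono mult_nonneg_nonneg) auto
    finally have 1: "\<bar>f x - \<rho> * upper f x\<bar> \<le> 4 * (c * W \<rho> \<xi>) * \<xi> powr (-\<delta>)" by (simp add: mult_ac)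
    have "\<bar>\<rho> * (upper f x - upper f \<xi>)\<bar> \<le> 1 * (4 * c * W \<rho> \<xi> * ((\<xi> - x) / \<xi>))"
      unfolding abs_mult using upper_increment[OF \<rho> f', of x \<xi>] False \<rho> x by (intro mult_mono) auto
    also have "\<dots> \<le> 4 * c * W \<rho> \<xi> * (\<xi> powr (-\<delta>) * y powr \<delta>)"
    proof -
      \<comment> \<open>The constraint \<xi> < x + y gives \<xi> - x < y. Since y < \<xi>, lowering
        the exponent from 1 to \<delta> enlarges the bound.\<close>
      have "(\<xi> - x) / \<xi> \<le> y / \<xi>" using \<xi> y x by (intro divide_right_mono) auto
      also have "\<dots> = (y/\<xi>) powr 1" using y \<xi> by (simp add: powr_one')
      also have "\<dots> \<le> (y / \<xi>) powr \<delta>" using y \<xi> \<delta>_less_1 by (intro powr_mono') auto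
      also have "\<dots> = \<xi> powr (-\<delta>) * y powr \<delta>" using y \<xi> by (simp add: powr_divide powr_minus field_simps)
      finally show ?thesis
        unfolding mult_1 using cW mult_left_mono[of "(\<xi> - x) / \<xi>" "\<xi> powr (-\<delta>) * y powr \<delta>" "4 * c * W \<rho> \<xi>"] by simp
    qed
    finally have 2: "\<bar>\<rho> * (upper f x - upper f \<xi>)\<bar> \<le> 4 * (c * W \<rho> \<xi>) * \<xi> powr (-\<delta>) * y powr \<delta>" by (simp add: mult_ac)
    have n: "0 \<le> c * W \<rho> \<xi> * \<xi> powr (-\<delta>)" "0 \<le> c * W \<rho> \<xi> * \<xi> powr (-\<delta>) * y powr \<delta>" using cW by auto
    have "\<bar>f x - \<rho> * upper f \<xi>\<bar> \<le> \<bar>f x - \<rho> * upper f x\<bar> + \<bar>\<rho> * (upper f x - upper f \<xi>)\<bar>"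
      by (simp add: algebra_simps)
    also have "\<dots> \<le> 6 * c * W \<rho> \<xi> * \<xi> powr (-\<delta>) * (1 + y powr \<delta>)"
      using 1 2 n by (simp add: algebra_simps)
    finally show ?thesis .
  qed
qed

text \<open>The larger of x and y is at least \<xi> / 2. If it is y, each of the two terms is small
  by itself. If it is x, then k x y is close to y^(-2-a) and f x is close to \<rho> Q(\<xi>), and
  only the difference is small.\<close>

lemma triangle_pointwise:
  assumes \<rho>: "0 < \<rho>" "\<rho> \<le> 1" and f: "regular \<rho> c f" and g: "Wbounded \<rho> d g" and \<xi>: "1 \<le> \<xi>"
    and x: "0 < x" "x < \<xi>" and y: "0 < y" "y < \<xi>" "\<xi> < x + y"
  shows "\<bar>k x y * f x * g y - y powr (-2-a) * g y * (\<rho> * upper f \<xi>)\<bar>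
     \<le> (6 + 4 * K0) * c * d * W \<rho> \<xi> * \<xi> powr (-\<delta>) * (h \<rho> x + h \<rho> y)"
proof -
  have f': "Wbounded \<rho> c f" using f by (simp add: regular_def)
  note fb = WboundedD[OF f'] and gb = WboundedD[OF g]
  define B where "B = c * d * W \<rho> \<xi> * \<xi> powr (-\<delta>)"
  have B0: "0 \<le> B" using fb(2) gb(2) W_nonneg by (simp add: B_def)
  have hn: "0 \<le> B * h \<rho> x" "0 \<le> B * h \<rho> y" "0 \<le> K0 * (B * h \<rho> x)" "0 \<le> K0 * (B * h \<rho> y)"
    using B0 h_nonneg K0_nonneg by auto
  have F: "\<bar>\<rho> * upper f \<xi>\<bar> \<le> c * W \<rho> \<xi>" by (rule upper_abs_le[OF \<rho>(1) f' \<xi>])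
  have "\<bar>k x y * f x * g y - y powr (-2-a) * g y * (\<rho> * upper f \<xi>)\<bar> \<le> (6 + 4 * K0) * (B * h \<rho> x) + (6 + 4 * K0) * (B * h \<rho> y)"
  proof (cases "x \<le> y")
    case True
    then have yh: "\<xi> / 2 \<le> y" using y by simp
    have "\<bar>k x y * f x * g y\<bar> = k x y * (\<bar>f x\<bar> * \<bar>g y\<bar>)" using k_nonneg[of x y] by (simp add: abs_mult)
    also have "\<dots> \<le> ((1 + K0) * x powr (-1-a) * (2 * \<xi> powr (-\<delta>) * x powr (\<delta> - 1))) * ((c * W \<rho> x) * (d * (2 * W \<rho> \<xi>)))"
    proof (intro mult_mono)
      \<comment> \<open>The gain is extracted by splitting \<xi>^(-1) into \<xi>^(-\<delta>) and
        \<xi>^(\<delta>-1). As \<delta> < 1 and x < \<xi>, the second factor is at most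
        x^(\<delta>-1) and joins the weight in x.\<close>
      have "y powr (-1) \<le> (\<xi>/2) powr (-1)" using yh \<xi> by (intro powr_mono2') auto
      also have "\<dots> = 2 * (\<xi> powr (-\<delta>) * \<xi> powr (\<delta> - 1))"
        using \<xi> powr_mult_powr[of "-\<delta>" "\<delta>-1" "-1" \<xi>] by (simp add: powr_neg_one)
      also have "\<dots> \<le> 2 * (\<xi> powr (-\<delta>) * x powr (\<delta> - 1))"
        using x \<delta>_less_1 by (intro mult_left_mono powr_mono2') auto
      finally have "(1 + K0) * x powr (-1-a) * y powr (-1) \<le> (1 + K0) * x powr (-1-a) * (2 * \<xi> powr (-\<delta>) * x powr (\<delta> - 1))"
        using K0_nonneg by (intro mult_left_mono) auto
      then show "k x y \<le> (1 + K0) * x powr (-1-a) * (2 * \<xi> powr (-\<delta>) * x powr (\<delta> - 1))"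
        using k_left_le[of x y] x True by linarith
      show "\<bar>g y\<bar> \<le> d * (2 * W \<rho> \<xi>)"
        using gb(3)[of y] mult_left_mono[OF W_le_2W[of \<rho> \<xi> y] gb(2)] \<rho> \<xi> yh by linarith
    qed (use fb gb W_nonneg K0_nonneg in auto)
    also have "\<dots> = 4 * (1 + K0) * B * ((x powr (-1-a) * x powr (\<delta>-1)) * W \<rho> x)" by (simp add: B_def)
    also have "x powr (-1-a) * x powr (\<delta>-1) = x powr (-2-a+\<delta>)" by (rule powr_mult_powr) simp
    also have "4 * (1 + K0) * B * (x powr (-2-a+\<delta>) * W \<rho> x) \<le> 4 * (1 + K0) * B * h \<rho> x"
      using xW_le_h(4)[OF x(1)] K0_nonneg B0 by (intro mult_left_mono) auto
    finally have 1: "\<bar>k x y * f x * g y\<bar> \<le> 4 * (1 + K0) * B * h \<rho> x" .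
    have "\<bar>y powr (-2-a) * g y * (\<rho> * upper f \<xi>)\<bar> = y powr (-2-a) * (\<bar>g y\<bar> * \<bar>\<rho> * upper f \<xi>\<bar>)"
      by (simp add: abs_mult)
    also have "\<dots> \<le> y powr (-2-a) * ((d * W \<rho> y) * (c * W \<rho> \<xi>))"
      using gb F W_nonneg by (intro mult_left_mono mult_mono) auto
    also have "\<dots> = 1 * (y powr (-2-a) * ((d * W \<rho> y) * (c * W \<rho> \<xi>)))" by simp
    also have "\<dots> \<le> (2 * (\<xi> powr (-\<delta>) * y powr \<delta>)) * (y powr (-2-a) * ((d * W \<rho> y) * (c * W \<rho> \<xi>)))"
    proof (rule mult_right_mono)
      \<comment> \<open>As y \<ge> \<xi> / 2, the number 1 may be replaced by a multiple of
        \<xi>^(-\<delta>) * y^\<delta>; this produces the decay at the price of a power that h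
        absorbs.\<close>
      have "y powr (-\<delta>) * y powr \<delta> \<le> 2 * \<xi> powr (-\<delta>) * y powr \<delta>"
        using powr_half_le[of \<xi> y] \<xi> yh by (intro mult_right_mono) auto
      then show "1 \<le> 2 * (\<xi> powr (-\<delta>) * y powr \<delta>)" using y by (simp flip: powr_add)
      show "0 \<le> y powr (-2-a) * ((d * W \<rho> y) * (c * W \<rho> \<xi>))" using gb fb W_nonneg by auto
    qed
    also have "\<dots> = 2 * B * ((y powr (-2-a) * y powr \<delta>) * W \<rho> y)" by (simp add: B_def)
    also have "y powr (-2-a) * y powr \<delta> = y powr (-2-a+\<delta>)" by (rule powr_mult_powr) simp
    also have "2 * B * (y powr (-2-a+\<delta>) * W \<rho> y) \<le> 2 * B * h \<rho> y"
      using xW_le_h(4)[OF y(1)] B0 by (intro mult_left_mono) auto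
    finally have 2: "\<bar>y powr (-2-a) * g y * (\<rho> * upper f \<xi>)\<bar> \<le> 2 * B * h \<rho> y" .
    show ?thesis using 1 2 hn by (simp add: algebra_simps)
  next
    case False
    then have xh: "\<xi> / 2 \<le> x" using y by simp
    have "\<bar>(k x y - y powr (-2-a)) * (f x * g y)\<bar> \<le> (K0 * y powr (-2-a+\<delta>) * (2 * \<xi> powr (-\<delta>))) * ((c * (2 * W \<rho> \<xi>)) * (d * W \<rho> y))"
      unfolding abs_mult
    proof (intro mult_mono)
      have "K0 * y powr (-2-a+\<delta>) * x powr (-\<delta>) \<le> K0 * y powr (-2-a+\<delta>) * (2 * \<xi> powr (-\<delta>))"
        using K0_nonneg powr_half_le[of \<xi> x] xh \<xi> by (intro mult_left_mono) auto
      then show "\<bar>k x y - y powr (-2-a)\<bar> \<le> K0 * y powr (-2-a+\<delta>) * (2 * \<xi> powr (-\<delta>))"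
        using k_right[of y x] False y by linarith
      show "\<bar>f x\<bar> \<le> c * (2 * W \<rho> \<xi>)"
        using fb(3)[of x] mult_left_mono[OF W_le_2W[of \<rho> \<xi> x] fb(2)] \<rho> \<xi> xh by linarith
    qed (use fb gb W_nonneg K0_nonneg in auto)
    also have "\<dots> = 4 * K0 * B * (y powr (-2-a+\<delta>) * W \<rho> y)" by (simp add: B_def)
    also have "\<dots> \<le> 4 * K0 * B * h \<rho> y"
      using xW_le_h(4)[OF y(1)] B0 K0_nonneg by (intro mult_left_mono) auto
    finally have 1: "\<bar>(k x y - y powr (-2-a)) * (f x * g y)\<bar> \<le> 4 * K0 * B * h \<rho> y" .
    have "\<bar>y powr (-2-a) * g y * (f x - \<rho> * upper f \<xi>)\<bar> = y powr (-2-a) * (\<bar>g y\<bar> * \<bar>f x - \<rho> * upper f \<xi>\<bar>)"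
      by (simp add: abs_mult)
    also have "\<dots> \<le> y powr (-2-a) * ((d * W \<rho> y) * (6 * c * W \<rho> \<xi> * \<xi> powr (-\<delta>) * (1 + y powr \<delta>)))"
      using gb regular_modulus[OF \<rho> f \<xi> xh x(2) y] W_nonneg by (intro mult_left_mono mult_mono) auto
    also have "\<dots> = 6 * B * h \<rho> y" by (simp add: B_def h_def)
    finally have 2: "\<bar>y powr (-2-a) * g y * (f x - \<rho> * upper f \<xi>)\<bar> \<le> 6 * B * h \<rho> y" .
    \<comment> \<open>The kernel error and the modulus of f are separated by adding and subtracting
      y^(-2-a) * f x * g y.\<close>
    have "k x y * f x * g y - y powr (-2-a) * g y * (\<rho> * upper f \<xi>)
        = (k x y - y powr (-2-a)) * (f x * g y) + y powr (-2-a) * g y * (f x - \<rho> * upper f \<xi>)"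
      by (simp add: algebra_simps)
    then show ?thesis using 1 2 hn by (simp add: algebra_simps)
  qed
  then show ?thesis by (simp add: B_def algebra_simps)
qed

text \<open>The main term \<open>A\<^sub>f Q\<^sub>g\<close> comes from \<open>x < \<xi> \<le> y\<close>. The term \<open>\<rho> Q\<^sub>f A\<^sub>g\<close> comes from small \<open>y\<close>, where \<open>x\<close> runs over
  \<open>(\<xi> - y, \<xi>)\<close> and \<open>f x \<approx> \<rho> Q\<^sub>f \<xi>\<close>.\<close>

lemma coag_op_large_estimate:
  assumes \<rho>: "0 < \<rho>" "\<rho> \<le> 1" and f: "regular \<rho> c f" and g: "Wbounded \<rho> d g" and \<xi>: "1 \<le> \<xi>"
  shows "\<bar>coag_op f g \<xi> - lower f \<xi> * upper g \<xi> - \<rho> * upper f \<xi> * lower g \<xi>\<bar>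
      \<le> (K0 * H / \<delta> + 2 * (6 + 4 * K0) * H) * c * d * W \<rho> \<xi> * \<xi> powr (-\<delta>)"
proof -
  have f': "Wbounded \<rho> c f" using f by (simp add: regular_def)
  note fb = WboundedD[OF f'] and gb = WboundedD[OF g]
  have [measurable]: "f \<in> borel_measurable borel" "g \<in> borel_measurable borel" by (rule fb gb)+
  define F where "F = \<rho> * upper f \<xi>"
  \<comment> \<open>All three quantities are written as integrals over the same product space, so
    that the estimate becomes pointwise.\<close>
  define D where "D x y = (if x < \<xi> \<and> \<xi> < x + y then k x y * f x * g y else 0)
    - (indicator {..<\<xi>} x * (x powr (-1-a) * f x)) * (indicator {\<xi>..} y * (y powr (-1) * g y))
    - (if x < \<xi> \<and> y < \<xi> \<and> \<xi> < x + y then y powr (-2-a) * g y * F else 0)" for x y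
  have \<rho>0: "0 \<le> \<rho>" using \<rho> by simp
  note pp = integral_pair_product[OF lower_set_integrable[OF \<rho>0 f', of "{..<\<xi>}"]
    upper_set_integrable[OF \<rho>(1) g, of "{\<xi>..}"]]
  \<comment> \<open>The section length y turns the triangle integral with weight y^(-2-a) into
    \<open>F * lower g \<xi>\<close>.\<close>
  have yy: "y * (y powr (-2-a) * g y * F) = F * (y powr (-1-a) * g y)" for y
  proof (cases "y \<le> 0")
    case False
    have "y * (y powr (-2-a) * g y * F) = (y * y powr (-2-a)) * (g y * F)" by (simp only: mult_ac)
    also have "y * y powr (-2-a) = y powr (-1-a)"
      using False powr_mult_powr[of 1 "-2-a" "-1-a" y] by (simp add: powr_one')
    finally show ?thesis by simp
  qed (use Wbounded_nonpos[OF g, of y] in simp)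
  have "integrable lborel (\<lambda>y. y * (y powr (-2-a) * g y * F))"
    unfolding yy using lower_integrable[OF \<rho>0 g] by simp
  note tt = integral_triangle_snd[of "\<lambda>y. y powr (-2-a) * g y * F" \<xi>, OF _ _ this, simplified]
  have tt1: "integrable (lborel \<Otimes>\<^sub>M lborel) (\<lambda>(x,y). if x < \<xi> \<and> y < \<xi> \<and> \<xi> < x + y then y powr (-2-a) * g y * F else 0)"
    using Wbounded_nonpos[OF g] by (intro tt) auto
  have tt2: "(\<integral>(x,y). (if x < \<xi> \<and> y < \<xi> \<and> \<xi> < x + y then y powr (-2-a) * g y * F else 0) \<partial>(lborel \<Otimes>\<^sub>M lborel)) = F * lower g \<xi>"
  proof -
    have "(\<integral>(x,y). (if x < \<xi> \<and> y < \<xi> \<and> \<xi> < x + y then y powr (-2-a) * g y * F else 0) \<partial>(lborel \<Otimes>\<^sub>M lborel))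
      = (\<integral>y. indicator {..<\<xi>} y * (F * (y powr (-1-a) * g y)) \<partial>lborel)"
      unfolding yy[symmetric] using Wbounded_nonpos[OF g] by (intro tt) auto
    also have "\<dots> = F * lower g \<xi>" unfolding lower_def integral_mult_right_zero[symmetric]
      by (intro Bochner_Integration.integral_cong) auto
    finally show ?thesis .
  qed
  have eq: "coag_op f g \<xi> - lower f \<xi> * upper g \<xi> - F * lower g \<xi> = (\<integral>(x,y). D x y \<partial>(lborel \<Otimes>\<^sub>M lborel))"
  proof -
    define P where "P x y = (if x < \<xi> \<and> \<xi> < x + y then k x y * f x * g y else 0)
      - (indicator {..<\<xi>} x * (x powr (-1-a) * f x)) * (indicator {\<xi>..} y * (y powr (-1) * g y))" for x y
    define R where "R x y = (if x < \<xi> \<and> y < \<xi> \<and> \<xi> < x + y then y powr (-2-a) * g y * F else 0)" for x y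
    have P1: "coag_op f g \<xi> - lower f \<xi> * upper g \<xi> = (\<integral>(x,y). P x y \<partial>(lborel \<Otimes>\<^sub>M lborel))"
      unfolding coag_op_def lower_def upper_def P_def using pp coag_op_integrable[OF \<rho>(1) f' g, of \<xi>]
      by (subst pp(2)[symmetric], simp, simp, subst Bochner_Integration.integral_diff[symmetric]) (auto simp: split_beta')
    have P2: "integrable (lborel \<Otimes>\<^sub>M lborel) (\<lambda>(x,y). P x y)"
      unfolding P_def using pp(1) coag_op_integrable[OF \<rho>(1) f' g, of \<xi>] by (simp add: split_beta')
    have "(\<integral>(x,y). D x y \<partial>(lborel \<Otimes>\<^sub>M lborel)) =
        (\<integral>z. (case z of (x,y) \<Rightarrow> P x y) - (case z of (x,y) \<Rightarrow> R x y) \<partial>(lborel \<Otimes>\<^sub>M lborel))"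
      by (intro Bochner_Integration.integral_cong) (auto simp: D_def P_def R_def)
    also have "\<dots> = (\<integral>(x,y). P x y \<partial>(lborel \<Otimes>\<^sub>M lborel)) - (\<integral>(x,y). R x y \<partial>(lborel \<Otimes>\<^sub>M lborel))"
      using P2 tt1 unfolding R_def by (rule Bochner_Integration.integral_diff)
    finally show ?thesis using P1 tt2 by (simp add: R_def)
  qed
  \<comment> \<open>\<open>q1\<close> dominates the kernel error on y \<ge> \<xi>, where integrating
    y^(-1-\<delta>) yields the decay \<xi>^(-\<delta>). \<open>q2\<close> and \<open>q3\<close>
    carry the two terms of the pointwise bound on the triangle.\<close>
  define q1 where "q1 x y = (x * h \<rho> x) * (indicator {\<xi>..} y * y powr (-1-\<delta>))" for x y
  define q2 where "q2 x y = (if 0 < x \<and> x < \<xi> \<and> y < \<xi> \<and> \<xi> < x + y then h \<rho> x else 0)" for x y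
  define q3 where "q3 x y = (if 0 < y \<and> x < \<xi> \<and> y < \<xi> \<and> \<xi> < x + y then h \<rho> y else 0)" for x y
  have [measurable]: "(\<lambda>(x,y). q1 x y) \<in> borel_measurable (lborel \<Otimes>\<^sub>M lborel)"
    "(\<lambda>(x,y). q2 x y) \<in> borel_measurable (lborel \<Otimes>\<^sub>M lborel)" "(\<lambda>(x,y). q3 x y) \<in> borel_measurable (lborel \<Otimes>\<^sub>M lborel)"
    unfolding q1_def q2_def q3_def by measurable
  have nn: "0 \<le> q1 x y" "0 \<le> q2 x y" "0 \<le> q3 x y" for x y
    using mult_nonneg_nonneg[OF xh_nonneg, of "indicator {\<xi>..} y * y powr (-1-\<delta>)" x \<rho>] by (auto simp: q1_def q2_def q3_def h_nonneg)
  have i1: "(\<integral>\<^sup>+(x,y). ennreal (q1 x y) \<partial>(lborel \<Otimes>\<^sub>M lborel)) \<le> ennreal (H * (\<xi> powr (-\<delta>) / \<delta>))"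
    unfolding q1_def using nn_integral_powr_tail[OF \<delta>_pos, of \<xi>] \<xi> xh_integral[of \<rho>] \<rho> H_ge \<delta>_pos xh_nonneg
    by (intro nn_integral_pair_product) auto
  have xhi: "(\<integral>\<^sup>+x. ennreal (indicator {0<..<\<xi>} x * (x * h \<rho> x)) \<partial>lborel) \<le> ennreal H"
    using xh_nonneg by (intro order_trans[OF _ xh_integral[OF \<rho>0]] nn_integral_mono ennreal_leI) (auto simp: indicator_def)
  have i2: "(\<integral>\<^sup>+(x,y). ennreal (q2 x y) \<partial>(lborel \<Otimes>\<^sub>M lborel)) \<le> ennreal H"
    unfolding q2_def by (subst nn_integral_triangle_fst) (use xhi h_nonneg in auto)
  have i3: "(\<integral>\<^sup>+(x,y). ennreal (q3 x y) \<partial>(lborel \<Otimes>\<^sub>M lborel)) \<le> ennreal H"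
    unfolding q3_def by (subst nn_integral_triangle_snd) (use xhi h_nonneg in auto)
  define B where "B = c * d * W \<rho> \<xi>"
  have B0: "0 \<le> B" using fb(2) gb(2) W_nonneg by (simp add: B_def)
  define B' where "B' = (6 + 4 * K0) * c * d * W \<rho> \<xi> * \<xi> powr (-\<delta>)"
  have B'0: "0 \<le> B'" using fb(2) gb(2) W_nonneg K0_nonneg by (simp add: B'_def)
  have "\<bar>\<integral>z. (case z of (x,y) \<Rightarrow> D x y) \<partial>(lborel \<Otimes>\<^sub>M lborel)\<bar> \<le>
     K0 * B * (H * (\<xi> powr (-\<delta>) / \<delta>)) + (B' * H + B' * H)"
  proof (rule integrable_dominated(2)[where q = "\<lambda>z. K0 * B * (case z of (x,y) \<Rightarrow> q1 x y) +
      (B' * (case z of (x,y) \<Rightarrow> q2 x y) + B' * (case z of (x,y) \<Rightarrow> q3 x y))"])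
    show "(\<lambda>z. case z of (x,y) \<Rightarrow> D x y) \<in> borel_measurable (lborel \<Otimes>\<^sub>M lborel)" unfolding D_def by measurable
    show "(\<integral>\<^sup>+ z. ennreal (K0 * B * (case z of (x,y) \<Rightarrow> q1 x y) +
      (B' * (case z of (x,y) \<Rightarrow> q2 x y) + B' * (case z of (x,y) \<Rightarrow> q3 x y))) \<partial>(lborel \<Otimes>\<^sub>M lborel))
      \<le> ennreal (K0 * B * (H * (\<xi> powr (-\<delta>) / \<delta>)) + (B' * H + B' * H))"
      using i1 i2 i3 K0_nonneg \<delta>_pos B0 B'0 H_ge nn
      by (intro nn_integral_add_le nn_integral_cmult_le) (auto simp: split_beta')
    show "\<bar>case z of (x,y) \<Rightarrow> D x y\<bar> \<le> K0 * B * (case z of (x,y) \<Rightarrow> q1 x y) +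
      (B' * (case z of (x,y) \<Rightarrow> q2 x y) + B' * (case z of (x,y) \<Rightarrow> q3 x y))" for z
    proof (cases z)
      case (Pair x y)
      have n: "0 \<le> K0 * B * q1 x y" "0 \<le> B' * q2 x y" "0 \<le> B' * q3 x y"
        using nn K0_nonneg B0 B'0 by auto
      have "\<bar>D x y\<bar> \<le> K0 * B * q1 x y + (B' * q2 x y + B' * q3 x y)"
      proof -
        consider "x \<le> 0 \<or> y \<le> 0 \<or> \<xi> \<le> x \<or> (y < \<xi> \<and> x + y \<le> \<xi>)" | "0 < x" "x < \<xi>" "\<xi> \<le> y"
          | "0 < x" "0 < y" "x < \<xi>" "y < \<xi>" "\<xi> < x + y" by linarith
        then show ?thesis
        proof cases
          case 1
          then have "D x y = 0" using Wbounded_nonpos[OF f', of x] Wbounded_nonpos[OF g, of y] \<xi>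
            by (auto simp: D_def)
          then show ?thesis using n by simp
        next
          case 2
          then have "D x y = (k x y - x powr (-1-a) * y powr (-1)) * (f x * g y)"
            by (simp add: D_def algebra_simps)
          also have "\<bar>\<dots>\<bar> \<le> (K0 * x powr (-1-a+\<delta>) * y powr (-1-\<delta>)) * ((c * W \<rho> x) * (d * W \<rho> \<xi>))"
            unfolding abs_mult
          proof (intro mult_mono)
            have "W \<rho> y \<le> W \<rho> \<xi>" using 2 \<xi> \<rho> by (auto simp: W_ge_1 intro!: powr_mono2')
            then show "\<bar>g y\<bar> \<le> d * W \<rho> \<xi>" using gb(3)[of y] mult_left_mono[of "W \<rho> y" "W \<rho> \<xi>" d] gb(2) by linarith
          qed (use 2 k_left[of x y] K0_nonneg fb gb W_nonneg in auto)
          also have "\<dots> = K0 * B * ((x powr (-1-a+\<delta>) * W \<rho> x) * y powr (-1-\<delta>))" by (simp add: B_def)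
          also have "\<dots> \<le> K0 * B * ((x * h \<rho> x) * y powr (-1-\<delta>))"
            using 2 K0_nonneg B0 xW_le_h(3)[of x \<rho>] by (intro mult_left_mono mult_right_mono) auto
          also have "\<dots> = K0 * B * q1 x y" using 2 by (simp add: q1_def)
          finally show ?thesis using n by linarith
        next
          case 3
          then have "\<bar>D x y\<bar> \<le> B' * (h \<rho> x + h \<rho> y)"
            using triangle_pointwise[OF \<rho> f g \<xi>, of x y] by (simp add: D_def F_def B'_def)
          also have "\<dots> = B' * q2 x y + B' * q3 x y" using 3 by (simp add: q2_def q3_def algebra_simps)
          finally show ?thesis using n by linarith
        qed
      qed
      then show ?thesis using Pair by simp
    qed
    show "0 \<le> K0 * B * (H * (\<xi> powr (-\<delta>) / \<delta>)) + (B' * H + B' * H)"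
      using K0_nonneg \<delta>_pos B0 B'0 H_ge by auto
  qed
  also have "\<dots> = (K0 * H / \<delta> + 2 * (6 + 4 * K0) * H) * c * d * W \<rho> \<xi> * \<xi> powr (-\<delta>)"
    by (simp add: B_def B'_def algebra_simps)
  finally show ?thesis unfolding eq[symmetric] F_def .
qed

section \<open>The ansatz\<close>

text \<open>The value \<open>Q(1)\<close>. It has to be small compared with \<open>a\<close>, so that the tail carries only a small part of the
  moment (whence \<open>head_coeff > 0\<close>) and the dependence of \<open>A\<close> on \<open>z\<close> is contractive.\<close>

definition b :: real where "b = a / 40"

section \<open>Exponential decay near zero measured against powers\<close>

lemma b_pos: "0 < b" using a_pos by (simp add: b_def)

text \<open>A decreasing antiderivative of -x^(-1-a), so that prim x - prim y is the integral of
  s^(-1-a) from x to y. It blows up at zero and is the natural variable for the exponential decay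
  there.\<close>

definition prim :: "real \<Rightarrow> real" where "prim x = x powr (-a) / a"

lemma prim_deriv: "0 < x \<Longrightarrow> DERIV prim x :> - (x powr (-1-a))"
proof -
  assume "0 < x"
  have "-a-1 = -1-a" by simp
  note [simp] = arg_cong[OF this, of "\<lambda>t. x powr t"]
  show ?thesis unfolding prim_def using \<open>0 < x\<close> a_pos by (auto intro!: derivative_eq_intros)
qed

lemma prim_mono: "0 < x \<Longrightarrow> x \<le> y \<Longrightarrow> prim y \<le> prim x"
  using a_pos by (auto simp: prim_def intro!: divide_right_mono powr_mono2')

lemma prim_has_integral:
  assumes "0 < x" "x \<le> y"
  shows "((\<lambda>s. s powr (-1-a)) has_integral (prim x - prim y)) {x..y}"
proof -
  have "((\<lambda>s. s powr (-1-a)) has_integral (- prim y - (- prim x))) {x..y}"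
  proof (rule fundamental_theorem_of_calculus[OF assms(2)])
    fix s assume "s \<in> {x..y}"
    then have "DERIV (\<lambda>s. - prim s) s :> s powr (-1-a)" using prim_deriv[of s] assms by (auto intro!: derivative_eq_intros)
    then show "((\<lambda>s. - prim s) has_vector_derivative s powr (-1-a)) (at s within {x..y})"
      by (metis has_real_derivative_iff_has_vector_derivative has_vector_derivative_at_within)
  qed
  then show ?thesis by simp
qed

text \<open>An exponential in x^(-a) beats every power of x. The additional factor, linear in prim x
  - prim 1, arises when the exponential is varied with respect to v and has to be absorbed as
  well.\<close>

lemma ex_W_const: "\<exists>W_const\<ge>1. \<forall>x. 0 < x \<longrightarrow> x \<le> 1 \<longrightarrow> (1 + (prim x - prim 1)) * exp (- (3/4) * b * (prim x - prim 1)) \<le> W_const * x powr (a + 2)"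
proof -
  define p where "p = 1 + (a + 2) / a"
  obtain C where C: "\<And>t. 0 \<le> t \<Longrightarrow> (1 + t) powr p * exp (- (3/4 * b) * t) \<le> C"
    using poly_exp_bounded[of "3/4 * b" p] b_pos by auto
  define D where "D = (1 + a) powr ((a+2)/a)"
  have D0: "0 < D" using a_pos by (simp add: D_def)
  have C0: "0 \<le> C" using C[of 0] by simp
  have "(1 + (prim x - prim 1)) * exp (- (3/4) * b * (prim x - prim 1)) \<le> max 1 (C * D) * x powr (a + 2)" if x: "0 < x" "x \<le> 1" for x
  proof -
    define t where "t = prim x - prim 1"
    have t: "0 \<le> t" using prim_mono[OF x] by (simp add: t_def)
    \<comment> \<open>In the variable t negative powers of x grow only polynomially, so the claim
      reduces to boundedness of a polynomial times an exponential.\<close>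
    have "x powr (-a) = 1 + a * t" using a_pos by (simp add: t_def prim_def field_simps)
    also have "\<dots> \<le> (1 + a) * (1 + t)" using t a_pos by (simp add: algebra_simps)
    finally have "(x powr (-a)) powr ((a+2)/a) \<le> ((1 + a) * (1 + t)) powr ((a+2)/a)"
      using a_pos by (intro powr_mono2) auto
    also have "\<dots> = D * (1 + t) powr ((a+2)/a)" using a_pos t by (simp add: D_def powr_mult)
    also have "(x powr (-a)) powr ((a+2)/a) = x powr (-(a+2))" using a_pos by (simp add: powr_powr)
    finally have 1: "x powr (-(a+2)) \<le> D * (1 + t) powr ((a+2)/a)" .
    have "(1 + t) * exp (- (3/4) * b * t) * x powr (-(a+2)) \<le> (1 + t) * exp (- (3/4) * b * t) * (D * (1 + t) powr ((a+2)/a))"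
      using t 1 by (intro mult_left_mono) auto
    also have "\<dots> = D * ((1 + t) powr p * exp (- (3/4 * b) * t))"
      using t by (simp add: p_def powr_add powr_one')
    also have "\<dots> \<le> D * C" using C[OF t] D0 by (intro mult_left_mono) auto
    also have "\<dots> \<le> max 1 (C * D)" by (simp add: mult.commute)
    finally have "(1 + t) * exp (- (3/4) * b * t) * x powr (-(a+2)) * x powr (a+2) \<le> max 1 (C * D) * x powr (a + 2)"
      by (intro mult_right_mono) auto
    moreover have "x powr (-(a+2)) * x powr (a+2) = 1" using x by (simp flip: powr_add)
    ultimately show ?thesis by (simp add: t_def mult.assoc)
  qed
  then show ?thesis by (intro exI[of _ "max 1 (C * D)"]) auto
qed

text \<open>Chosen once and for all, hence independent of \<rho> and of the perturbations.\<close>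

definition W_const :: real where
  "W_const = (SOME W_const. W_const \<ge> 1 \<and> (\<forall>x. 0 < x \<longrightarrow> x \<le> 1 \<longrightarrow>
    (1 + (prim x - prim 1)) * exp (- (3/4) * b * (prim x - prim 1)) \<le> W_const * x powr (a + 2)))"

lemma W_const: "1 \<le> W_const" "0 < x \<Longrightarrow> x \<le> 1 \<Longrightarrow> (1 + (prim x - prim 1)) * exp (- (3/4) * b * (prim x - prim 1)) \<le> W_const * W \<rho> x"
  using someI_ex[OF ex_W_const] unfolding W_const_def[symmetric] by (auto simp: W_def)

text \<open>The bound 1/4 yields decay rates between 3/4 and 5/4 of the unperturbed one. After
  rescaling, which multiplies the rate by a number between 2/3 and 1, the lower one becomes 3/4 *
  2/3 = 1/2, the rate claimed in the upper bound.\<close>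

definition head_ok :: "(real \<Rightarrow> real) \<Rightarrow> bool" where
  "head_ok v \<longleftrightarrow> continuous_on {0<..1} v \<and> (\<forall>x\<in>{0<..1}. \<bar>v x\<bar> \<le> 1/4)"

text \<open>The decay x^(-\<delta>) makes z / s integrable at infinity, so that the tail is a pure
  power up to a convergent factor.\<close>

definition tail_ok :: "(real \<Rightarrow> real) \<Rightarrow> bool" where
  "tail_ok z \<longleftrightarrow> continuous_on {1..} z \<and> (\<forall>x\<ge>1. \<bar>z x\<bar> \<le> x powr (-\<delta>) / 4)"

section \<open>Exponents of head and tail: bounds, derivatives, dependence on the
  perturbation\<close>

definition head_exponent :: "(real \<Rightarrow> real) \<Rightarrow> real \<Rightarrow> real" where
  "head_exponent v x = integral {x..1} (\<lambda>s. s powr (-1-a) * (1 + v s))"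

definition tail_exponent :: "(real \<Rightarrow> real) \<Rightarrow> real \<Rightarrow> real" where
  "tail_exponent z x = integral {1..x} (\<lambda>s. z s * s powr (-1))"

lemma head_ok_continuous: "head_ok v \<Longrightarrow> S \<subseteq> {0<..1} \<Longrightarrow> continuous_on S v"
  unfolding head_ok_def using continuous_on_subset by blast

lemma tail_ok_continuous: "tail_ok z \<Longrightarrow> S \<subseteq> {1..} \<Longrightarrow> continuous_on S z"
  unfolding tail_ok_def using continuous_on_subset by blast

lemma head_exponent_integrable:
  assumes "head_ok v" "0 < x" "y \<le> 1"
  shows "(\<lambda>s. s powr (-1-a) * (1 + v s)) integrable_on {x..y}"
  using assms by (intro integrable_continuous_interval continuous_intros head_ok_continuous[OF assms(1)]) auto

lemma head_exponent_diff:
  assumes "head_ok v" "0 < x" "x \<le> y" "y \<le> 1"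
  shows "head_exponent v x - head_exponent v y = integral {x..y} (\<lambda>s. s powr (-1-a) * (1 + v s))"
  using Henstock_Kurzweil_Integration.integral_combine[of x y 1 "\<lambda>s. s powr (-1-a) * (1 + v s)"]
    head_exponent_integrable[OF assms(1,2), of 1] assms by (simp add: head_exponent_def)

lemma head_exponent_diff_bounds:
  assumes "head_ok v" "0 < x" "x \<le> y" "y \<le> 1"
  shows "3/4 * (prim x - prim y) \<le> head_exponent v x - head_exponent v y" "head_exponent v x - head_exponent v y \<le> 5/4 * (prim x - prim y)"
proof -
  have i: "((\<lambda>s. c * s powr (-1-a)) has_integral (c * (prim x - prim y))) {x..y}" for c
    using has_integral_mult_right[OF prim_has_integral[OF assms(2,3)]] .
  have vb: "- (1/4) \<le> v s" "v s \<le> 1/4" if "s \<in> {x..y}" for s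
    using assms that by (auto simp: head_ok_def abs_le_iff dest!: bspec[where x=s])
  note g = integrable_integral[OF head_exponent_integrable[OF assms(1,2,4)]]
  show "3/4 * (prim x - prim y) \<le> head_exponent v x - head_exponent v y" unfolding head_exponent_diff[OF assms]
  proof (rule has_integral_le[OF i g])
    fix s assume "s \<in> {x..y}"
    then have "s powr (-1-a) * (3/4) \<le> s powr (-1-a) * (1 + v s)" using vb(1)[of s] by (intro mult_left_mono) auto
    then show "3/4 * s powr (-1-a) \<le> s powr (-1-a) * (1 + v s)" by simp
  qed
  show "head_exponent v x - head_exponent v y \<le> 5/4 * (prim x - prim y)" unfolding head_exponent_diff[OF assms]
  proof (rule has_integral_le[OF g i])
    fix s assume "s \<in> {x..y}"
    then have "s powr (-1-a) * (1 + v s) \<le> s powr (-1-a) * (5/4)" using vb(2)[of s] by (intro mult_left_mono) auto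
    then show "s powr (-1-a) * (1 + v s) \<le> 5/4 * s powr (-1-a)" by simp
  qed
qed

lemma head_exponent_diff_diff:
  assumes v: "head_ok v" and w: "head_ok w" and xy: "0 < x" "x \<le> y" "y \<le> 1" and d: "\<And>s. 0 < s \<Longrightarrow> s \<le> 1 \<Longrightarrow> \<bar>v s - w s\<bar> \<le> d"
  shows "\<bar>(head_exponent v x - head_exponent v y) - (head_exponent w x - head_exponent w y)\<bar> \<le> d * (prim x - prim y)"
proof -
  note gvi = head_exponent_integrable[OF v xy(1,3)] and gwi = head_exponent_integrable[OF w xy(1,3)]
  have "(head_exponent v x - head_exponent v y) - (head_exponent w x - head_exponent w y) = integral {x..y} (\<lambda>s. s powr (-1-a) * (1 + v s) - s powr (-1-a) * (1 + w s))"
    unfolding head_exponent_diff[OF v xy] head_exponent_diff[OF w xy] by (rule Henstock_Kurzweil_Integration.integral_diff[OF gvi gwi, symmetric])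
  also have "norm \<dots> \<le> integral {x..y} (\<lambda>s. d * s powr (-1-a))"
  proof (rule integral_norm_bound_integral)
    show "(\<lambda>s. d * s powr (-1-a)) integrable_on {x..y}"
      using has_integral_mult_right[OF prim_has_integral[OF xy(1,2)], of d] by blast
    show "norm (s powr (-1-a) * (1 + v s) - s powr (-1-a) * (1 + w s)) \<le> d * s powr (-1-a)" if "s \<in> {x..y}" for s
    proof -
      have "s powr (-1-a) * (1 + v s) - s powr (-1-a) * (1 + w s) = s powr (-1-a) * (v s - w s)" by (simp add: algebra_simps)
      moreover have "s powr (-1-a) * \<bar>v s - w s\<bar> \<le> s powr (-1-a) * d" using that xy by (intro mult_left_mono d) auto
      ultimately show ?thesis by (simp add: abs_mult mult.commute)
    qed
  qed (intro Henstock_Kurzweil_Integration.integrable_diff gvi gwi)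
  also have "\<dots> = d * (prim x - prim y)"
    using has_integral_mult_right[OF prim_has_integral[OF xy(1,2)], of d] by (rule integral_unique)
  finally show ?thesis by simp
qed

lemma head_exponent_1 [simp]: "head_exponent v 1 = 0" by (simp add: head_exponent_def)

lemma head_exponent_deriv:
  assumes "head_ok v" "0 < x" "x < 1"
  shows "DERIV (head_exponent v) x :> - (x powr (-1-a) * (1 + v x))"
proof -
  \<comment> \<open>An auxiliary base point strictly below x turns the variable lower limit into a
    variable upper one, for which the differentiation rule is stated.\<close>
  define c where "c = x / 2"
  have c: "0 < c" "c < x" using assms by (auto simp: c_def)
  define G where "G s = s powr (-1-a) * (1 + v s)" for s
  have "continuous_on {c..1} G" unfolding G_def
    using assms c by (intro continuous_intros head_ok_continuous[OF assms(1)]) auto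
  then have "((\<lambda>u. integral {c..u} G) has_vector_derivative G x) (at x within {c..1})"
    using c assms by (intro integral_has_vector_derivative) auto
  then have "((\<lambda>u. integral {c..u} G) has_vector_derivative G x) (at x)"
    using c assms by (subst (asm) at_within_interior) (auto simp: interior_atLeastAtMost_real)
  then have 1: "DERIV (\<lambda>u. integral {c..1} G - integral {c..u} G) x :> - G x"
    by (auto simp: has_real_derivative_iff_has_vector_derivative intro!: derivative_eq_intros)
  have "DERIV (head_exponent v) x :> - G x"
  proof (rule DERIV_cong_ev[THEN iffD1, OF refl _ refl 1])
    show "\<forall>\<^sub>F u in nhds x. integral {c..1} G - integral {c..u} G = head_exponent v u"
    proof (rule eventually_nhds_in_open[of "{c<..<1}", THEN eventually_mono])
      fix u assume "u \<in> {c<..<1}"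
      then have "head_exponent v c - head_exponent v u = integral {c..u} G" using head_exponent_diff[OF assms(1), of c u] c by (simp add: G_def[abs_def])
      moreover have "head_exponent v c = integral {c..1} G" by (simp add: head_exponent_def G_def[abs_def])
      ultimately show "integral {c..1} G - integral {c..u} G = head_exponent v u" by simp
    qed (use c assms in auto)
  qed
  then show ?thesis by (simp add: G_def)
qed

lemma head_exponent_continuous:
  assumes "head_ok v"
  shows "continuous_on {0<..1} (head_exponent v)"
proof -
  have "continuous (at x within {0<..1}) (head_exponent v)" if x: "x \<in> {0<..1}" for x
    unfolding continuous_within
  proof (rule LIM_zero_cancel, rule Lim_null_comparison)
    show "((\<lambda>y. 5/4 * \<bar>prim x - prim y\<bar>) \<longlongrightarrow> 0) (at x within {0<..1})"
    proof -
      have "isCont prim x" using prim_deriv[of x] x DERIV_isCont by auto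
      then have "(prim \<longlongrightarrow> prim x) (at x within {0<..1})"
        using continuous_at_imp_continuous_at_within continuous_within by blast
      then have "((\<lambda>y. 5/4 * \<bar>prim x - prim y\<bar>) \<longlongrightarrow> 5/4 * \<bar>prim x - prim x\<bar>) (at x within {0<..1})"
        by (intro tendsto_intros)
      then show ?thesis by simp
    qed
    show "\<forall>\<^sub>F y in at x within {0<..1}. norm (head_exponent v y - head_exponent v x) \<le> 5/4 * \<bar>prim x - prim y\<bar>"
      unfolding eventually_at_filter
    proof (intro always_eventually allI impI)
      fix y :: real assume y: "y \<in> {0<..1}"
      show "norm (head_exponent v y - head_exponent v x) \<le> 5/4 * \<bar>prim x - prim y\<bar>"
      proof (cases "x \<le> y")
        case True then show ?thesis using head_exponent_diff_bounds[OF assms, of x y] x y prim_mono[of x y] by auto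
      next
        case False then show ?thesis using head_exponent_diff_bounds[OF assms, of y x] x y prim_mono[of y x] by auto
      qed
    qed
  qed
  then show ?thesis by (simp add: continuous_on_eq_continuous_within)
qed

lemma tail_exponent_integrable:
  assumes "tail_ok z" "1 \<le> x"
  shows "(\<lambda>s. z s * s powr (-1)) integrable_on {x..y}"
  using assms by (intro integrable_continuous_interval continuous_intros tail_ok_continuous[OF assms(1)]) auto

lemma tail_has_integral:
  assumes "1 \<le> x"
  shows "((\<lambda>s. c * s powr (-1-\<delta>)) has_integral (c * ((1 - x powr (-\<delta>)) / \<delta>))) {1..x}"
proof (rule has_integral_mult_right)
  have "((\<lambda>s. s powr (-1-\<delta>)) has_integral (- (x powr (-\<delta>) / \<delta>) - (- (1 powr (-\<delta>) / \<delta>)))) {1..x}"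
  proof (rule fundamental_theorem_of_calculus[OF assms])
    fix s assume s: "s \<in> {1..x}"
    have "-\<delta>-1 = -1-\<delta>" by simp
    note [simp] = arg_cong[OF this, of "\<lambda>t. s powr t"]
    have "DERIV (\<lambda>s. - (s powr (-\<delta>) / \<delta>)) s :> s powr (-1-\<delta>)" using s \<delta>_pos by (auto intro!: derivative_eq_intros)
    then show "((\<lambda>s. - (s powr (-\<delta>) / \<delta>)) has_vector_derivative s powr (-1-\<delta>)) (at s within {1..x})"
      by (metis has_real_derivative_iff_has_vector_derivative has_vector_derivative_at_within)
  qed
  then show "((\<lambda>s. s powr (-1-\<delta>)) has_integral ((1 - x powr (-\<delta>)) / \<delta>)) {1..x}" by (simp add: diff_divide_distrib)
qed

text \<open>Stated for a general constant c because it is applied both to z and to the difference of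
  two tails.\<close>

lemma tail_exponent_abs_le_aux:
  assumes z: "continuous_on {1..} z" "\<And>s. 1 \<le> s \<Longrightarrow> \<bar>z s\<bar> \<le> c * s powr (-\<delta>)" and c: "0 \<le> c" and x: "1 \<le> x"
  shows "\<bar>tail_exponent z x\<bar> \<le> c / \<delta>"
proof -
  have "norm (integral {1..x} (\<lambda>s. z s * s powr (-1))) \<le> integral {1..x} (\<lambda>s. c * s powr (-1-\<delta>))"
  proof (rule integral_norm_bound_integral)
    show "(\<lambda>s. z s * s powr (-1)) integrable_on {1..x}"
      using continuous_on_subset[OF z(1), of "{1..x}"] by (intro integrable_continuous_interval continuous_intros) auto
    show "norm (z s * s powr (-1)) \<le> c * s powr (-1-\<delta>)" if "s \<in> {1..x}" for s
    proof -
      have "\<bar>z s\<bar> * s powr (-1) \<le> (c * s powr (-\<delta>)) * s powr (-1)" using that by (intro mult_right_mono z) auto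
      also have "\<dots> = c * (s powr (-\<delta>) * s powr (-1))" by simp
      also have "s powr (-\<delta>) * s powr (-1) = s powr (-1-\<delta>)" by (rule powr_mult_powr) simp
      finally show ?thesis by (simp add: abs_mult)
    qed
  qed (use tail_has_integral[OF x] in blast)
  also have "\<dots> = c * ((1 - x powr (-\<delta>)) / \<delta>)" by (rule integral_unique[OF tail_has_integral[OF x]])
  also have "\<dots> \<le> c * (1 / \<delta>)" using c \<delta>_pos by (intro mult_left_mono divide_right_mono) auto
  finally show ?thesis by (simp add: tail_exponent_def)
qed

lemma tail_exponent_bound:
  assumes "tail_ok z" "1 \<le> x"
  shows "\<bar>tail_exponent z x\<bar> \<le> 1 / (4 * \<delta>)"
  using tail_exponent_abs_le_aux[of z "1/4" x] assms by (simp add: tail_ok_def)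

lemma tail_exponent_diff_bound:
  assumes z: "tail_ok z" and w: "tail_ok w" and d: "0 \<le> d" "\<And>s. 1 \<le> s \<Longrightarrow> \<bar>z s - w s\<bar> \<le> d * s powr (-\<delta>)" and x: "1 \<le> x"
  shows "\<bar>tail_exponent z x - tail_exponent w x\<bar> \<le> d / \<delta>"
proof -
  have "tail_exponent z x - tail_exponent w x = tail_exponent (\<lambda>s. z s - w s) x"
    using Henstock_Kurzweil_Integration.integral_diff[OF tail_exponent_integrable[OF z, of 1 x] tail_exponent_integrable[OF w, of 1 x]]
    by (simp add: tail_exponent_def algebra_simps)
  also have "\<bar>\<dots>\<bar> \<le> d / \<delta>"
    using z w d x by (intro tail_exponent_abs_le_aux) (auto simp: tail_ok_def intro!: continuous_intros)
  finally show ?thesis .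
qed

lemma tail_exponent_deriv_within:
  assumes "tail_ok z" "1 \<le> x"
  shows "(tail_exponent z has_field_derivative (z x * x powr (-1))) (at x within {1..})"
proof -
  define G where "G s = z s * s powr (-1)" for s
  have "continuous_on {1..x+1} G" unfolding G_def
    using assms by (intro continuous_intros tail_ok_continuous[OF assms(1)]) auto
  then have "((\<lambda>u. integral {1..u} G) has_vector_derivative G x) (at x within {1..x+1})"
    using assms by (intro integral_has_vector_derivative) auto
  moreover have "at x within {1..x+1} = at x within {1..}"
    by (rule at_within_nhd[of x "{..<x+1}"]) auto
  ultimately show ?thesis
    by (simp add: has_real_derivative_iff_has_vector_derivative tail_exponent_def[abs_def] G_def[abs_def])
qed

lemma tail_exponent_deriv:
  assumes "tail_ok z" "1 < x"
  shows "DERIV (tail_exponent z) x :> z x * x powr (-1)"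
proof -
  have "at x within {1..} = at x" using assms by (intro at_within_interior) (simp add: interior_real_atLeast)
  then show ?thesis using tail_exponent_deriv_within[OF assms(1), of x] assms(2) by simp
qed

lemma tail_exponent_continuous: "tail_ok z \<Longrightarrow> continuous_on {1..} (tail_exponent z)"
  unfolding continuous_on_eq_continuous_within
  by (intro ballI, rule DERIV_continuous, rule tail_exponent_deriv_within) auto

lemma tail_exponent_1 [simp]: "tail_exponent z 1 = 0" by (simp add: tail_exponent_def)

section \<open>Explicit head and tail solutions\<close>

definition head_decay :: "(real \<Rightarrow> real) \<Rightarrow> real \<Rightarrow> real" where
  "head_decay v x = exp (- b * head_exponent v x)"

text \<open>This is Q(x) / Q(1), the solution of - x Q' = \<rho> (1 + z) Q with value 1 at 1, just
  as \<open>head_decay\<close> is A(x) / A(1).\<close>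

definition tail_decay :: "real \<Rightarrow> (real \<Rightarrow> real) \<Rightarrow> real \<Rightarrow> real" where
  "tail_decay \<rho> z x = x powr (-\<rho>) * exp (- \<rho> * tail_exponent z x)"

definition tail_value :: "real \<Rightarrow> (real \<Rightarrow> real) \<Rightarrow> real \<Rightarrow> real" where
  "tail_value \<rho> z x = b * \<rho> * (1 + z x) * tail_decay \<rho> z x"

text \<open>With |tail_exponent z x| \<le> 1 / (4 * \<delta>) this gives |\<rho> * tail_exponent z
  x| \<le> 1/20, so the exponential factor of the tail lies between 1/2 and 2.\<close>

definition small :: "real \<Rightarrow> bool" where "small \<rho> \<longleftrightarrow> 0 < \<rho> \<and> 5 * \<rho> \<le> \<delta>"

lemma smallD: assumes "small \<rho>" shows "0 < \<rho>" "\<rho> \<le> 1" "0 \<le> \<rho>" "\<rho> / \<delta> \<le> 1/5" "5 * \<rho> \<le> \<delta>"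
  using assms \<delta>_pos \<delta>_less_1 by (auto simp: small_def field_simps)

lemma tail_okD:
  assumes "tail_ok z" "1 \<le> x"
  shows "\<bar>z x\<bar> \<le> x powr (-\<delta>) / 4" "\<bar>z x\<bar> \<le> 1/4" "3/4 \<le> 1 + z x" "1 + z x \<le> 5/4"
proof -
  show 1: "\<bar>z x\<bar> \<le> x powr (-\<delta>) / 4" using assms by (auto simp: tail_ok_def)
  have "x powr (-\<delta>) \<le> x powr 0" using assms \<delta>_pos by (intro powr_mono) auto
  then show 2: "\<bar>z x\<bar> \<le> 1/4" using 1 assms by simp
  then show "3/4 \<le> 1 + z x" "1 + z x \<le> 5/4" by auto
qed

lemma head_okD:
  assumes "head_ok v" "0 < x" "x \<le> 1"
  shows "\<bar>v x\<bar> \<le> 1/4" "3/4 \<le> 1 + v x" "1 + v x \<le> 5/4"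
proof -
  show "\<bar>v x\<bar> \<le> 1/4" using assms by (auto simp: head_ok_def)
  then show "3/4 \<le> 1 + v x" "1 + v x \<le> 5/4" by auto
qed

lemma rho_tail_exponent_le:
  assumes "small \<rho>" "tail_ok z" "1 \<le> x"
  shows "\<bar>\<rho> * tail_exponent z x\<bar> \<le> 1/20"
proof -
  have "\<bar>\<rho> * tail_exponent z x\<bar> \<le> \<rho> * (1 / (4 * \<delta>))"
    unfolding abs_mult using tail_exponent_bound[OF assms(2,3)] smallD(1)[OF assms(1)] by (intro mult_mono) auto
  also have "\<dots> = (\<rho> / \<delta>) / 4" by simp
  also have "\<dots> \<le> (1/5) / 4" by (intro divide_right_mono smallD(4)[OF assms(1)]) simp
  also have "\<dots> = (1/20 :: real)" by simp
  finally show ?thesis .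
qed

lemma exp_small_le_2: "exp (1/20) \<le> (2::real)"
  using exp_bound_half[of "1/20::real"] by simp

lemma tail_decay_bounds:
  assumes "small \<rho>" "tail_ok z" "1 \<le> x"
  shows "W \<rho> x / 2 \<le> tail_decay \<rho> z x" "tail_decay \<rho> z x \<le> 2 * W \<rho> x" "0 < tail_decay \<rho> z x"
proof -
  have r: "\<bar>\<rho> * tail_exponent z x\<bar> \<le> 1/20" by (rule rho_tail_exponent_le[OF assms])
  have "exp (- \<rho> * tail_exponent z x) \<le> exp (1/20)" using r by auto
  then have "exp (- \<rho> * tail_exponent z x) \<le> 2" using exp_small_le_2 by linarith
  then show "tail_decay \<rho> z x \<le> 2 * W \<rho> x" using assms mult_left_mono[of "exp (- \<rho> * tail_exponent z x)" 2 "x powr (-\<rho>)"]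
    by (simp add: tail_decay_def W_ge_1)
  have "1/2 \<le> 1 + - \<rho> * tail_exponent z x" using r by auto
  also have "\<dots> \<le> exp (- \<rho> * tail_exponent z x)" by (rule exp_ge_add_one_self)
  finally show "W \<rho> x / 2 \<le> tail_decay \<rho> z x" using assms mult_left_mono[of "1/2" "exp (- \<rho> * tail_exponent z x)" "x powr (-\<rho>)"]
    by (simp add: tail_decay_def W_ge_1)
  show "0 < tail_decay \<rho> z x" using assms by (simp add: tail_decay_def)
qed

definition tail_dist :: "real \<Rightarrow> (real \<Rightarrow> real) \<Rightarrow> (real \<Rightarrow> real) \<Rightarrow> bool" where
  "tail_dist d z w \<longleftrightarrow> 0 \<le> d \<and> (\<forall>x\<ge>1. \<bar>z x - w x\<bar> \<le> d * x powr (-\<delta>))"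

definition head_dist :: "real \<Rightarrow> (real \<Rightarrow> real) \<Rightarrow> (real \<Rightarrow> real) \<Rightarrow> bool" where
  "head_dist d v w \<longleftrightarrow> 0 \<le> d \<and> (\<forall>x. 0 < x \<longrightarrow> x \<le> 1 \<longrightarrow> \<bar>v x - w x\<bar> \<le> d)"

lemma tail_distD: "tail_dist d z w \<Longrightarrow> 1 \<le> x \<Longrightarrow> \<bar>z x - w x\<bar> \<le> d * x powr (-\<delta>)"
  "tail_dist d z w \<Longrightarrow> 1 \<le> x \<Longrightarrow> \<bar>z x - w x\<bar> \<le> d"
  "tail_dist d z w \<Longrightarrow> 0 \<le> d"
proof -
  assume z: "tail_dist d z w"
  then show "0 \<le> d" by (simp add: tail_dist_def)
  assume x: "1 \<le> x"
  show 1: "\<bar>z x - w x\<bar> \<le> d * x powr (-\<delta>)" using z x by (simp add: tail_dist_def)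
  have "x powr (-\<delta>) \<le> x powr 0" using x \<delta>_pos by (intro powr_mono) auto
  then have "d * x powr (-\<delta>) \<le> d * 1" using z x by (intro mult_left_mono) (auto simp: tail_dist_def)
  then show "\<bar>z x - w x\<bar> \<le> d" using 1 by simp
qed

text \<open>The perturbation enters the exponent multiplied by \<rho>, so its Lipschitz constant is
  of order \<rho> / \<delta>, and the weight W is preserved.\<close>

lemma tail_decay_diff:
  assumes \<rho>: "small \<rho>" and z: "tail_ok z" and w: "tail_ok w" and d: "tail_dist d z w" and x: "1 \<le> x"
  shows "\<bar>tail_decay \<rho> z x - tail_decay \<rho> w x\<bar> \<le> 2 * (\<rho> / \<delta>) * d * W \<rho> x"
proof -
  have "\<bar>exp (- \<rho> * tail_exponent z x) - exp (- \<rho> * tail_exponent w x)\<bar> \<le> \<bar>- \<rho> * tail_exponent z x - (- \<rho> * tail_exponent w x)\<bar> * exp (1/20)"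
    using rho_tail_exponent_le[OF \<rho> z x] rho_tail_exponent_le[OF \<rho> w x] by (intro exp_diff_le) auto
  also have "\<dots> \<le> (\<rho> * (d / \<delta>)) * 2"
  proof (rule mult_mono)
    have "\<bar>- \<rho> * tail_exponent z x - (- \<rho> * tail_exponent w x)\<bar> = \<rho> * \<bar>tail_exponent z x - tail_exponent w x\<bar>"
      using smallD(1)[OF \<rho>] by (simp add: abs_mult abs_minus_commute flip: right_diff_distrib)
    also have "\<dots> \<le> \<rho> * (d / \<delta>)"
      using tail_exponent_diff_bound[OF z w _ _ x, of d] d smallD(1)[OF \<rho>] by (intro mult_left_mono) (auto simp: tail_dist_def)
    finally show "\<bar>- \<rho> * tail_exponent z x - (- \<rho> * tail_exponent w x)\<bar> \<le> \<rho> * (d / \<delta>)" .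
  qed (use exp_small_le_2 tail_distD(3)[OF d] smallD(1)[OF \<rho>] \<delta>_pos in auto)
  finally have "x powr (-\<rho>) * \<bar>exp (- \<rho> * tail_exponent z x) - exp (- \<rho> * tail_exponent w x)\<bar> \<le> x powr (-\<rho>) * ((\<rho> * (d / \<delta>)) * 2)"
    by (intro mult_left_mono) auto
  then show ?thesis using x by (simp add: tail_decay_def W_ge_1 mult_ac abs_mult flip: right_diff_distrib)
qed

lemma tail_decay_diff':
  assumes \<rho>: "small \<rho>" and z: "tail_ok z" and w: "tail_ok w" and d: "tail_dist d z w" and x: "1 \<le> x"
  shows "\<bar>tail_decay \<rho> z x - tail_decay \<rho> w x\<bar> \<le> 2/5 * d * W \<rho> x"
proof -
  have "(\<rho> / \<delta>) * (2 * d * W \<rho> x) \<le> (1/5) * (2 * d * W \<rho> x)"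
    using smallD(4)[OF \<rho>] tail_distD(3)[OF d] W_nonneg by (intro mult_right_mono) auto
  then show ?thesis using tail_decay_diff[OF assms] by simp
qed

lemma tail_value_bounds:
  assumes "small \<rho>" "tail_ok z" "1 \<le> x"
  shows "0 < tail_value \<rho> z x" "tail_value \<rho> z x \<le> 5/2 * b * \<rho> * W \<rho> x"
proof -
  note B = tail_decay_bounds[OF assms] and z = tail_okD[OF assms(2,3)]
  show "0 < tail_value \<rho> z x" using B z b_pos smallD(1)[OF assms(1)] by (auto simp: tail_value_def intro!: mult_pos_pos)
  have "(1 + z x) * tail_decay \<rho> z x \<le> 5/4 * (2 * W \<rho> x)"
    using B z by (intro mult_mono) auto
  then have "b * \<rho> * ((1 + z x) * tail_decay \<rho> z x) \<le> b * \<rho> * (5/4 * (2 * W \<rho> x))"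
    using b_pos smallD(1)[OF assms(1)] by (intro mult_left_mono) auto
  then show "tail_value \<rho> z x \<le> 5/2 * b * \<rho> * W \<rho> x" by (simp add: tail_value_def)
qed

lemma tail_value_diff:
  assumes \<rho>: "small \<rho>" and z: "tail_ok z" and w: "tail_ok w" and d: "tail_dist d z w" and x: "1 \<le> x"
  shows "\<bar>tail_value \<rho> z x - tail_value \<rho> w x\<bar> \<le> 5/2 * b * \<rho> * d * W \<rho> x"
proof -
  have "(1 + z x) * tail_decay \<rho> z x - (1 + w x) * tail_decay \<rho> w x = (z x - w x) * tail_decay \<rho> z x + (1 + w x) * (tail_decay \<rho> z x - tail_decay \<rho> w x)"
    by (simp add: algebra_simps)
  also have "\<bar>\<dots>\<bar> \<le> \<bar>z x - w x\<bar> * \<bar>tail_decay \<rho> z x\<bar> + \<bar>1 + w x\<bar> * \<bar>tail_decay \<rho> z x - tail_decay \<rho> w x\<bar>"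
    by (rule order_trans[OF abs_triangle_ineq]) (simp add: abs_mult)
  also have "\<dots> \<le> d * (2 * W \<rho> x) + 5/4 * (2/5 * d * W \<rho> x)"
    using tail_distD(2,3)[OF d] x tail_decay_bounds[OF \<rho> z x] tail_decay_diff'[OF assms] tail_okD[OF w x]
    by (intro add_mono mult_mono) auto
  finally have "\<bar>(1 + z x) * tail_decay \<rho> z x - (1 + w x) * tail_decay \<rho> w x\<bar> \<le> 5/2 * d * W \<rho> x" by simp
  then have "b * \<rho> * \<bar>(1 + z x) * tail_decay \<rho> z x - (1 + w x) * tail_decay \<rho> w x\<bar> \<le> b * \<rho> * (5/2 * d * W \<rho> x)"
    using b_pos smallD(1)[OF \<rho>] by (intro mult_left_mono) auto
  also have "b * \<rho> * \<bar>(1 + z x) * tail_decay \<rho> z x - (1 + w x) * tail_decay \<rho> w x\<bar> = \<bar>b * \<rho> * ((1 + z x) * tail_decay \<rho> z x - (1 + w x) * tail_decay \<rho> w x)\<bar>"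
    using b_pos smallD(1)[OF \<rho>] by (simp add: abs_mult)
  also have "b * \<rho> * ((1 + z x) * tail_decay \<rho> z x - (1 + w x) * tail_decay \<rho> w x) = tail_value \<rho> z x - tail_value \<rho> w x"
    by (simp add: tail_value_def algebra_simps)
  finally show ?thesis by (simp add: mult_ac)
qed

text \<open>Since b * tail_decay is Q, this is the second half of \<open>regular\<close>. The
  difference equals b * \<rho> * z x * tail_decay \<rho> z x, and z supplies the factor
  x^(-\<delta>).\<close>

lemma tail_value_tail_decay_bound:
  assumes "small \<rho>" "tail_ok z" "1 \<le> x"
  shows "\<bar>tail_value \<rho> z x - \<rho> * (b * tail_decay \<rho> z x)\<bar> \<le> b * \<rho> * x powr (-\<delta>) * W \<rho> x"
proof -
  have "\<bar>z x * tail_decay \<rho> z x\<bar> \<le> (x powr (-\<delta>) / 4) * (2 * W \<rho> x)"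
    unfolding abs_mult using tail_decay_bounds[OF assms] tail_okD[OF assms(2,3)] by (intro mult_mono) auto
  also have "\<dots> \<le> x powr (-\<delta>) * W \<rho> x" using W_nonneg[of \<rho> x] by simp
  finally have "b * \<rho> * \<bar>z x * tail_decay \<rho> z x\<bar> \<le> b * \<rho> * (x powr (-\<delta>) * W \<rho> x)"
    using b_pos smallD(1)[OF assms(1)] by (intro mult_left_mono) auto
  also have "b * \<rho> * \<bar>z x * tail_decay \<rho> z x\<bar> = \<bar>b * \<rho> * (z x * tail_decay \<rho> z x)\<bar>"
    using b_pos smallD(1)[OF assms(1)] by (simp add: abs_mult)
  also have "b * \<rho> * (z x * tail_decay \<rho> z x) = tail_value \<rho> z x - \<rho> * (b * tail_decay \<rho> z x)"
    by (simp add: tail_value_def algebra_simps)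
  finally show ?thesis by (simp add: mult_ac)
qed

lemma tail_value_tail_decay_diff:
  assumes \<rho>: "small \<rho>" and z: "tail_ok z" and w: "tail_ok w" and d: "tail_dist d z w" and x: "1 \<le> x"
  shows "\<bar>(tail_value \<rho> z x - \<rho> * (b * tail_decay \<rho> z x)) - (tail_value \<rho> w x - \<rho> * (b * tail_decay \<rho> w x))\<bar> \<le> 5/2 * b * \<rho> * d * x powr (-\<delta>) * W \<rho> x"
proof -
  have "z x * tail_decay \<rho> z x - w x * tail_decay \<rho> w x = (z x - w x) * tail_decay \<rho> z x + w x * (tail_decay \<rho> z x - tail_decay \<rho> w x)"
    by (simp add: algebra_simps)
  also have "\<bar>\<dots>\<bar> \<le> \<bar>z x - w x\<bar> * \<bar>tail_decay \<rho> z x\<bar> + \<bar>w x\<bar> * \<bar>tail_decay \<rho> z x - tail_decay \<rho> w x\<bar>"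
    by (rule order_trans[OF abs_triangle_ineq]) (simp add: abs_mult)
  also have "\<dots> \<le> (d * x powr (-\<delta>)) * (2 * W \<rho> x) + (x powr (-\<delta>) / 4) * (2/5 * d * W \<rho> x)"
    using tail_distD(1,3)[OF d] x tail_decay_bounds[OF \<rho> z x] tail_decay_diff'[OF assms] tail_okD[OF w x]
    by (intro add_mono mult_mono) auto
  also have "\<dots> \<le> 5/2 * d * x powr (-\<delta>) * W \<rho> x"
    using mult_nonneg_nonneg[OF mult_nonneg_nonneg[OF tail_distD(3)[OF d], of "x powr (-\<delta>)"] W_nonneg[of \<rho> x]]
    by (simp add: mult_ac)
  finally have "b * \<rho> * \<bar>z x * tail_decay \<rho> z x - w x * tail_decay \<rho> w x\<bar> \<le> b * \<rho> * (5/2 * d * x powr (-\<delta>) * W \<rho> x)"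
    using b_pos smallD(1)[OF \<rho>] by (intro mult_left_mono) auto
  also have "b * \<rho> * \<bar>z x * tail_decay \<rho> z x - w x * tail_decay \<rho> w x\<bar> = \<bar>b * \<rho> * (z x * tail_decay \<rho> z x - w x * tail_decay \<rho> w x)\<bar>"
    using b_pos smallD(1)[OF \<rho>] by (simp add: abs_mult)
  also have "b * \<rho> * (z x * tail_decay \<rho> z x - w x * tail_decay \<rho> w x) = (tail_value \<rho> z x - \<rho> * (b * tail_decay \<rho> z x)) - (tail_value \<rho> w x - \<rho> * (b * tail_decay \<rho> w x))"
    by (simp add: tail_value_def algebra_simps)
  finally show ?thesis by (simp add: mult_ac)
qed

lemma tail_decay_deriv:
  assumes "tail_ok z" "1 < x"
  shows "DERIV (tail_decay \<rho> z) x :> - (\<rho> * x powr (-1) * (1 + z x) * tail_decay \<rho> z x)"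
proof -
  have "DERIV (\<lambda>x. x powr (-\<rho>) * exp (- \<rho> * tail_exponent z x)) x :>
     (-\<rho> * x powr (-\<rho> - 1)) * exp (- \<rho> * tail_exponent z x) + exp (- \<rho> * tail_exponent z x) * (- \<rho> * (z x * x powr (-1))) * x powr (-\<rho>)"
    using assms tail_exponent_deriv[OF assms] by (auto intro!: derivative_eq_intros)
  moreover have "x powr (-\<rho> - 1) = x powr (-1) * x powr (-\<rho>)"
    using powr_mult_powr[of "-1" "-\<rho>" "-\<rho>-1" x] by simp
  ultimately show ?thesis unfolding tail_decay_def by (simp add: algebra_simps)
qed

lemma tail_decay_continuous: "tail_ok z \<Longrightarrow> continuous_on {1..} (tail_decay \<rho> z)"
  unfolding tail_decay_def by (intro continuous_intros tail_exponent_continuous) auto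

lemma tail_value_continuous: "tail_ok z \<Longrightarrow> continuous_on {1..} (tail_value \<rho> z)"
  unfolding tail_value_def by (intro continuous_intros tail_decay_continuous tail_ok_continuous) auto

lemma tail_decay_1 [simp]: "tail_decay \<rho> z 1 = 1" by (simp add: tail_decay_def)

lemma tail_decay_tendsto_0:
  assumes "small \<rho>" "tail_ok z"
  shows "(tail_decay \<rho> z \<longlongrightarrow> 0) at_top"
proof (rule Lim_null_comparison)
  show "\<forall>\<^sub>F x in at_top. norm (tail_decay \<rho> z x) \<le> 2 * x powr (-\<rho>)"
    using eventually_ge_at_top[of 1]
  proof eventually_elim
    case (elim x)
    then show ?case using tail_decay_bounds[OF assms elim] by (simp add: W_ge_1)
  qed
  have "((\<lambda>x. x powr (-\<rho>)) \<longlongrightarrow> 0) at_top"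
    using smallD(1)[OF assms(1)] tendsto_neg_powr[of "-\<rho>" "\<lambda>x. x" at_top] by (simp add: filterlim_ident)
  from tendsto_mult_left[OF this, of 2] show "((\<lambda>x. 2 * x powr (-\<rho>)) \<longlongrightarrow> 0) at_top" by simp
qed

text \<open>The integrand is the derivative of -b * tail_decay, which vanishes at infinity. The
  ansatz thus makes Q explicit for every admissible z.\<close>

lemma tail_value_integral:
  assumes \<rho>: "small \<rho>" and z: "tail_ok z" and \<xi>: "1 \<le> \<xi>"
  shows "(\<integral>y. indicator {\<xi><..} y * (y powr (-1) * tail_value \<rho> z y) \<partial>lborel) = b * tail_decay \<rho> z \<xi>"
proof -
  have "(\<integral>y. indicator {\<xi><..} y * (y powr (-1) * tail_value \<rho> z y) \<partial>lborel) = 0 - (- b * tail_decay \<rho> z \<xi>)"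
  proof (rule integral_FTC_Ioi(2))
    show "DERIV (\<lambda>y. - b * tail_decay \<rho> z y) x :> x powr (-1) * tail_value \<rho> z x" if "\<xi> < x" for x
      using DERIV_cmult[OF tail_decay_deriv[OF z, of x \<rho>], of "-b"] that \<xi> by (simp add: tail_value_def mult_ac)
    show "isCont (\<lambda>x. x powr (-1) * tail_value \<rho> z x) x" if "\<xi> < x" for x
      using that \<xi> continuous_on_interior[OF tail_value_continuous[OF z, of \<rho>], of x]
      by (intro continuous_intros) (auto simp: interior_real_atLeast)
    show "0 \<le> x powr (-1) * tail_value \<rho> z x" if "\<xi> < x" for x
      using tail_value_bounds[OF \<rho> z, of x] that \<xi> by simp
    have "(tail_decay \<rho> z \<longlongrightarrow> tail_decay \<rho> z \<xi>) (at \<xi> within {\<xi><..})"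
      using tail_decay_continuous[OF z, of \<rho>] \<xi> unfolding continuous_on_def
      by (rule_tac tendsto_within_subset[where S = "{1..}"]) auto
    then show "((\<lambda>y. - b * tail_decay \<rho> z y) \<longlongrightarrow> - b * tail_decay \<rho> z \<xi>) (at_right \<xi>)"
      by (intro tendsto_intros)
    show "((\<lambda>y. - b * tail_decay \<rho> z y) \<longlongrightarrow> 0) at_top"
      using tendsto_mult_left[OF tail_decay_tendsto_0[OF \<rho> z], of "-b"] by simp
  qed
  then show ?thesis by simp
qed

lemma head_decay_bounds:
  assumes v: "head_ok v" and x: "0 < x" "x \<le> 1"
  shows "head_decay v x \<le> exp (- (3/4) * b * (prim x - prim 1))" "exp (- (5/4) * b * (prim x - prim 1)) \<le> head_decay v x" "0 < head_decay v x"
    "head_decay v x \<le> W_const * W \<rho> x"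
proof -
  note g = head_exponent_diff_bounds[OF v x order_refl]
  show 1: "head_decay v x \<le> exp (- (3/4) * b * (prim x - prim 1))" using mult_left_mono[OF g(1), of b] b_pos by (simp add: head_decay_def)
  show "exp (- (5/4) * b * (prim x - prim 1)) \<le> head_decay v x" using mult_left_mono[OF g(2), of b] b_pos by (simp add: head_decay_def)
  show "0 < head_decay v x" by (simp add: head_decay_def)
  have "1 * exp (- (3/4) * b * (prim x - prim 1)) \<le> (1 + (prim x - prim 1)) * exp (- (3/4) * b * (prim x - prim 1))"
    using prim_mono[OF x] by (intro mult_right_mono) auto
  then show "head_decay v x \<le> W_const * W \<rho> x" using 1 W_const(2)[OF x, of \<rho>] by linarith
qed

lemma head_decay_1 [simp]: "head_decay v 1 = 1" by (simp add: head_decay_def)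

lemma head_decay_deriv:
  assumes "head_ok v" "0 < x" "x < 1"
  shows "DERIV (head_decay v) x :> x powr (-1-a) * (b * (1 + v x) * head_decay v x)"
  unfolding head_decay_def using head_exponent_deriv[OF assms] by (auto intro!: derivative_eq_intros simp: mult_ac)

lemma head_decay_continuous: "head_ok v \<Longrightarrow> continuous_on {0<..1} (head_decay v)"
  unfolding head_decay_def by (intro continuous_intros head_exponent_continuous)

lemma head_decay_tendsto_0:
  assumes "head_ok v"
  shows "(head_decay v \<longlongrightarrow> 0) (at_right 0)"
proof (rule Lim_null_comparison)
  show "\<forall>\<^sub>F x in at_right 0. norm (head_decay v x) \<le> W_const * x powr (a + 2)"
    using eventually_at_right_real[OF zero_less_one]
  proof eventually_elim
    case (elim x)
    then show "norm (head_decay v x) \<le> W_const * x powr (a + 2)"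
      using head_decay_bounds(3)[OF assms, of x] head_decay_bounds(4)[OF assms, of x 1] by (simp add: W_def)
  qed
  have "((\<lambda>x::real. x powr (a + 2)) \<longlongrightarrow> 0 powr (a + 2)) (at_right 0)"
    using a_pos by (intro tendsto_powr2 tendsto_intros eventually_at_right_less[THEN eventually_mono]) auto
  from tendsto_mult_left[OF this, of W_const] show "((\<lambda>x. W_const * x powr (a + 2)) \<longlongrightarrow> 0) (at_right 0)" by simp
qed

text \<open>The integrand is the derivative of \<open>head_decay\<close>, which vanishes at zero;
  this makes A explicit up to the factor \<open>head_coeff\<close>.\<close>

lemma head_decay_integral:
  assumes v: "head_ok v" and \<xi>: "0 < \<xi>" "\<xi> \<le> 1"
  shows "(\<integral>x. indicator {0<..<\<xi>} x * (x powr (-1-a) * (b * (1 + v x) * head_decay v x)) \<partial>lborel) = head_decay v \<xi>"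
    and "integrable lborel (\<lambda>x. indicator {0<..<\<xi>} x * (x powr (-1-a) * (b * (1 + v x) * head_decay v x)))"
proof -
  have *: "DERIV (head_decay v) x :> x powr (-1-a) * (b * (1 + v x) * head_decay v x)"
    "isCont (\<lambda>x. x powr (-1-a) * (b * (1 + v x) * head_decay v x)) x"
    "0 \<le> x powr (-1-a) * (b * (1 + v x) * head_decay v x)" if "0 < x" "x < \<xi>" for x
  proof -
    show "DERIV (head_decay v) x :> x powr (-1-a) * (b * (1 + v x) * head_decay v x)"
      using head_decay_deriv[OF v, of x] that \<xi> by simp
    have "isCont v x" "isCont (head_decay v) x"
      using that \<xi> continuous_on_interior[of "{0<..1}" _ x] head_ok_continuous[OF v order_refl] head_decay_continuous[OF v] by auto
    then show "isCont (\<lambda>x. x powr (-1-a) * (b * (1 + v x) * head_decay v x)) x" using that by (intro continuous_intros) auto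
    show "0 \<le> x powr (-1-a) * (b * (1 + v x) * head_decay v x)"
      using head_decay_bounds(3)[OF v, of x] head_okD[OF v, of x] that \<xi> b_pos by simp
  qed
  have lim: "(head_decay v \<longlongrightarrow> head_decay v \<xi>) (at_left \<xi>)"
  proof -
    have "(head_decay v \<longlongrightarrow> head_decay v \<xi>) (at \<xi> within {0<..<\<xi>})"
      using head_decay_continuous[OF v] \<xi> unfolding continuous_on_def
      by (rule_tac tendsto_within_subset[where S = "{0<..1}"]) auto
    moreover have "at_left \<xi> = at \<xi> within {0<..<\<xi>}" using \<xi> by (intro at_within_nhd[of _ "{0<..}"]) auto
    ultimately show ?thesis by simp
  qed
  show "(\<integral>x. indicator {0<..<\<xi>} x * (x powr (-1-a) * (b * (1 + v x) * head_decay v x)) \<partial>lborel) = head_decay v \<xi>"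
    using integral_FTC_Ioo(2)[OF \<xi>(1) * head_decay_tendsto_0[OF v] lim] by simp
  show "integrable lborel (\<lambda>x. indicator {0<..<\<xi>} x * (x powr (-1-a) * (b * (1 + v x) * head_decay v x)))"
    using integral_FTC_Ioo(1)[OF \<xi>(1) * head_decay_tendsto_0[OF v] lim] .
qed

section \<open>The profile: size and Lipschitz dependence on the perturbations\<close>

definition tail_part :: "real \<Rightarrow> (real \<Rightarrow> real) \<Rightarrow> real \<Rightarrow> real" where
  "tail_part \<rho> z x = indicator {1<..} x * tail_value \<rho> z x"

definition head_part :: "(real \<Rightarrow> real) \<Rightarrow> real \<Rightarrow> real" where
  "head_part v x = indicator {0<..1} x * (b * (1 + v x) * head_decay v x)"

definition tail_moment :: "real \<Rightarrow> (real \<Rightarrow> real) \<Rightarrow> real" where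
  "tail_moment \<rho> z = (\<integral>x. x powr (-1-a) * tail_part \<rho> z x \<partial>lborel)"

text \<open>Chosen to give the profile the total moment \<open>\<rho> / (1 + \<rho>)\<close>.\<close>

definition head_coeff :: "real \<Rightarrow> (real \<Rightarrow> real) \<Rightarrow> real" where
  "head_coeff \<rho> z = \<rho> / (1 + \<rho>) - tail_moment \<rho> z"

definition profile :: "real \<Rightarrow> (real \<Rightarrow> real) \<Rightarrow> (real \<Rightarrow> real) \<Rightarrow> real \<Rightarrow> real" where
  "profile \<rho> v z x = head_coeff \<rho> z * head_part v x + tail_part \<rho> z x"

lemma W_pos: "0 < x \<Longrightarrow> 0 < W \<rho> x"
  by (simp add: W_def)

lemma Wbounded_mono:
  assumes "Wbounded \<rho> c f" "c \<le> c'"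
  shows "Wbounded \<rho> c' f"
proof -
  have "c * W \<rho> x \<le> c' * W \<rho> x" for x using assms(2) W_nonneg by (rule mult_right_mono)
  then show ?thesis using assms unfolding Wbounded_def by (meson order_trans)
qed

lemma Wbounded_add: "Wbounded \<rho> c f \<Longrightarrow> Wbounded \<rho> d g \<Longrightarrow> Wbounded \<rho> (c + d) (\<lambda>x. f x + g x)"
  unfolding Wbounded_def by (auto simp: distrib_right intro: order_trans[OF abs_triangle_ineq] add_mono)

lemma tail_part_measurable:
  assumes "tail_ok z" shows "tail_part \<rho> z \<in> borel_measurable borel"
proof -
  have "continuous_on {1<..} (tail_value \<rho> z)" by (rule continuous_on_subset[OF tail_value_continuous[OF assms]]) auto
  then have "(\<lambda>x. indicator {1<..} x *\<^sub>R tail_value \<rho> z x) \<in> borel_measurable borel"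
    by (intro borel_measurable_continuous_on_indicator) auto
  then show ?thesis by (simp add: tail_part_def[abs_def])
qed

lemma head_part_measurable:
  assumes "head_ok v" shows "head_part v \<in> borel_measurable borel"
proof -
  have "continuous_on {0<..1} (\<lambda>x. b * (1 + v x) * head_decay v x)"
    by (intro continuous_intros head_decay_continuous head_ok_continuous assms order_refl)
  then have "(\<lambda>x. indicator {0<..1} x *\<^sub>R (b * (1 + v x) * head_decay v x)) \<in> borel_measurable borel"
    by (intro borel_measurable_continuous_on_indicator) auto
  then show ?thesis by (simp add: head_part_def[abs_def])
qed

lemma tail_part_Wbounded:
  assumes "small \<rho>" "tail_ok z" shows "Wbounded \<rho> (5/2 * b * \<rho>) (tail_part \<rho> z)"
  unfolding Wbounded_def
proof (intro conjI allI tail_part_measurable assms)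
  show c: "0 \<le> 5/2 * b * \<rho>" using b_pos smallD(1)[OF assms(1)] by simp
  show "\<bar>tail_part \<rho> z x\<bar> \<le> 5/2 * b * \<rho> * W \<rho> x" for x
    using tail_value_bounds[OF assms, of x] mult_nonneg_nonneg[OF c W_nonneg[of \<rho> x]]
    by (cases "1 < x") (auto simp: tail_part_def)
qed

lemma tail_part_diff_Wbounded:
  assumes "small \<rho>" "tail_ok z" "tail_ok w" "tail_dist d z w"
  shows "Wbounded \<rho> (5/2 * b * \<rho> * d) (\<lambda>x. tail_part \<rho> z x - tail_part \<rho> w x)"
  unfolding Wbounded_def
proof (intro conjI allI borel_measurable_diff tail_part_measurable assms)
  show c: "0 \<le> 5/2 * b * \<rho> * d" using b_pos smallD(1)[OF assms(1)] tail_distD(3)[OF assms(4)] by simp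
  show "\<bar>tail_part \<rho> z x - tail_part \<rho> w x\<bar> \<le> 5/2 * b * \<rho> * d * W \<rho> x" for x
    using tail_value_diff[OF assms, of x] mult_nonneg_nonneg[OF c W_nonneg[of \<rho> x]]
    by (cases "1 < x") (auto simp: tail_part_def)
qed

lemma head_part_bounds:
  assumes "head_ok v"
  shows "0 \<le> head_part v x" "\<bar>head_part v x\<bar> \<le> 5/4 * b * (W_const * W \<rho> x)"
proof -
  have "0 \<le> head_part v x \<and> \<bar>head_part v x\<bar> \<le> 5/4 * b * (W_const * W \<rho> x)"
  proof (cases "x \<in> {0<..1}")
    case True
    then have x: "0 < x" "x \<le> 1" by auto
    note v = head_okD[OF assms x] and e = head_decay_bounds[OF assms x]
    have "(1 + v x) * head_decay v x \<le> 5/4 * (W_const * W \<rho> x)" using v e by (intro mult_mono) auto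
    then have "b * ((1 + v x) * head_decay v x) \<le> b * (5/4 * (W_const * W \<rho> x))" using b_pos by (intro mult_left_mono) auto
    moreover have "0 \<le> b * ((1 + v x) * head_decay v x)" using v e b_pos by simp
    ultimately show ?thesis using True by (simp add: head_part_def mult_ac)
  qed (use b_pos W_const(1) W_nonneg in \<open>auto simp: head_part_def\<close>)
  then show "0 \<le> head_part v x" "\<bar>head_part v x\<bar> \<le> 5/4 * b * (W_const * W \<rho> x)" by auto
qed

lemma head_part_Wbounded: "head_ok v \<Longrightarrow> Wbounded \<rho> (5/4 * b * W_const) (head_part v)"
  unfolding Wbounded_def using head_part_bounds(2)[of v _ \<rho>] head_part_measurable b_pos W_const(1) by (auto simp: mult_ac)

text \<open>The ratio of decays is the exponential of a difference of exponents, and changing v by d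
  moves that exponent by at most b * d * (prim x - prim y). The case y = 1 serves the profile
  itself, general y the normalised head.\<close>

lemma head_decay_ratio_diff:
  assumes v: "head_ok v" and w: "head_ok w" and d: "head_dist d v w" and xy: "0 < x" "x \<le> y" "y \<le> 1"
  shows "\<bar>(1 + v x) * (head_decay v x / head_decay v y) - (1 + w x) * (head_decay w x / head_decay w y)\<bar>
     \<le> d * (1 + 5/4 * b * (prim x - prim y)) * exp (- (3/4) * b * (prim x - prim y))"
proof -
  define t where "t = prim x - prim y"
  define p where "p = - b * (head_exponent v x - head_exponent v y)"
  define q where "q = - b * (head_exponent w x - head_exponent w y)"
  have t: "0 \<le> t" using prim_mono[OF xy(1,2)] by (simp add: t_def)
  have d0: "0 \<le> d" using d by (simp add: head_dist_def)
  have e: "head_decay v x / head_decay v y = exp p" "head_decay w x / head_decay w y = exp q"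
    by (simp_all add: head_decay_def p_def q_def algebra_simps flip: exp_diff)
  have p: "p \<le> - (3/4) * b * t" and q: "q \<le> - (3/4) * b * t"
    using mult_left_mono[OF head_exponent_diff_bounds(1)[OF v xy], of b] mult_left_mono[OF head_exponent_diff_bounds(1)[OF w xy], of b] b_pos
    by (auto simp: p_def q_def t_def)
  have "\<bar>p - q\<bar> = b * \<bar>(head_exponent v x - head_exponent v y) - (head_exponent w x - head_exponent w y)\<bar>"
    using b_pos by (simp add: p_def q_def abs_mult abs_minus_commute flip: right_diff_distrib)
  also have "\<dots> \<le> b * (d * t)" unfolding t_def
    using head_exponent_diff_diff[OF v w xy, of d] d b_pos by (intro mult_left_mono) (auto simp: head_dist_def)
  finally have pq: "\<bar>p - q\<bar> \<le> b * (d * t)" .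
  have "\<bar>exp p - exp q\<bar> \<le> \<bar>p - q\<bar> * exp (- (3/4) * b * t)" by (rule exp_diff_le[OF p q])
  also have "\<dots> \<le> b * (d * t) * exp (- (3/4) * b * t)" using pq by (intro mult_right_mono) auto
  finally have E: "\<bar>exp p - exp q\<bar> \<le> b * (d * t) * exp (- (3/4) * b * t)" .
  have "(1 + v x) * exp p - (1 + w x) * exp q = (v x - w x) * exp p + (1 + w x) * (exp p - exp q)"
    by (simp add: algebra_simps)
  also have "\<bar>\<dots>\<bar> \<le> \<bar>v x - w x\<bar> * exp p + \<bar>1 + w x\<bar> * \<bar>exp p - exp q\<bar>"
    by (rule order_trans[OF abs_triangle_ineq]) (simp add: abs_mult)
  also have "\<dots> \<le> d * exp (- (3/4) * b * t) + 5/4 * (b * (d * t) * exp (- (3/4) * b * t))"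
    using d p E head_okD[OF w, of x] xy d0 by (intro add_mono mult_mono) (auto simp: head_dist_def)
  also have "\<dots> = d * (1 + 5/4 * b * t) * exp (- (3/4) * b * t)" by (simp add: algebra_simps)
  finally show ?thesis unfolding e t_def .
qed

lemma head_part_diff_Wbounded:
  assumes v: "head_ok v" and w: "head_ok w" and d: "head_dist d v w"
  shows "Wbounded \<rho> (b * (1 + 2 * b) * W_const * d) (\<lambda>x. head_part v x - head_part w x)"
proof -
  have d0: "0 \<le> d" using d by (simp add: head_dist_def)
  have "\<bar>head_part v x - head_part w x\<bar> \<le> b * (1 + 2 * b) * W_const * d * W \<rho> x" for x
  proof (cases "x \<in> {0<..1}")
    case True
    then have x: "0 < x" "x \<le> 1" by auto
    define t where "t = prim x - prim 1"
    have t: "0 \<le> t" using prim_mono[OF x] by (simp add: t_def)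
    have "head_part v x - head_part w x = b * ((1 + v x) * (head_decay v x / head_decay v 1) - (1 + w x) * (head_decay w x / head_decay w 1))"
      using x by (simp add: head_part_def algebra_simps)
    also have "\<bar>\<dots>\<bar> \<le> b * (d * (1 + 5/4 * b * t) * exp (- (3/4) * b * t))"
      unfolding abs_mult t_def using head_decay_ratio_diff[OF v w d x(1,2)] b_pos by (intro mult_mono) auto
    \<comment> \<open>The factor linear in t is brought to the form 1 + t that the choice of
      \<open>W_const\<close> absorbs.\<close>
    also have "\<dots> \<le> b * (d * ((1 + 2 * b) * (1 + t)) * exp (- (3/4) * b * t))"
      using b_pos t d0 by (intro mult_left_mono mult_right_mono) (auto simp: algebra_simps)
    also have "\<dots> = (b * d * (1 + 2 * b)) * ((1 + t) * exp (- (3/4) * b * t))" by simp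
    also have "\<dots> \<le> (b * d * (1 + 2 * b)) * (W_const * W \<rho> x)"
      using W_const(2)[OF x, of \<rho>] b_pos d0 unfolding t_def by (intro mult_left_mono) auto
    finally show ?thesis by (simp add: mult_ac)
  next
    case False
    then show ?thesis using b_pos d0 W_const(1) W_nonneg by (auto simp: head_part_def)
  qed
  then show ?thesis unfolding Wbounded_def using head_part_measurable v w b_pos d0 W_const(1) by auto
qed

text \<open>Bounding W by 1 leaves the integral of x^(-1-a). The power \<xi>^(-a) obtained this way
  dictates the later comparison with \<xi>^(-\<delta>).\<close>

lemma lower_tail_bound:
  assumes "0 \<le> \<rho>" "Wbounded \<rho> c f" "1 \<le> \<xi>"
  shows "\<bar>\<integral>x. indicator {\<xi>..} x * (x powr (-1-a) * f x) \<partial>lborel\<bar> \<le> c * (\<xi> powr (-a) / a)"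
proof (rule integrable_dominated(2))
  note f = WboundedD[OF assms(2)]
  have [measurable]: "f \<in> borel_measurable borel" by (rule f)
  show "(\<lambda>x. indicator {\<xi>..} x * (x powr (-1-a) * f x)) \<in> borel_measurable lborel" by measurable
  show "\<bar>indicator {\<xi>..} x * (x powr (-1-a) * f x)\<bar> \<le> c * (indicator {\<xi>..} x * x powr (-1-a))" for x
  proof -
    have "\<bar>f x\<bar> \<le> c" using f(3)[of x] mult_left_mono[OF W_le_1[OF assms(1), of x] f(2)] by simp
    then have "x powr (-1-a) * \<bar>f x\<bar> \<le> x powr (-1-a) * c" by (intro mult_left_mono) auto
    then show ?thesis by (auto simp: abs_mult mult.commute split: split_indicator)
  qed
  show "(\<integral>\<^sup>+x. ennreal (c * (indicator {\<xi>..} x * x powr (-1-a))) \<partial>lborel) \<le> ennreal (c * (\<xi> powr (-a) / a))"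
    using assms f a_pos nn_integral_powr_tail[of a \<xi>] by (intro nn_integral_cmult_le) auto
  show "0 \<le> c * (\<xi> powr (-a) / a)" using f a_pos by auto
qed

lemma tail_moment_eq: "tail_moment \<rho> z = (\<integral>x. indicator {1..} x * (x powr (-1-a) * tail_part \<rho> z x) \<partial>lborel)"
  unfolding tail_moment_def by (intro Bochner_Integration.integral_cong) (auto simp: tail_part_def split: split_indicator)

lemma tail_moment_bounds:
  assumes "small \<rho>" "tail_ok z"
  shows "0 \<le> tail_moment \<rho> z" "tail_moment \<rho> z \<le> \<rho> / 16"
proof -
  show "0 \<le> tail_moment \<rho> z" unfolding tail_moment_def using tail_value_bounds(1)[OF assms]
    by (intro integral_nonneg_AE AE_I2) (auto simp: tail_part_def less_imp_le split: split_indicator)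
  have "tail_moment \<rho> z \<le> 5/2 * b * \<rho> * (1 powr (-a) / a)"
    using lower_tail_bound[OF smallD(3)[OF assms(1)] tail_part_Wbounded[OF assms], of 1] by (simp add: tail_moment_eq)
  \<comment> \<open>With b = a / 40 the constant 5/2 * b / a is exactly 1/16.\<close>
  then show "tail_moment \<rho> z \<le> \<rho> / 16" using a_pos by (simp add: b_def)
qed

lemma head_coeff_bounds:
  assumes "small \<rho>" "tail_ok z"
  shows "\<rho> / 4 \<le> head_coeff \<rho> z" "head_coeff \<rho> z \<le> \<rho>" "0 < head_coeff \<rho> z"
proof -
  have "\<rho> / 2 \<le> \<rho> / (1 + \<rho>)" "\<rho> / (1 + \<rho>) \<le> \<rho>" using smallD(1,2)[OF assms(1)] by (auto simp: field_simps)
  then show "\<rho> / 4 \<le> head_coeff \<rho> z" "head_coeff \<rho> z \<le> \<rho>" using tail_moment_bounds[OF assms] smallD(1)[OF assms(1)] by (auto simp: head_coeff_def)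
  then show "0 < head_coeff \<rho> z" using smallD(1)[OF assms(1)] by linarith
qed

text \<open>The prescribed total \<rho> / (1 + \<rho>) cancels in the difference, so only the
  moments of the two tails are compared.\<close>

lemma head_coeff_diff:
  assumes "small \<rho>" "tail_ok z" "tail_ok w" "tail_dist d z w"
  shows "\<bar>head_coeff \<rho> z - head_coeff \<rho> w\<bar> \<le> \<rho> * d / 16"
proof -
  note 0 = smallD(3)[OF assms(1)]
  have "head_coeff \<rho> w - head_coeff \<rho> z = (\<integral>x. indicator {1..} x * (x powr (-1-a) * (tail_part \<rho> z x - tail_part \<rho> w x)) \<partial>lborel)"
    unfolding head_coeff_def tail_moment_eq
    using Bochner_Integration.integral_diff[OF lower_set_integrable[OF 0 tail_part_Wbounded[OF assms(1,2)], of "{1..}"]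
      lower_set_integrable[OF 0 tail_part_Wbounded[OF assms(1,3)], of "{1..}"]]
    by (simp add: algebra_simps)
  also have "\<bar>\<dots>\<bar> \<le> 5/2 * b * \<rho> * d * (1 powr (-a) / a)"
    by (rule lower_tail_bound[OF 0 tail_part_diff_Wbounded[OF assms]]) simp
  finally show ?thesis using a_pos by (simp add: b_def abs_minus_commute)
qed

text \<open>A common constant for the size of a profile and for its Lipschitz dependence, in units
  of \<rho> * W. Both the head coefficient and the tail carry a factor \<rho>.\<close>

definition F_const :: real where "F_const = b * (5 + 2 * b) * W_const"

lemma F_const_pos: "0 < F_const" using b_pos W_const(1) by (simp add: F_const_def)

lemma b_le_F_const: "5 * b \<le> F_const"
proof -
  have "b * 5 * 1 \<le> b * (5 + 2 * b) * W_const" using b_pos W_const(1) by (intro mult_mono) auto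
  then show ?thesis by (simp add: F_const_def)
qed

lemma profile_Wbounded:
  assumes "small \<rho>" "head_ok v" "tail_ok z"
  shows "Wbounded \<rho> (F_const * \<rho>) (profile \<rho> v z)"
proof -
  have "Wbounded \<rho> (\<bar>head_coeff \<rho> z\<bar> * (5/4 * b * W_const) + 5/2 * b * \<rho>) (profile \<rho> v z)"
    unfolding profile_def[abs_def] by (intro Wbounded_add Wbounded_scale head_part_Wbounded tail_part_Wbounded assms)
  moreover have "\<bar>head_coeff \<rho> z\<bar> * (5/4 * b * W_const) + 5/2 * b * \<rho> \<le> F_const * \<rho>"
  proof -
    have "\<bar>head_coeff \<rho> z\<bar> * (5/4 * b * W_const) \<le> \<rho> * (5/4 * b * W_const)"
      using head_coeff_bounds[OF assms(1,3)] b_pos W_const(1) by (intro mult_right_mono) auto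
    moreover have "5/2 * b * \<rho> * 1 \<le> 5/2 * b * \<rho> * W_const" using b_pos smallD(1)[OF assms(1)] W_const(1) by (intro mult_left_mono) auto
    moreover have "\<rho> * (5/4 * b * W_const) + 5/2 * b * \<rho> * W_const \<le> F_const * \<rho>"
    proof -
      have "(15/4) * (b * \<rho> * W_const) \<le> (5 + 2 * b) * (b * \<rho> * W_const)"
        using b_pos smallD(1)[OF assms(1)] W_const(1) by (intro mult_right_mono) auto
      then show ?thesis by (simp add: F_const_def mult_ac algebra_simps)
    qed
    ultimately show ?thesis by linarith
  qed
  ultimately show ?thesis by (rule Wbounded_mono)
qed

text \<open>Telescoping over the head coefficient, the head and the tail. The constant 5 + 2 * b
  leaves room for 5/64 + (1 + 2 * b) + 5/2.\<close>

lemma profile_diff_Wbounded: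
  assumes "small \<rho>" "head_ok v" "tail_ok z" "head_ok v'" "tail_ok z'" "head_dist d v v'" "tail_dist d z z'"
  shows "Wbounded \<rho> (F_const * \<rho> * d) (\<lambda>x. profile \<rho> v z x - profile \<rho> v' z' x)"
proof -
  note \<rho> = smallD(1)[OF assms(1)] and d = tail_distD(3)[OF assms(7)]
  have eq: "profile \<rho> v z x - profile \<rho> v' z' x = ((head_coeff \<rho> z - head_coeff \<rho> z') * head_part v x + head_coeff \<rho> z' * (head_part v x - head_part v' x)) + (tail_part \<rho> z x - tail_part \<rho> z' x)" for x
    by (simp add: profile_def algebra_simps)
  have "Wbounded \<rho> ((\<bar>head_coeff \<rho> z - head_coeff \<rho> z'\<bar> * (5/4 * b * W_const) + \<bar>head_coeff \<rho> z'\<bar> * (b * (1 + 2 * b) * W_const * d)) + 5/2 * b * \<rho> * d) (\<lambda>x. profile \<rho> v z x - profile \<rho> v' z' x)"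
    unfolding eq using assms by (intro Wbounded_add Wbounded_scale head_part_Wbounded tail_part_diff_Wbounded head_part_diff_Wbounded)
  moreover have "(\<bar>head_coeff \<rho> z - head_coeff \<rho> z'\<bar> * (5/4 * b * W_const) + \<bar>head_coeff \<rho> z'\<bar> * (b * (1 + 2 * b) * W_const * d)) + 5/2 * b * \<rho> * d \<le> F_const * \<rho> * d"
  proof -
    have "\<bar>head_coeff \<rho> z - head_coeff \<rho> z'\<bar> * (5/4 * b * W_const) \<le> (\<rho> * d / 16) * (5/4 * b * W_const)"
      using head_coeff_diff[OF assms(1,3,5,7)] b_pos W_const(1) by (intro mult_right_mono) auto
    moreover have "\<bar>head_coeff \<rho> z'\<bar> * (b * (1 + 2 * b) * W_const * d) \<le> \<rho> * (b * (1 + 2 * b) * W_const * d)"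
      using head_coeff_bounds[OF assms(1,5)] b_pos W_const(1) d by (intro mult_right_mono) auto
    moreover have "5/2 * b * \<rho> * d * 1 \<le> 5/2 * b * \<rho> * d * W_const" using b_pos \<rho> d W_const(1) by (intro mult_left_mono) auto
    moreover have "(\<rho> * d / 16) * (5/4 * b * W_const) + \<rho> * (b * (1 + 2 * b) * W_const * d) + 5/2 * b * \<rho> * d * W_const \<le> F_const * \<rho> * d"
    proof -
      have "(5/64 + (1 + 2 * b) + 5/2) * (b * \<rho> * d * W_const) \<le> (5 + 2 * b) * (b * \<rho> * d * W_const)"
        using b_pos \<rho> d W_const(1) by (intro mult_right_mono) auto
      then show ?thesis by (simp add: F_const_def mult_ac algebra_simps)
    qed
    ultimately show ?thesis by linarith
  qed
  ultimately show ?thesis by (rule Wbounded_mono)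
qed

lemma profile_head: "0 < x \<Longrightarrow> x \<le> 1 \<Longrightarrow> profile \<rho> v z x = head_coeff \<rho> z * (b * (1 + v x) * head_decay v x)"
  by (simp add: profile_def tail_part_def head_part_def)

lemma profile_tail: "1 < x \<Longrightarrow> profile \<rho> v z x = tail_value \<rho> z x"
  by (simp add: profile_def tail_part_def head_part_def)

lemma profile_pos:
  assumes "small \<rho>" "head_ok v" "tail_ok z" "0 < x"
  shows "0 < profile \<rho> v z x"
proof (cases "x \<le> 1")
  case True
  then show ?thesis using head_coeff_bounds(3)[OF assms(1,3)] b_pos head_okD[OF assms(2,4)] head_decay_bounds(3)[OF assms(2,4)] assms(4)
    by (simp add: profile_head)
next
  case False
  then show ?thesis using tail_value_bounds(1)[OF assms(1,3), of x] by (simp add: profile_tail)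
qed

section \<open>The values of A and Q for the profile\<close>

lemma AE_indicator_eq:
  fixes f :: "real \<Rightarrow> real"
  assumes [measurable]: "f \<in> borel_measurable borel" "S \<in> sets borel" "T \<in> sets borel" and "\<And>x. x \<noteq> c \<Longrightarrow> x \<in> S \<longleftrightarrow> x \<in> T"
  shows "(\<integral>x. indicator S x * f x \<partial>lborel) = (\<integral>x. indicator T x * f x \<partial>lborel)"
proof (rule integral_cong_AE)
  show "AE x in lborel. indicator S x * f x = indicator T x * f x"
    using AE_lborel_singleton[of c] by eventually_elim (use assms(4) in \<open>auto simp: indicator_def\<close>)
qed measurable

text \<open>This holds for every admissible pair, not only at a fixed point. In particular all
  profiles share the value Q(1) = b.\<close>

lemma upper_profile:
  assumes "small \<rho>" "head_ok v" "tail_ok z" "1 \<le> \<xi>"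
  shows "upper (profile \<rho> v z) \<xi> = b * tail_decay \<rho> z \<xi>"
proof -
  have [measurable]: "profile \<rho> v z \<in> borel_measurable borel" using WboundedD(1)[OF profile_Wbounded[OF assms(1-3)]] .
  have "upper (profile \<rho> v z) \<xi> = (\<integral>x. indicator {\<xi><..} x * (x powr (-1) * profile \<rho> v z x) \<partial>lborel)"
    unfolding upper_def by (rule AE_indicator_eq[where c = \<xi>]) auto
  also have "\<dots> = (\<integral>x. indicator {\<xi><..} x * (x powr (-1) * tail_value \<rho> z x) \<partial>lborel)"
    using assms(4) by (intro Bochner_Integration.integral_cong) (auto simp: profile_tail split: split_indicator)
  also have "\<dots> = b * tail_decay \<rho> z \<xi>" by (rule tail_value_integral[OF assms(1,3,4)])
  finally show ?thesis .
qed

lemma lower_head_part: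
  assumes "head_ok v" "0 < \<xi>" "\<xi> \<le> 1"
  shows "lower (head_part v) \<xi> = head_decay v \<xi>"
  unfolding lower_def head_decay_integral(1)[OF assms, symmetric]
  using assms by (intro Bochner_Integration.integral_cong) (auto simp: head_part_def split: split_indicator)

lemma lower_profile_small:
  assumes "head_ok v" "0 < \<xi>" "\<xi> \<le> 1"
  shows "lower (profile \<rho> v z) \<xi> = head_coeff \<rho> z * head_decay v \<xi>"
proof -
  have "lower (profile \<rho> v z) \<xi> = lower (\<lambda>x. head_coeff \<rho> z * head_part v x) \<xi>"
    unfolding lower_def using assms by (intro Bochner_Integration.integral_cong) (auto simp: profile_def tail_part_def split: split_indicator)
  then show ?thesis using lower_head_part[OF assms] by (simp add: lower_scale)
qed

lemma profile_moment:
  assumes "small \<rho>" "head_ok v" "tail_ok z"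
  shows "(\<integral>x. x powr (-1-a) * profile \<rho> v z x \<partial>lborel) = \<rho> / (1 + \<rho>)"
proof -
  note 0 = smallD(3)[OF assms(1)]
  have [measurable]: "head_part v \<in> borel_measurable borel" using head_part_measurable[OF assms(2)] .
  have 1: "(\<integral>x. x powr (-1-a) * head_part v x \<partial>lborel) = 1"
  proof -
    have "(\<integral>x. x powr (-1-a) * head_part v x \<partial>lborel) = (\<integral>x. indicator {..1} x * (x powr (-1-a) * head_part v x) \<partial>lborel)"
      by (intro Bochner_Integration.integral_cong) (auto simp: head_part_def split: split_indicator)
    also have "\<dots> = lower (head_part v) 1" unfolding lower_def by (rule AE_indicator_eq[where c = 1]) auto
    finally show ?thesis using lower_head_part[OF assms(2), of 1] by simp
  qed
  have "(\<integral>x. x powr (-1-a) * profile \<rho> v z x \<partial>lborel) = (\<integral>x. head_coeff \<rho> z * (x powr (-1-a) * head_part v x) + x powr (-1-a) * tail_part \<rho> z x \<partial>lborel)"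
    by (simp add: profile_def algebra_simps)
  also have "\<dots> = head_coeff \<rho> z * 1 + tail_moment \<rho> z" unfolding tail_moment_def
    using 1 lower_integrable[OF 0 head_part_Wbounded[OF assms(2)]] lower_integrable[OF 0 tail_part_Wbounded[OF assms(1,3)]]
    by (subst Bochner_Integration.integral_add) auto
  finally show ?thesis by (simp add: head_coeff_def)
qed

text \<open>Written as the total moment minus the part beyond \<xi>, A no longer refers to v when
  \<xi> \<ge> 1.\<close>

lemma lower_profile_large:
  assumes "small \<rho>" "head_ok v" "tail_ok z" "1 \<le> \<xi>"
  shows "lower (profile \<rho> v z) \<xi> = \<rho> / (1 + \<rho>) - (\<integral>x. indicator {\<xi>..} x * (x powr (-1-a) * tail_part \<rho> z x) \<partial>lborel)"
proof -
  note 0 = smallD(3)[OF assms(1)] and P = profile_Wbounded[OF assms(1-3)]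
  have [measurable]: "profile \<rho> v z \<in> borel_measurable borel" "tail_part \<rho> z \<in> borel_measurable borel"
    using WboundedD(1)[OF P] tail_part_measurable[OF assms(3)] .
  have "\<rho> / (1 + \<rho>) = (\<integral>x. indicator {..<\<xi>} x * (x powr (-1-a) * profile \<rho> v z x) + indicator {\<xi>..} x * (x powr (-1-a) * profile \<rho> v z x) \<partial>lborel)"
    unfolding profile_moment[OF assms(1-3), symmetric]
    by (intro Bochner_Integration.integral_cong) (auto split: split_indicator)
  also have "\<dots> = lower (profile \<rho> v z) \<xi> + (\<integral>x. indicator {\<xi>..} x * (x powr (-1-a) * profile \<rho> v z x) \<partial>lborel)"
    unfolding lower_def using lower_set_integrable[OF 0 P] by (intro Bochner_Integration.integral_add) auto
  also have "(\<integral>x. indicator {\<xi>..} x * (x powr (-1-a) * profile \<rho> v z x) \<partial>lborel) = (\<integral>x. indicator {\<xi><..} x * (x powr (-1-a) * profile \<rho> v z x) \<partial>lborel)"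
    by (rule AE_indicator_eq[where c = \<xi>]) auto
  also have "\<dots> = (\<integral>x. indicator {\<xi><..} x * (x powr (-1-a) * tail_part \<rho> z x) \<partial>lborel)"
    using assms(4) by (intro Bochner_Integration.integral_cong) (auto simp: profile_def head_part_def split: split_indicator)
  also have "\<dots> = (\<integral>x. indicator {\<xi>..} x * (x powr (-1-a) * tail_part \<rho> z x) \<partial>lborel)"
    by (rule AE_indicator_eq[where c = \<xi>]) auto
  finally show ?thesis by simp
qed

lemma tail_powr_le:
  assumes "1 \<le> \<xi>" shows "\<xi> powr (-a) \<le> \<xi> powr (-\<delta>)"
  using assms \<delta>_less_a by (intro powr_mono) auto

lemma lower_profile_large_bound:
  assumes "small \<rho>" "head_ok v" "tail_ok z" "1 \<le> \<xi>"
  shows "\<bar>lower (profile \<rho> v z) \<xi> - \<rho> / (1 + \<rho>)\<bar> \<le> \<rho> / 16 * \<xi> powr (-\<delta>)"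
proof -
  have "\<bar>lower (profile \<rho> v z) \<xi> - \<rho> / (1 + \<rho>)\<bar> \<le> 5/2 * b * \<rho> * (\<xi> powr (-a) / a)"
    unfolding lower_profile_large[OF assms] using lower_tail_bound[OF smallD(3)[OF assms(1)] tail_part_Wbounded[OF assms(1,3)] assms(4)] by simp
  also have "\<dots> = \<rho> / 16 * \<xi> powr (-a)" using a_pos by (simp add: b_def)
  also have "\<dots> \<le> \<rho> / 16 * \<xi> powr (-\<delta>)" using tail_powr_le[OF assms(4)] smallD(1)[OF assms(1)] by (intro mult_left_mono) auto
  finally show ?thesis .
qed

text \<open>The heads contribute only through the prescribed total moment, so just the distance of
  the tails appears.\<close>

lemma lower_profile_large_diff:
  assumes "small \<rho>" "head_ok v" "tail_ok z" "head_ok v'" "tail_ok z'" "tail_dist d z z'" "1 \<le> \<xi>"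
  shows "\<bar>lower (profile \<rho> v z) \<xi> - lower (profile \<rho> v' z') \<xi>\<bar> \<le> \<rho> * d / 16 * \<xi> powr (-\<delta>)"
proof -
  note 0 = smallD(3)[OF assms(1)]
  have "lower (profile \<rho> v' z') \<xi> - lower (profile \<rho> v z) \<xi> = (\<integral>x. indicator {\<xi>..} x * (x powr (-1-a) * (tail_part \<rho> z x - tail_part \<rho> z' x)) \<partial>lborel)"
    unfolding lower_profile_large[OF assms(1-3,7)] lower_profile_large[OF assms(1,4,5,7)]
    using Bochner_Integration.integral_diff[OF lower_set_integrable[OF 0 tail_part_Wbounded[OF assms(1,3)], of "{\<xi>..}"]
      lower_set_integrable[OF 0 tail_part_Wbounded[OF assms(1,5)], of "{\<xi>..}"]]
    by (simp add: algebra_simps)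
  also have "\<bar>\<dots>\<bar> \<le> 5/2 * b * \<rho> * d * (\<xi> powr (-a) / a)"
    by (rule lower_tail_bound[OF 0 tail_part_diff_Wbounded[OF assms(1,3,5,6)] assms(7)])
  also have "\<dots> = \<rho> * d / 16 * \<xi> powr (-a)" using a_pos by (simp add: b_def)
  also have "\<dots> \<le> \<rho> * d / 16 * \<xi> powr (-\<delta>)"
    using tail_powr_le[OF assms(7)] smallD(1)[OF assms(1)] tail_distD(3)[OF assms(6)] by (intro mult_left_mono) auto
  finally show ?thesis by (simp add: abs_minus_commute)
qed

lemma profile_regular:
  assumes "small \<rho>" "head_ok v" "tail_ok z"
  shows "regular \<rho> (F_const * \<rho>) (profile \<rho> v z)"
  unfolding regular_def
proof (intro conjI allI impI profile_Wbounded assms)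
  fix x :: real assume x: "1 < x"
  have "\<bar>profile \<rho> v z x - \<rho> * upper (profile \<rho> v z) x\<bar> \<le> b * \<rho> * x powr (-\<delta>) * W \<rho> x"
    using x tail_value_tail_decay_bound[OF assms(1,3), of x] by (simp add: upper_profile[OF assms] profile_tail)
  also have "\<dots> \<le> F_const * \<rho> * x powr (-\<delta>) * W \<rho> x"
    using b_le_F_const b_pos smallD(1)[OF assms(1)] W_nonneg by (intro mult_right_mono) auto
  finally show "\<bar>profile \<rho> v z x - \<rho> * upper (profile \<rho> v z) x\<bar> \<le> F_const * \<rho> * x powr (-\<delta>) * W \<rho> x" .
qed

lemma profile_diff_regular:
  assumes "small \<rho>" "head_ok v" "tail_ok z" "head_ok v'" "tail_ok z'" "head_dist d v v'" "tail_dist d z z'"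
  shows "regular \<rho> (F_const * \<rho> * d) (\<lambda>x. profile \<rho> v z x - profile \<rho> v' z' x)"
  unfolding regular_def
proof (intro conjI allI impI profile_diff_Wbounded assms)
  fix x :: real assume x: "1 < x"
  have "(profile \<rho> v z x - profile \<rho> v' z' x) - \<rho> * upper (\<lambda>x. profile \<rho> v z x - profile \<rho> v' z' x) x
    = (tail_value \<rho> z x - \<rho> * (b * tail_decay \<rho> z x)) - (tail_value \<rho> z' x - \<rho> * (b * tail_decay \<rho> z' x))"
    unfolding upper_diff[OF smallD(1)[OF assms(1)] profile_Wbounded[OF assms(1-3)] profile_Wbounded[OF assms(1,4,5)]]
    using x by (simp add: upper_profile assms profile_tail algebra_simps)
  also have "\<bar>\<dots>\<bar> \<le> 5/2 * b * \<rho> * d * x powr (-\<delta>) * W \<rho> x"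
    using tail_value_tail_decay_diff[OF assms(1,3,5,7), of x] x by simp
  also have "\<dots> \<le> F_const * \<rho> * d * x powr (-\<delta>) * W \<rho> x"
    using b_le_F_const b_pos smallD(1)[OF assms(1)] W_nonneg tail_distD(3)[OF assms(7)] by (intro mult_right_mono) auto
  finally show "\<bar>(profile \<rho> v z x - profile \<rho> v' z' x) - \<rho> * upper (\<lambda>x. profile \<rho> v z x - profile \<rho> v' z' x) x\<bar> \<le> F_const * \<rho> * d * x powr (-\<delta>) * W \<rho> x" .
qed

section \<open>Contraction estimates and the fixed point\<close>

text \<open>The quotient \<open>f / A(\<xi>)\<close> on \<open>(0,1]\<close>, which does not depend on \<open>z\<close>.\<close>

definition norm_head :: "(real \<Rightarrow> real) \<Rightarrow> real \<Rightarrow> real \<Rightarrow> real" where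
  "norm_head v \<xi> x = (1 / head_decay v \<xi>) * head_part v x"

lemma norm_head_Wbounded: "head_ok v \<Longrightarrow> Wbounded \<rho> (\<bar>1 / head_decay v \<xi>\<bar> * (5/4 * b * W_const)) (norm_head v \<xi>)"
  unfolding norm_head_def[abs_def] by (intro Wbounded_scale head_part_Wbounded)

lemma norm_head_eq: "0 < x \<Longrightarrow> x \<le> 1 \<Longrightarrow> norm_head v \<xi> x = b * ((1 + v x) * (head_decay v x / head_decay v \<xi>))"
  by (simp add: norm_head_def head_part_def)

lemma lower_norm_head: "head_ok v \<Longrightarrow> 0 < \<xi> \<Longrightarrow> \<xi> \<le> 1 \<Longrightarrow> lower (norm_head v \<xi>) \<xi> = 1"
  unfolding norm_head_def[abs_def] using head_decay_bounds(3)[of v \<xi>] by (simp only: lower_scale lower_head_part) simp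

text \<open>For \<xi> \<le> 1 the first slot is evaluated only at x < \<xi>, where the profile is a
  multiple of the head. The exponentially small A(\<xi>) therefore factors out exactly and cancels
  in the quotient.\<close>

lemma coag_op_norm_head:
  assumes "head_ok v" "0 < \<xi>" "\<xi> \<le> 1"
  shows "coag_op (profile \<rho> v z) g \<xi> = lower (profile \<rho> v z) \<xi> * coag_op (norm_head v \<xi>) g \<xi>"
proof -
  have "coag_op (profile \<rho> v z) g \<xi> = coag_op (\<lambda>x. head_coeff \<rho> z * head_part v x) g \<xi>"
    unfolding coag_op_def using assms by (intro Bochner_Integration.integral_cong) (auto simp: profile_def tail_part_def)
  also have "\<dots> = head_coeff \<rho> z * coag_op (head_part v) g \<xi>" by (rule coag_op_scale_left)
  also have "coag_op (head_part v) g \<xi> = head_decay v \<xi> * coag_op (norm_head v \<xi>) g \<xi>"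
    unfolding norm_head_def[abs_def] coag_op_scale_left using head_decay_bounds(3)[OF assms] by simp
  finally show ?thesis by (simp add: lower_profile_small[OF assms])
qed

lemma norm_head_bounds:
  assumes "head_ok v" "0 < \<xi>" "\<xi> \<le> 1"
  shows "0 < x \<Longrightarrow> x < \<xi> \<Longrightarrow> \<bar>norm_head v \<xi> x\<bar> \<le> 1 + 2 * b"
    and "(\<integral>\<^sup>+x. ennreal (indicator {0<..<\<xi>} x * (x powr (-1-a) * \<bar>norm_head v \<xi> x\<bar>)) \<partial>lborel) \<le> ennreal (1 + 2 * b)"
proof -
  assume x: "0 < x" "x < \<xi>"
  have "head_decay v x \<le> head_decay v \<xi>"
  proof -
    have "0 \<le> head_exponent v x - head_exponent v \<xi>" using head_exponent_diff_bounds(1)[OF assms(1) x(1), of \<xi>] prim_mono[of x \<xi>] x assms by simp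
    then show ?thesis using b_pos by (simp add: head_decay_def)
  qed
  then have r: "0 \<le> head_decay v x / head_decay v \<xi>" "head_decay v x / head_decay v \<xi> \<le> 1" using head_decay_bounds(3)[OF assms(1), of x] head_decay_bounds(3)[OF assms] x assms by auto
  have p: "(1 + v x) * (head_decay v x / head_decay v \<xi>) \<le> 5/4 * 1" "0 \<le> (1 + v x) * (head_decay v x / head_decay v \<xi>)"
    using r head_okD[OF assms(1), of x] x assms by (intro mult_mono mult_nonneg_nonneg; simp)+
  have "b * ((1 + v x) * (head_decay v x / head_decay v \<xi>)) \<le> b * (5/4 * 1)"
    using p(1) b_pos by (intro mult_left_mono) auto
  moreover have "0 \<le> b * ((1 + v x) * (head_decay v x / head_decay v \<xi>))"
    using b_pos by (intro mult_nonneg_nonneg[OF _ p(2)]) simp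
  ultimately have "\<bar>b * ((1 + v x) * (head_decay v x / head_decay v \<xi>))\<bar> \<le> 1 + 2 * b" using b_pos by linarith
  then show "\<bar>norm_head v \<xi> x\<bar> \<le> 1 + 2 * b" using x assms by (simp only: norm_head_eq)
next
  have eq: "indicator {0<..<\<xi>} x * (x powr (-1-a) * \<bar>norm_head v \<xi> x\<bar>) = (1 / head_decay v \<xi>) * (indicator {0<..<\<xi>} x * (x powr (-1-a) * (b * (1 + v x) * head_decay v x)))" for x
  proof -
    have "0 \<le> norm_head v \<xi> x" unfolding norm_head_def using head_part_bounds(1)[OF assms(1), of x] head_decay_bounds(3)[OF assms] by simp
    then have "\<bar>norm_head v \<xi> x\<bar> = (1 / head_decay v \<xi>) * head_part v x" unfolding norm_head_def by (rule abs_of_nonneg)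
    then show ?thesis using assms(2,3) by (auto simp: head_part_def split: split_indicator)
  qed
  have int: "integrable lborel (\<lambda>x. indicator {0<..<\<xi>} x * (x powr (-1-a) * \<bar>norm_head v \<xi> x\<bar>))"
    unfolding eq by (intro integrable_mult_right head_decay_integral(2) assms)
  have "(\<integral>\<^sup>+x. ennreal (indicator {0<..<\<xi>} x * (x powr (-1-a) * \<bar>norm_head v \<xi> x\<bar>)) \<partial>lborel)
    = ennreal (\<integral>x. indicator {0<..<\<xi>} x * (x powr (-1-a) * \<bar>norm_head v \<xi> x\<bar>) \<partial>lborel)"
    by (rule nn_integral_eq_integral[OF int]) auto
  also have "(\<integral>x. indicator {0<..<\<xi>} x * (x powr (-1-a) * \<bar>norm_head v \<xi> x\<bar>) \<partial>lborel) = 1"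
    unfolding eq integral_mult_right_zero head_decay_integral(1)[OF assms] using head_decay_bounds(3)[OF assms] by simp
  also have "ennreal 1 \<le> ennreal (1 + 2 * b)" using b_pos by (intro ennreal_leI) simp
  finally show "(\<integral>\<^sup>+x. ennreal (indicator {0<..<\<xi>} x * (x powr (-1-a) * \<bar>norm_head v \<xi> x\<bar>)) \<partial>lborel) \<le> ennreal (1 + 2 * b)" .
qed

text \<open>The substitution t = prim x - prim \<xi> turns the integral into that of exp(-(b/2) t),
  whose value 2 / b does not depend on \<xi>.\<close>

lemma exp_prim_integral:
  assumes \<xi>: "0 < \<xi>"
  shows "integrable lborel (\<lambda>x. indicator {0<..<\<xi>} x * (x powr (-1-a) * exp (- (b/2) * (prim x - prim \<xi>))))"
    and "(\<integral>x. indicator {0<..<\<xi>} x * (x powr (-1-a) * exp (- (b/2) * (prim x - prim \<xi>))) \<partial>lborel) = 2 / b"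
proof -
  define F where "F x = 2 / b * exp (- (b/2) * (prim x - prim \<xi>))" for x
  have *: "DERIV F x :> x powr (-1-a) * exp (- (b/2) * (prim x - prim \<xi>))"
    "isCont (\<lambda>x. x powr (-1-a) * exp (- (b/2) * (prim x - prim \<xi>))) x"
    "0 \<le> x powr (-1-a) * exp (- (b/2) * (prim x - prim \<xi>))" if "0 < x" "x < \<xi>" for x
    unfolding F_def using that prim_deriv[of x] b_pos DERIV_isCont[OF prim_deriv[of x]]
    by (auto intro!: derivative_eq_intros continuous_intros)
  have "(F \<longlongrightarrow> 0) (at_right 0)" unfolding F_def prim_def using a_pos b_pos by real_asymp
  moreover have "(F \<longlongrightarrow> F \<xi>) (at_left \<xi>)"
  proof -
    have "isCont F \<xi>" unfolding F_def using DERIV_isCont[OF prim_deriv[OF \<xi>]] by (intro continuous_intros)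
    then show ?thesis unfolding isCont_def by (rule tendsto_within_subset) auto
  qed
  ultimately show "integrable lborel (\<lambda>x. indicator {0<..<\<xi>} x * (x powr (-1-a) * exp (- (b/2) * (prim x - prim \<xi>))))"
    "(\<integral>x. indicator {0<..<\<xi>} x * (x powr (-1-a) * exp (- (b/2) * (prim x - prim \<xi>))) \<partial>lborel) = 2 / b"
    using integral_FTC_Ioo[OF \<xi> *] by (auto simp: F_def)
qed

lemma norm_head_diff_pointwise:
  assumes v: "head_ok v" and w: "head_ok w" and d: "head_dist d v w" and x: "0 < x" "x < \<xi>" "\<xi> \<le> 1"
  shows "\<bar>norm_head v \<xi> x - norm_head w \<xi> x\<bar> \<le> 5 * b * d * exp (- (b/2) * (prim x - prim \<xi>))"
proof -
  define t where "t = prim x - prim \<xi>"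
  have t: "0 \<le> t" using prim_mono[of x \<xi>] x by (simp add: t_def)
  have d0: "0 \<le> d" using d by (simp add: head_dist_def)
  have "norm_head v \<xi> x - norm_head w \<xi> x = b * ((1 + v x) * (head_decay v x / head_decay v \<xi>) - (1 + w x) * (head_decay w x / head_decay w \<xi>))"
    using x by (simp add: norm_head_eq algebra_simps)
  also have "\<bar>\<dots>\<bar> \<le> b * (d * (1 + 5/4 * b * t) * exp (- (3/4) * b * t))"
    unfolding abs_mult t_def using head_decay_ratio_diff[OF v w d x(1), of \<xi>] x b_pos by (intro mult_mono) auto
  \<comment> \<open>A quarter of the rate is given up to absorb the factor linear in t, leaving b/2
    out of (3/4) * b.\<close>
  also have "\<dots> \<le> b * (d * (5 * exp (b * t / 4)) * exp (- (3/4) * b * t))"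
  proof -
    have "1 + 5/4 * b * t \<le> 5 * (1 + b * t / 4)" using t b_pos by simp
    also have "\<dots> \<le> 5 * exp (b * t / 4)" by (intro mult_left_mono exp_ge_add_one_self) simp
    finally show ?thesis using b_pos d0 by (intro mult_left_mono mult_right_mono) auto
  qed
  also have "\<dots> = 5 * b * d * (exp (b * t / 4) * exp (- (3/4) * b * t))" by simp
  also have "exp (b * t / 4) * exp (- (3/4) * b * t) = exp (- (b/2) * t)" by (simp flip: exp_add)
  finally show ?thesis by (simp add: t_def)
qed

lemma norm_head_diff_bounds:
  assumes v: "head_ok v" and w: "head_ok w" and d: "head_dist d v w" and \<xi>: "0 < \<xi>" "\<xi> \<le> 1"
  shows "0 < x \<Longrightarrow> x < \<xi> \<Longrightarrow> \<bar>norm_head v \<xi> x - norm_head w \<xi> x\<bar> \<le> (10 + 5 * b) * d"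
    and "(\<integral>\<^sup>+x. ennreal (indicator {0<..<\<xi>} x * (x powr (-1-a) * \<bar>norm_head v \<xi> x - norm_head w \<xi> x\<bar>)) \<partial>lborel) \<le> ennreal ((10 + 5 * b) * d)"
proof -
  have d0: "0 \<le> d" using d by (simp add: head_dist_def)
  note p = norm_head_diff_pointwise[OF v w d _ _ \<xi>(2)]
  show "\<bar>norm_head v \<xi> x - norm_head w \<xi> x\<bar> \<le> (10 + 5 * b) * d" if x: "0 < x" "x < \<xi>"
  proof -
    have "exp (- (b/2) * (prim x - prim \<xi>)) \<le> 1" using prim_mono[of x \<xi>] x b_pos by simp
    then have "5 * b * d * exp (- (b/2) * (prim x - prim \<xi>)) \<le> 5 * b * d * 1" using b_pos d0 by (intro mult_left_mono) auto
    then show ?thesis using p[OF x] d0 by (simp add: algebra_simps)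
  qed
  have "(\<integral>\<^sup>+x. ennreal (indicator {0<..<\<xi>} x * (x powr (-1-a) * \<bar>norm_head v \<xi> x - norm_head w \<xi> x\<bar>)) \<partial>lborel)
    \<le> (\<integral>\<^sup>+x. ennreal (5 * b * d * (indicator {0<..<\<xi>} x * (x powr (-1-a) * exp (- (b/2) * (prim x - prim \<xi>))))) \<partial>lborel)"
  proof (intro nn_integral_mono ennreal_leI)
    fix x
    show "indicator {0<..<\<xi>} x * (x powr (-1-a) * \<bar>norm_head v \<xi> x - norm_head w \<xi> x\<bar>)
      \<le> 5 * b * d * (indicator {0<..<\<xi>} x * (x powr (-1-a) * exp (- (b/2) * (prim x - prim \<xi>))))"
    proof (cases "x \<in> {0<..<\<xi>}")
      case True
      then have "x powr (-1-a) * \<bar>norm_head v \<xi> x - norm_head w \<xi> x\<bar> \<le> x powr (-1-a) * (5 * b * d * exp (- (b/2) * (prim x - prim \<xi>)))"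
        using p[of x] by (intro mult_left_mono) auto
      then show ?thesis using True by simp
    qed simp
  qed
  also have "\<dots> = ennreal (\<integral>x. 5 * b * d * (indicator {0<..<\<xi>} x * (x powr (-1-a) * exp (- (b/2) * (prim x - prim \<xi>)))) \<partial>lborel)"
    using exp_prim_integral(1)[OF \<xi>(1)] b_pos d0 by (intro nn_integral_eq_integral AE_I2) auto
  also have "(\<integral>x. 5 * b * d * (indicator {0<..<\<xi>} x * (x powr (-1-a) * exp (- (b/2) * (prim x - prim \<xi>)))) \<partial>lborel) = 5 * b * d * (2 / b)"
    unfolding integral_mult_right_zero exp_prim_integral(2)[OF \<xi>(1)] ..
  also have "5 * b * d * (2 / b) \<le> (10 + 5 * b) * d" using b_pos d0 by (simp add: algebra_simps)
  finally show "(\<integral>\<^sup>+x. ennreal (indicator {0<..<\<xi>} x * (x powr (-1-a) * \<bar>norm_head v \<xi> x - norm_head w \<xi> x\<bar>)) \<partial>lborel) \<le> ennreal ((10 + 5 * b) * d)"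
    by (simp add: ennreal_leI)
qed

text \<open>Below 1 the weight satisfies W / y = y^(a+1) \<le> 1, so Q changes by at most c. The
  value \<xi> = 0 is included because it gives the mass.\<close>

lemma upper_small:
  assumes "0 < \<rho>" "Wbounded \<rho> c f" "0 \<le> \<xi>" "\<xi> \<le> 1"
  shows "\<bar>upper f \<xi> - upper f 1\<bar> \<le> c"
proof -
  note f = WboundedD[OF assms(2)]
  have [measurable]: "f \<in> borel_measurable borel" by (rule f)
  have "upper f \<xi> - upper f 1 = (\<integral>y. indicator {\<xi>..<1} y * (y powr (-1) * f y) \<partial>lborel)"
    unfolding upper_def Bochner_Integration.integral_diff[OF upper_set_integrable[OF assms(1,2), of "{\<xi>..}", simplified]
      upper_set_integrable[OF assms(1,2), of "{1..}", simplified], symmetric]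
    using assms by (intro Bochner_Integration.integral_cong) (auto split: split_indicator)
  also have "\<bar>\<dots>\<bar> \<le> c * 1"
  proof (rule integrable_dominated(2))
    show "\<bar>indicator {\<xi>..<1} y * (y powr (-1) * f y)\<bar> \<le> c * indicator {0<..<1} y" for y
    proof (cases "y \<in> {\<xi>..<1} \<and> y \<noteq> 0")
      case True
      have "y powr (-1) * \<bar>f y\<bar> \<le> y powr (-1) * (c * W \<rho> y)" using True by (intro mult_left_mono f) auto
      also have "\<dots> = c * (y powr (-1) * y powr (a+2))" using True assms by (simp add: W_def)
      also have "y powr (-1) * y powr (a+2) = y powr (a+1)" by (rule powr_mult_powr) simp
      also have "\<dots> \<le> 1" using True assms a_pos powr_mono2[of "a+1" y 1] by auto
      finally have "y powr (-1) * \<bar>f y\<bar> \<le> c" using f(2) by (simp add: mult_left_mono)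
      then show ?thesis using True assms by (simp add: abs_mult)
    qed (use f(2) in auto)
    have i: "(\<integral>\<^sup>+y. ennreal (indicator {0<..<1::real} y) \<partial>lborel) \<le> ennreal 1" by (simp add: ennreal_indicator)
    show "(\<integral>\<^sup>+y. ennreal (c * indicator {0<..<1::real} y) \<partial>lborel) \<le> ennreal (c * 1)"
      by (rule nn_integral_cmult_le[OF _ f(2) i]) auto
  qed (use f(2) in auto)
  finally show ?thesis by simp
qed

section \<open>The fixed point maps: invariance and contraction\<close>

definition err_const_1 :: real where "err_const_1 = K0 * (1 + 1/\<delta>) + (1 + K0) * (1 + H)"
text \<open>The number 11 + 7 * b is the sum of the Lipschitz constant 10 + 5 * b and the size 1 + 2
  * b of the normalised head. The summand 1 accounts for the variation of Q on (0,1], and the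
  denominator b for the normalisation of the map.\<close>

definition head_const :: real where "head_const = (err_const_1 * (11 + 7 * b) + 1) * F_const / b"
definition err_const_2 :: real where "err_const_2 = K0 * H / \<delta> + 2 * (6 + 4 * K0) * H"
text \<open>The 6 is 4 + 2: the lower bound b * W / 2 for Q doubles both the two telescoping terms
  of the remainder and the one coming from the change of the denominator.\<close>

definition tail_const :: real where "tail_const = 6 * err_const_2 * F_const\<^sup>2 / b"

lemma const_nonneg: "0 \<le> err_const_1" "0 \<le> err_const_2" "0 \<le> head_const" "0 \<le> tail_const"
  using K0_nonneg \<delta>_pos H_ge F_const_pos b_pos by (auto simp: err_const_1_def err_const_2_def head_const_def tail_const_def)

text \<open>The equation on (0,1] solved for v: the operator equals b (1 + v) A at \<xi> precisely
  when this expression equals v at \<xi>. Likewise for \<open>tail_map\<close>, z and \<rho> (1 + z)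
  Q.\<close>

definition head_map :: "real \<Rightarrow> (real \<Rightarrow> real) \<Rightarrow> (real \<Rightarrow> real) \<Rightarrow> real \<Rightarrow> real" where
  "head_map \<rho> v z \<xi> = coag_op (profile \<rho> v z) (profile \<rho> v z) \<xi> / (b * lower (profile \<rho> v z) \<xi>) - 1"

definition tail_map :: "real \<Rightarrow> (real \<Rightarrow> real) \<Rightarrow> (real \<Rightarrow> real) \<Rightarrow> real \<Rightarrow> real" where
  "tail_map \<rho> v z \<xi> = coag_op (profile \<rho> v z) (profile \<rho> v z) \<xi> / (\<rho> * upper (profile \<rho> v z) \<xi>) - 1"

lemma head_map_eq:
  assumes "small \<rho>" "head_ok v" "tail_ok z" "0 < \<xi>" "\<xi> \<le> 1"
  shows "head_map \<rho> v z \<xi> = coag_op (norm_head v \<xi>) (profile \<rho> v z) \<xi> / b - 1"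
  using head_coeff_bounds(3)[OF assms(1,3)] head_decay_bounds(3)[OF assms(2,4,5)]
  unfolding head_map_def coag_op_norm_head[OF assms(2,4,5)] lower_profile_small[OF assms(2,4,5)] by simp

lemma head_map_bound:
  assumes "small \<rho>" "head_ok v" "tail_ok z" "0 < \<xi>" "\<xi> \<le> 1"
  shows "\<bar>head_map \<rho> v z \<xi>\<bar> \<le> head_const * \<rho>"
proof -
  define P where "P = profile \<rho> v z"
  note \<rho> = smallD(1)[OF assms(1)] and P = profile_Wbounded[OF assms(1-3), folded P_def]
  have 1: "\<bar>coag_op (norm_head v \<xi>) P \<xi> - upper P \<xi>\<bar> \<le> err_const_1 * (1 + 2 * b) * (F_const * \<rho>)"
    using coag_op_small_estimate[OF \<rho> assms(4,5) norm_head_Wbounded[OF assms(2), of \<rho> \<xi>] P, of "1 + 2 * b"] norm_head_bounds[OF assms(2,4,5)] b_pos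
      lower_norm_head[OF assms(2,4,5)] by (simp add: err_const_1_def)
  have 2: "\<bar>upper P \<xi> - b\<bar> \<le> F_const * \<rho>" using upper_small[OF \<rho> P less_imp_le[OF assms(4)] assms(5)] upper_profile[OF assms(1-3), of 1] by (simp add: P_def)
  have "\<bar>coag_op (norm_head v \<xi>) P \<xi> - b\<bar> \<le> (err_const_1 * (1 + 2 * b) + 1) * (F_const * \<rho>)" using 1 2 by (simp add: algebra_simps abs_le_iff)
  also have "\<dots> \<le> (err_const_1 * (11 + 7 * b) + 1) * (F_const * \<rho>)" using const_nonneg b_pos F_const_pos \<rho> by (intro mult_right_mono add_right_mono mult_left_mono) auto
  finally have "\<bar>coag_op (norm_head v \<xi>) P \<xi> - b\<bar> / b \<le> (err_const_1 * (11 + 7 * b) + 1) * (F_const * \<rho>) / b" using b_pos by (intro divide_right_mono) auto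
  moreover have "head_map \<rho> v z \<xi> = (coag_op (norm_head v \<xi>) P \<xi> - b) / b" using head_map_eq[OF assms] b_pos by (simp add: P_def diff_divide_distrib)
  ultimately show ?thesis using b_pos by (simp add: head_const_def mult_ac)
qed

lemma head_map_diff:
  assumes "small \<rho>" "head_ok v" "tail_ok z" "head_ok v'" "tail_ok z'" "head_dist d v v'" "tail_dist d z z'" "0 < \<xi>" "\<xi> \<le> 1"
  shows "\<bar>head_map \<rho> v z \<xi> - head_map \<rho> v' z' \<xi>\<bar> \<le> head_const * \<rho> * d"
proof -
  define P where "P = profile \<rho> v z"
  define P' where "P' = profile \<rho> v' z'"
  define G where "G x = P x - P' x" for x
  note \<rho> = smallD(1)[OF assms(1)] and d0 = tail_distD(3)[OF assms(7)]
  note P = profile_Wbounded[OF assms(1-3), folded P_def] and P' = profile_Wbounded[OF assms(1,4,5), folded P'_def]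
  have G: "Wbounded \<rho> (F_const * \<rho> * d) G" using profile_diff_Wbounded[OF assms(1-7)] by (simp add: G_def[abs_def] P_def P'_def)
  note norm_head = norm_head_Wbounded[OF assms(2), of \<rho> \<xi>] and norm_head' = norm_head_Wbounded[OF assms(4), of \<rho> \<xi>]
  \<comment> \<open>Both normalised heads have the same moment 1 below \<xi>, so the main term of
    their difference vanishes and only the O(\<rho>) error is left.\<close>
  have A0: "lower (\<lambda>x. norm_head v \<xi> x - norm_head v' \<xi> x) \<xi> = 0"
    using lower_diff[OF smallD(3)[OF assms(1)] norm_head norm_head'] assms by (simp add: lower_norm_head)
  have 1: "\<bar>coag_op (\<lambda>x. norm_head v \<xi> x - norm_head v' \<xi> x) P \<xi>\<bar> \<le> err_const_1 * ((10 + 5 * b) * d) * (F_const * \<rho>)"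
    using coag_op_small_estimate[OF \<rho> assms(8,9) Wbounded_diff[OF norm_head norm_head'] P, of "(10 + 5 * b) * d"]
      norm_head_diff_bounds[OF assms(2,4,6,8,9)] b_pos d0 by (simp add: A0 err_const_1_def)
  have 2: "\<bar>coag_op (norm_head v' \<xi>) G \<xi> - upper G \<xi>\<bar> \<le> err_const_1 * (1 + 2 * b) * (F_const * \<rho> * d)"
    using coag_op_small_estimate[OF \<rho> assms(8,9) norm_head' G, of "1 + 2 * b"] norm_head_bounds[OF assms(4,8,9)] b_pos
      lower_norm_head[OF assms(4,8,9)] by (simp add: err_const_1_def)
  \<comment> \<open>Both profiles have Q(1) = b. Without this cancellation the head map would not be
    Lipschitz with a constant of order \<rho>.\<close>
  have "upper G 1 = 0" unfolding G_def[abs_def] upper_diff[OF \<rho> P P']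
    using assms by (simp add: upper_profile P_def P'_def)
  then have 3: "\<bar>upper G \<xi>\<bar> \<le> F_const * \<rho> * d" using upper_small[OF \<rho> G less_imp_le[OF assms(8)] assms(9)] by simp
  have "coag_op (norm_head v \<xi>) P \<xi> - coag_op (norm_head v' \<xi>) P' \<xi> = coag_op (\<lambda>x. norm_head v \<xi> x - norm_head v' \<xi> x) P \<xi> + coag_op (norm_head v' \<xi>) G \<xi>"
    unfolding G_def using coag_op_diff_left[OF \<rho> norm_head norm_head' P] coag_op_diff_right[OF \<rho> P P' norm_head'] by simp
  then have "\<bar>coag_op (norm_head v \<xi>) P \<xi> - coag_op (norm_head v' \<xi>) P' \<xi>\<bar> \<le> err_const_1 * ((10 + 5 * b) * d) * (F_const * \<rho>) + err_const_1 * (1 + 2 * b) * (F_const * \<rho> * d) + F_const * \<rho> * d"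
    using 1 2 3 by linarith
  also have "\<dots> = (err_const_1 * (11 + 7 * b) + 1) * (F_const * \<rho> * d)" by (simp add: algebra_simps)
  finally have "\<bar>coag_op (norm_head v \<xi>) P \<xi> - coag_op (norm_head v' \<xi>) P' \<xi>\<bar> / b \<le> (err_const_1 * (11 + 7 * b) + 1) * (F_const * \<rho> * d) / b"
    using b_pos by (intro divide_right_mono) auto
  moreover have "head_map \<rho> v z \<xi> - head_map \<rho> v' z' \<xi> = (coag_op (norm_head v \<xi>) P \<xi> - coag_op (norm_head v' \<xi>) P' \<xi>) / b"
    using head_map_eq[OF assms(1-3,8,9)] head_map_eq[OF assms(1,4,5,8,9)] by (simp add: P_def P'_def diff_divide_distrib)
  ultimately show ?thesis using b_pos by (simp add: head_const_def mult_ac)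
qed

definition remainder :: "real \<Rightarrow> (real \<Rightarrow> real) \<Rightarrow> (real \<Rightarrow> real) \<Rightarrow> real \<Rightarrow> real" where
  "remainder \<rho> f g \<xi> = coag_op f g \<xi> - lower f \<xi> * upper g \<xi> - \<rho> * upper f \<xi> * lower g \<xi>"

text \<open>The two main terms add up to (1 + \<rho>) A Q. Dividing by \<rho> Q and subtracting 1
  gives zero exactly when A = \<rho> / (1 + \<rho>), which is why the moment is prescribed to be
  this value.\<close>

lemma tail_map_eq:
  assumes "small \<rho>" "head_ok v" "tail_ok z" "1 \<le> \<xi>"
  shows "tail_map \<rho> v z \<xi> = (1 + \<rho>) / \<rho> * (lower (profile \<rho> v z) \<xi> - \<rho> / (1 + \<rho>)) + remainder \<rho> (profile \<rho> v z) (profile \<rho> v z) \<xi> / (\<rho> * upper (profile \<rho> v z) \<xi>)"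
proof -
  define A where "A = lower (profile \<rho> v z) \<xi>"
  define Q where "Q = upper (profile \<rho> v z) \<xi>"
  define R where "R = coag_op (profile \<rho> v z) (profile \<rho> v z) \<xi>"
  have "0 < Q" using tail_decay_bounds(3)[OF assms(1,3,4)] b_pos by (simp add: Q_def upper_profile[OF assms])
  then have "(R - A * Q - \<rho> * Q * A) / (\<rho> * Q) = R / (\<rho> * Q) - (1 + \<rho>) / \<rho> * A"
    using smallD(1)[OF assms(1)] by (simp add: field_simps)
  moreover have "(1 + \<rho>) / \<rho> * (A - \<rho> / (1 + \<rho>)) = (1 + \<rho>) / \<rho> * A - 1"
    using smallD(1)[OF assms(1)] by (simp add: right_diff_distrib)
  ultimately have "R / (\<rho> * Q) - 1 = (1 + \<rho>) / \<rho> * (A - \<rho> / (1 + \<rho>)) + (R - A * Q - \<rho> * Q * A) / (\<rho> * Q)"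
    by simp
  then show ?thesis by (simp add: tail_map_def remainder_def A_def Q_def R_def)
qed

lemma upper_profile_lower:
  assumes "small \<rho>" "head_ok v" "tail_ok z" "1 \<le> \<xi>"
  shows "b * W \<rho> \<xi> / 2 \<le> upper (profile \<rho> v z) \<xi>"
  using tail_decay_bounds(1)[OF assms(1,3,4)] b_pos mult_left_mono[of "W \<rho> \<xi> / 2" "tail_decay \<rho> z \<xi>" b] by (simp add: upper_profile[OF assms])

text \<open>Q is at least b * W / 2, so the weight cancels and only the decay \<xi>^(-\<delta>) of
  the error survives.\<close>

lemma remainder_over_Q:
  assumes "small \<rho>" "head_ok v" "tail_ok z" "1 \<le> \<xi>" and e: "\<bar>e\<bar> \<le> C * W \<rho> \<xi> * \<xi> powr (-\<delta>)" "0 \<le> C"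
  shows "\<bar>e / upper (profile \<rho> v z) \<xi>\<bar> \<le> 2 * C / b * \<xi> powr (-\<delta>)"
proof -
  have W: "0 < W \<rho> \<xi>" using assms W_pos by simp
  note Q = upper_profile_lower[OF assms(1-4)]
  have Q0: "0 < b * W \<rho> \<xi> / 2" using W b_pos by simp
  have "\<bar>e / upper (profile \<rho> v z) \<xi>\<bar> = \<bar>e\<bar> / upper (profile \<rho> v z) \<xi>" using Q Q0 by simp
  also have "\<dots> \<le> (C * W \<rho> \<xi> * \<xi> powr (-\<delta>)) / (b * W \<rho> \<xi> / 2)"
    using Q Q0 e W by (intro frac_le) auto
  also have "\<dots> = 2 * C / b * \<xi> powr (-\<delta>)" using W b_pos by (simp add: field_simps)
  finally show ?thesis .
qed

text \<open>The remainder is quadratic in \<rho> and loses one power to the denominator. The 1/8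
  comes from the deviation of A from its total, which does not shrink with \<rho>; it is controlled
  by the choice of b.\<close>

lemma tail_map_bound:
  assumes "small \<rho>" "head_ok v" "tail_ok z" "1 \<le> \<xi>"
  shows "\<bar>tail_map \<rho> v z \<xi>\<bar> \<le> (1/8 + tail_const * \<rho>) * \<xi> powr (-\<delta>)"
proof -
  define P where "P = profile \<rho> v z"
  note \<rho> = smallD(1,2)[OF assms(1)]
  note P = profile_Wbounded[OF assms(1-3), folded P_def] and Pa = profile_regular[OF assms(1-3), folded P_def]
  have "\<bar>remainder \<rho> P P \<xi>\<bar> \<le> (err_const_2 * (F_const * \<rho>) * (F_const * \<rho>)) * W \<rho> \<xi> * \<xi> powr (-\<delta>)"
    unfolding remainder_def err_const_2_def by (rule coag_op_large_estimate[OF \<rho> Pa P assms(4)])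
  from remainder_over_Q[OF assms this] have "\<bar>remainder \<rho> P P \<xi> / upper P \<xi>\<bar> \<le> 2 * (err_const_2 * (F_const * \<rho>) * (F_const * \<rho>)) / b * \<xi> powr (-\<delta>)"
    using const_nonneg F_const_pos \<rho> by (simp add: P_def)
  then have "\<bar>remainder \<rho> P P \<xi> / upper P \<xi>\<bar> / \<rho> \<le> (2 * (err_const_2 * (F_const * \<rho>) * (F_const * \<rho>)) / b * \<xi> powr (-\<delta>)) / \<rho>"
    using \<rho> by (intro divide_right_mono) auto
  also have "\<dots> = (2 * err_const_2 * F_const\<^sup>2 / b) * \<rho> * \<xi> powr (-\<delta>)" using \<rho> by (simp add: power2_eq_square)
  also have "\<dots> \<le> tail_const * \<rho> * \<xi> powr (-\<delta>)" unfolding tail_const_def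
    using \<rho> const_nonneg b_pos by (intro mult_right_mono divide_right_mono) auto
  finally have 1: "\<bar>remainder \<rho> P P \<xi> / (\<rho> * upper P \<xi>)\<bar> \<le> tail_const * \<rho> * \<xi> powr (-\<delta>)" using \<rho> by (simp add: abs_mult mult.commute)
  have "\<bar>(1 + \<rho>) / \<rho> * (lower P \<xi> - \<rho> / (1 + \<rho>))\<bar> \<le> (2 / \<rho>) * (\<rho> / 16 * \<xi> powr (-\<delta>))"
    unfolding abs_mult using lower_profile_large_bound[OF assms] \<rho> by (intro mult_mono) (auto simp: P_def divide_right_mono)
  also have "\<dots> = 1/8 * \<xi> powr (-\<delta>)" using \<rho> by simp
  finally have "\<bar>(1 + \<rho>) / \<rho> * (lower P \<xi> - \<rho> / (1 + \<rho>)) + remainder \<rho> P P \<xi> / (\<rho> * upper P \<xi>)\<bar> \<le> 1/8 * \<xi> powr (-\<delta>) + tail_const * \<rho> * \<xi> powr (-\<delta>)"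
    using 1 by (intro order_trans[OF abs_triangle_ineq] add_mono)
  then show ?thesis unfolding tail_map_eq[OF assms] P_def[symmetric] distrib_right .
qed

lemma tail_map_diff:
  assumes "small \<rho>" "head_ok v" "tail_ok z" "head_ok v'" "tail_ok z'" "head_dist d v v'" "tail_dist d z z'" "1 \<le> \<xi>"
  shows "\<bar>tail_map \<rho> v z \<xi> - tail_map \<rho> v' z' \<xi>\<bar> \<le> (1/8 + tail_const * \<rho>) * d * \<xi> powr (-\<delta>)"
proof -
  define P where "P = profile \<rho> v z"
  define P' where "P' = profile \<rho> v' z'"
  define G where "G x = P x - P' x" for x
  note \<rho> = smallD(1,2)[OF assms(1)] and d0 = tail_distD(3)[OF assms(7)]
  note P = profile_Wbounded[OF assms(1-3), folded P_def] and P' = profile_Wbounded[OF assms(1,4,5), folded P'_def]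
  note Pa = profile_regular[OF assms(1-3), folded P_def] and Pa' = profile_regular[OF assms(1,4,5), folded P'_def]
  have Ga: "regular \<rho> (F_const * \<rho> * d) G" using profile_diff_regular[OF assms(1-7)] by (simp add: G_def[abs_def] P_def P'_def)
  have G: "Wbounded \<rho> (F_const * \<rho> * d) G" using Ga by (simp add: regular_def)
  have e1: "\<bar>remainder \<rho> G P \<xi>\<bar> \<le> (err_const_2 * (F_const * \<rho> * d) * (F_const * \<rho>)) * W \<rho> \<xi> * \<xi> powr (-\<delta>)"
    unfolding remainder_def err_const_2_def by (rule coag_op_large_estimate[OF \<rho> Ga P assms(8)])
  have e2: "\<bar>remainder \<rho> P' G \<xi>\<bar> \<le> (err_const_2 * (F_const * \<rho>) * (F_const * \<rho> * d)) * W \<rho> \<xi> * \<xi> powr (-\<delta>)"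
    unfolding remainder_def err_const_2_def by (rule coag_op_large_estimate[OF \<rho> Pa' G assms(8)])
  \<comment> \<open>Bilinearity reduces the difference to one change in each slot. In the first slot
    this uses that the difference of two profiles is itself regular.\<close>
  have "remainder \<rho> P P \<xi> - remainder \<rho> P' P' \<xi> = remainder \<rho> G P \<xi> + remainder \<rho> P' G \<xi>"
    unfolding remainder_def G_def coag_op_diff_left[OF \<rho>(1) P P' P] coag_op_diff_right[OF \<rho>(1) P P' P']
      lower_diff[OF smallD(3)[OF assms(1)] P P'] upper_diff[OF \<rho>(1) P P'] by (simp add: algebra_simps)
  then have e3: "\<bar>remainder \<rho> P P \<xi> - remainder \<rho> P' P' \<xi>\<bar> \<le> (2 * (err_const_2 * (F_const * \<rho>) * (F_const * \<rho>) * d)) * W \<rho> \<xi> * \<xi> powr (-\<delta>)"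
    using e1 e2 by (simp add: algebra_simps)
  have a1: "\<bar>(remainder \<rho> P P \<xi> - remainder \<rho> P' P' \<xi>) / upper P \<xi>\<bar> \<le> 2 * (2 * (err_const_2 * (F_const * \<rho>) * (F_const * \<rho>) * d)) / b * \<xi> powr (-\<delta>)"
    using remainder_over_Q[OF assms(1-3,8) e3] const_nonneg F_const_pos \<rho> d0 by (simp add: P_def)
  have e4: "\<bar>remainder \<rho> P' P' \<xi>\<bar> \<le> (err_const_2 * (F_const * \<rho>) * (F_const * \<rho>)) * W \<rho> \<xi> * \<xi> powr (-\<delta>)"
    unfolding remainder_def err_const_2_def by (rule coag_op_large_estimate[OF \<rho> Pa' P' assms(8)])
  have a2: "\<bar>remainder \<rho> P' P' \<xi> / upper P' \<xi>\<bar> \<le> 2 * (err_const_2 * (F_const * \<rho>) * (F_const * \<rho>)) / b * \<xi> powr (-\<delta>)"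
    using remainder_over_Q[OF assms(1,4,5,8) e4] const_nonneg F_const_pos \<rho> d0 by (simp add: P'_def)
  have W: "0 < W \<rho> \<xi>" using assms(8) W_pos by simp
  have Q0: "0 < b * W \<rho> \<xi> / 2" "b * W \<rho> \<xi> / 2 \<le> upper P \<xi>" "b * W \<rho> \<xi> / 2 \<le> upper P' \<xi>"
    using W b_pos upper_profile_lower[OF assms(1-3,8)] upper_profile_lower[OF assms(1,4,5,8)] by (auto simp: P_def P'_def)
  have a3: "\<bar>(upper P' \<xi> - upper P \<xi>) / upper P \<xi>\<bar> \<le> d"
  proof -
    have "\<bar>upper P' \<xi> - upper P \<xi>\<bar> = b * \<bar>tail_decay \<rho> z \<xi> - tail_decay \<rho> z' \<xi>\<bar>"
      using b_pos assms by (simp add: P_def P'_def upper_profile abs_mult abs_minus_commute flip: right_diff_distrib)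
    also have "\<dots> \<le> b * (2/5 * d * W \<rho> \<xi>)" using tail_decay_diff'[OF assms(1,3,5,7,8)] b_pos by (intro mult_left_mono) auto
    also have "\<dots> = (4/5 * d) * (b * W \<rho> \<xi> / 2)" by simp
    also have "\<dots> \<le> d * upper P \<xi>" using Q0 d0 by (intro mult_mono) auto
    finally show ?thesis using Q0 by (simp add: divide_le_eq)
  qed
  \<comment> \<open>The quotients have different denominators; the change of Q is split off and
    multiplied by a quotient that is already small.\<close>
  have eq: "remainder \<rho> P P \<xi> / upper P \<xi> - remainder \<rho> P' P' \<xi> / upper P' \<xi>
     = (remainder \<rho> P P \<xi> - remainder \<rho> P' P' \<xi>) / upper P \<xi> + (remainder \<rho> P' P' \<xi> / upper P' \<xi>) * ((upper P' \<xi> - upper P \<xi>) / upper P \<xi>)"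
    using Q0 by (simp add: field_simps)
  have "\<bar>(remainder \<rho> P' P' \<xi> / upper P' \<xi>) * ((upper P' \<xi> - upper P \<xi>) / upper P \<xi>)\<bar> \<le> (2 * (err_const_2 * (F_const * \<rho>) * (F_const * \<rho>)) / b * \<xi> powr (-\<delta>)) * d"
    unfolding abs_mult using a2 a3 const_nonneg F_const_pos \<rho> d0 b_pos by (intro mult_mono) auto
  then have "\<bar>remainder \<rho> P P \<xi> / upper P \<xi> - remainder \<rho> P' P' \<xi> / upper P' \<xi>\<bar> \<le> 2 * (2 * (err_const_2 * (F_const * \<rho>) * (F_const * \<rho>) * d)) / b * \<xi> powr (-\<delta>)
       + (2 * (err_const_2 * (F_const * \<rho>) * (F_const * \<rho>)) / b * \<xi> powr (-\<delta>)) * d"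
    unfolding eq using a1 by linarith
  also have "\<dots> = tail_const * \<rho> * \<rho> * d * \<xi> powr (-\<delta>)" by (simp add: tail_const_def power2_eq_square algebra_simps)
  finally have "\<bar>remainder \<rho> P P \<xi> / upper P \<xi> - remainder \<rho> P' P' \<xi> / upper P' \<xi>\<bar> / \<rho> \<le> tail_const * \<rho> * \<rho> * d * \<xi> powr (-\<delta>) / \<rho>"
    using \<rho> by (intro divide_right_mono) auto
  moreover have "remainder \<rho> P P \<xi> / (\<rho> * upper P \<xi>) - remainder \<rho> P' P' \<xi> / (\<rho> * upper P' \<xi>) = (remainder \<rho> P P \<xi> / upper P \<xi> - remainder \<rho> P' P' \<xi> / upper P' \<xi>) / \<rho>"
    by (simp add: diff_divide_distrib mult.commute)
  moreover have "tail_const * \<rho> * \<rho> * d * \<xi> powr (-\<delta>) / \<rho> = tail_const * \<rho> * d * \<xi> powr (-\<delta>)" using \<rho> by simp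
  ultimately have 1: "\<bar>remainder \<rho> P P \<xi> / (\<rho> * upper P \<xi>) - remainder \<rho> P' P' \<xi> / (\<rho> * upper P' \<xi>)\<bar> \<le> tail_const * \<rho> * d * \<xi> powr (-\<delta>)"
    using \<rho>(1) by (simp only: abs_divide abs_of_pos)
  have "\<bar>(1 + \<rho>) / \<rho> * (lower P \<xi> - lower P' \<xi>)\<bar> \<le> (2 / \<rho>) * (\<rho> * d / 16 * \<xi> powr (-\<delta>))"
    unfolding abs_mult using lower_profile_large_diff[OF assms(1-5,7,8)] \<rho> by (intro mult_mono) (auto simp: P_def P'_def divide_right_mono)
  also have "\<dots> = 1/8 * d * \<xi> powr (-\<delta>)" using \<rho> by simp
  finally have 2: "\<bar>(1 + \<rho>) / \<rho> * (lower P \<xi> - lower P' \<xi>)\<bar> \<le> 1/8 * d * \<xi> powr (-\<delta>)" .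
  have 3: "tail_map \<rho> v z \<xi> - tail_map \<rho> v' z' \<xi> = (1 + \<rho>) / \<rho> * (lower P \<xi> - lower P' \<xi>) + (remainder \<rho> P P \<xi> / (\<rho> * upper P \<xi>) - remainder \<rho> P' P' \<xi> / (\<rho> * upper P' \<xi>))"
    unfolding tail_map_eq[OF assms(1-3,8)] tail_map_eq[OF assms(1,4,5,8)] P_def[symmetric] P'_def[symmetric] by (simp add: algebra_simps)
  show ?thesis unfolding 3 distrib_right using 1 2 by (intro order_trans[OF abs_triangle_ineq] add_mono)
qed

text \<open>A pair \<open>(v, z)\<close> is encoded as one function on \<open>bool \<times> real\<close>, with \<open>False\<close> for \<open>v\<close> and \<open>True\<close> for \<open>z\<close>.\<close>

definition pert_bound :: "bool \<times> real \<Rightarrow> real" where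
  "pert_bound i = (if fst i then (if 1 \<le> snd i then snd i powr (-\<delta>) / 4 else 0) else (if 0 < snd i \<and> snd i \<le> 1 then 1/4 else 0))"

text \<open>\<open>pert_bound\<close> is zero outside the two domains, so a perturbation vanishes
  there and the value 0 that \<open>pert_map\<close> takes off its domains is consistent.\<close>

definition perts :: "(bool \<times> real \<Rightarrow> real) set" where
  "perts = {u. head_ok (\<lambda>x. u (False, x)) \<and> tail_ok (\<lambda>x. u (True, x)) \<and> (\<forall>i. \<bar>u i\<bar> \<le> pert_bound i)}"

definition pert_map :: "real \<Rightarrow> (bool \<times> real \<Rightarrow> real) \<Rightarrow> bool \<times> real \<Rightarrow> real" where
  "pert_map \<rho> u i = (if fst i then (if 1 \<le> snd i then tail_map \<rho> (\<lambda>x. u (False, x)) (\<lambda>x. u (True, x)) (snd i) else 0)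
     else (if 0 < snd i \<and> snd i \<le> 1 then head_map \<rho> (\<lambda>x. u (False, x)) (\<lambda>x. u (True, x)) (snd i) else 0))"

lemma perts_intro:
  assumes c: "continuous_on {0<..1} (\<lambda>x. u (False, x))" "continuous_on {1..} (\<lambda>x. u (True, x))" and bd: "\<And>i. \<bar>u i\<bar> \<le> pert_bound i"
  shows "u \<in> perts"
proof -
  have "\<bar>u (False, x)\<bar> \<le> 1/4" if "x \<in> {0<..1}" for x using bd[of "(False, x)"] that by (simp add: pert_bound_def)
  moreover have "\<bar>u (True, x)\<bar> \<le> x powr (-\<delta>) / 4" if "1 \<le> x" for x using bd[of "(True, x)"] that by (simp add: pert_bound_def)
  ultimately show ?thesis using c bd unfolding perts_def head_ok_def tail_ok_def by blast
qed

lemma pert_bound_le: "pert_bound i \<le> 1/4" and pert_bound_nonneg: "0 \<le> pert_bound i"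
proof -
  have "x powr (-\<delta>) \<le> 1" if "1 \<le> x" for x using powr_mono[of "-\<delta>" 0 x] that \<delta>_pos by simp
  then show "pert_bound i \<le> 1/4" by (auto simp: pert_bound_def)
qed (auto simp: pert_bound_def)

lemma head_map_continuous:
  assumes "small \<rho>" "head_ok v" "tail_ok z"
  shows "continuous_on {0<..1} (head_map \<rho> v z)"
proof -
  note P = profile_Wbounded[OF assms]
  have "continuous_on {0<..1} (\<lambda>\<xi>. coag_op (profile \<rho> v z) (profile \<rho> v z) \<xi> / (b * (head_coeff \<rho> z * head_decay v \<xi>)) - 1)"
  proof (intro continuous_intros head_decay_continuous assms)
    show "continuous_on {0<..1} (coag_op (profile \<rho> v z) (profile \<rho> v z))"
      by (rule continuous_on_subset[OF coag_op_continuous[OF smallD(1)[OF assms(1)] P P]]) simp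
    show "\<forall>x\<in>{0<..1}. b * (head_coeff \<rho> z * head_decay v x) \<noteq> 0" using b_pos head_coeff_bounds(3)[OF assms(1,3)] head_decay_bounds(3)[OF assms(2)] by force
  qed
  then show ?thesis by (rule continuous_on_eq) (auto simp: head_map_def lower_profile_small[OF assms(2)])
qed

lemma tail_map_continuous:
  assumes "small \<rho>" "head_ok v" "tail_ok z"
  shows "continuous_on {1..} (tail_map \<rho> v z)"
proof -
  note P = profile_Wbounded[OF assms]
  have "continuous_on {1..} (\<lambda>\<xi>. coag_op (profile \<rho> v z) (profile \<rho> v z) \<xi> / (\<rho> * (b * tail_decay \<rho> z \<xi>)) - 1)"
  proof (intro continuous_intros tail_decay_continuous assms)
    show "continuous_on {1..} (coag_op (profile \<rho> v z) (profile \<rho> v z))"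
      by (rule continuous_on_subset[OF coag_op_continuous[OF smallD(1)[OF assms(1)] P P]]) simp
    show "\<forall>x\<in>{1..}. \<rho> * (b * tail_decay \<rho> z x) \<noteq> 0" using b_pos smallD(1)[OF assms(1)] tail_decay_bounds(3)[OF assms(1,3)] by force
  qed
  then show ?thesis by (rule continuous_on_eq) (auto simp: tail_map_def upper_profile[OF assms])
qed

text \<open>For the tail, the fixed 1/8 and at most 1/8 from the remainder add up to 1/4. This is
  exactly the invariance bound and, being below 1/2, also gives contraction. The head has no fixed
  share and only requires \<rho> to be small.\<close>

lemma fixed_point_exists:
  assumes \<rho>: "small \<rho>" and D: "head_const * \<rho> \<le> 1/4" "tail_const * \<rho> \<le> 1/8"
  shows "\<exists>v z. head_ok v \<and> tail_ok z \<and> (\<forall>\<xi>. 0 < \<xi> \<longrightarrow> \<xi> \<le> 1 \<longrightarrow> head_map \<rho> v z \<xi> = v \<xi>) \<and> (\<forall>\<xi>\<ge>1. tail_map \<rho> v z \<xi> = z \<xi>)"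
proof -
  have "\<exists>u\<in>perts. pert_map \<rho> u = u"
  proof (rule weighted_contraction)
    show "(\<lambda>i. 0) \<in> perts" by (auto simp: perts_def head_ok_def tail_ok_def pert_bound_nonneg)
    show "\<bar>u i\<bar> \<le> pert_bound i" if "u \<in> perts" for u i using that unfolding perts_def by blast
    show "pert_map \<rho> u \<in> perts" if u: "u \<in> perts" for u
    proof -
      define v where "v = (\<lambda>x. u (False, x))"
      define z where "z = (\<lambda>x. u (True, x))"
      have g: "head_ok v" "tail_ok z" using u by (auto simp: perts_def v_def z_def)
      have 1: "\<bar>head_map \<rho> v z x\<bar> \<le> 1/4" if "0 < x" "x \<le> 1" for x using head_map_bound[OF \<rho> g that] D by linarith
      have 2: "\<bar>tail_map \<rho> v z x\<bar> \<le> x powr (-\<delta>) / 4" if "1 \<le> x" for x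
      proof -
        have "(1/8 + tail_const * \<rho>) * x powr (-\<delta>) \<le> (1/4) * x powr (-\<delta>)" using D by (intro mult_right_mono) auto
        then show ?thesis using tail_map_bound[OF \<rho> g that] by simp
      qed
      have e: "continuous_on {0<..1} (\<lambda>x. pert_map \<rho> u (False, x))" "continuous_on {1..} (\<lambda>x. pert_map \<rho> u (True, x))"
        by (rule continuous_on_eq[OF head_map_continuous[OF \<rho> g]] continuous_on_eq[OF tail_map_continuous[OF \<rho> g]], simp add: pert_map_def v_def z_def)+
      have "\<bar>pert_map \<rho> u i\<bar> \<le> pert_bound i" for i
      proof (cases "fst i")
        case True
        then show ?thesis using 2[of "snd i"] by (cases "1 \<le> snd i") (simp_all add: pert_map_def pert_bound_def v_def z_def)
      next
        case False
        then show ?thesis using 1[of "snd i"] by (cases "0 < snd i \<and> snd i \<le> 1") (auto simp: pert_map_def pert_bound_def v_def z_def)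
      qed
      then show ?thesis by (intro perts_intro e)
    qed
    show "\<bar>pert_map \<rho> u i - pert_map \<rho> u' i\<bar> \<le> d / 2 * pert_bound i"
      if u: "u \<in> perts" and u': "u' \<in> perts" and d: "0 \<le> d" and c: "\<And>i. \<bar>u i - u' i\<bar> \<le> d * pert_bound i" for u u' d i
    proof -
      define v where "v = (\<lambda>x. u (False, x))"
      define z where "z = (\<lambda>x. u (True, x))"
      define v' where "v' = (\<lambda>x. u' (False, x))"
      define z' where "z' = (\<lambda>x. u' (True, x))"
      have g: "head_ok v" "tail_ok z" "head_ok v'" "tail_ok z'" using u u' by (auto simp: perts_def v_def z_def v'_def z'_def)
      \<comment> \<open>The weight \<open>pert_bound\<close> already contains the factor 1/4, so a
        weighted distance d is an unweighted distance d / 4.\<close>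
      have vd: "head_dist (d / 4) v v'"
        unfolding head_dist_def
      proof (intro conjI allI impI)
        show "\<bar>v x - v' x\<bar> \<le> d / 4" if "0 < x" "x \<le> 1" for x
          using c[of "(False, x)"] that by (simp add: v_def v'_def pert_bound_def)
      qed (use d in simp)
      have zd: "tail_dist (d / 4) z z'"
        unfolding tail_dist_def
      proof (intro conjI allI impI)
        show "\<bar>z x - z' x\<bar> \<le> d / 4 * x powr (-\<delta>)" if "1 \<le> x" for x
          using c[of "(True, x)"] that by (simp add: z_def z'_def pert_bound_def)
      qed (use d in simp)
      note 1 = head_map_diff[OF \<rho> g vd zd] and 2 = tail_map_diff[OF \<rho> g vd zd]
      obtain s x where i: "i = (s, x)" by (cases i)
      show ?thesis
      proof (cases s)
        case True
        show ?thesis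
        proof (cases "1 \<le> x")
          case x: True
          have "(1/8 + tail_const * \<rho>) * (d / 4 * x powr (-\<delta>)) \<le> (1/2) * (d / 4 * x powr (-\<delta>))" using D d by (intro mult_right_mono) auto
          then have "\<bar>tail_map \<rho> v z x - tail_map \<rho> v' z' x\<bar> \<le> (1/2) * (d / 4 * x powr (-\<delta>))"
            using 2[OF x] unfolding mult.assoc by (rule order_trans[rotated])
          then show ?thesis using True x i by (simp add: pert_map_def pert_bound_def v_def z_def v'_def z'_def)
        qed (use True i in \<open>simp add: pert_map_def pert_bound_def\<close>)
      next
        case False
        show ?thesis
        proof (cases "0 < x \<and> x \<le> 1")
          case x: True
          have "head_const * \<rho> * (d / 4) \<le> (1/2) * (d / 4)" using D d by (intro mult_right_mono) auto
          then have "\<bar>head_map \<rho> v z x - head_map \<rho> v' z' x\<bar> \<le> (1/2) * (d / 4)"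
            using x by (intro order_trans[OF 1]) auto
          then show ?thesis using False x i by (simp add: pert_map_def pert_bound_def v_def z_def v'_def z'_def)
        qed (use False i in \<open>auto simp: pert_map_def pert_bound_def\<close>)
      qed
    qed
    show "w \<in> perts" if f: "\<And>n. f n \<in> perts" and lim: "\<And>n i. \<bar>f n i - w i\<bar> \<le> 4 * (1/2)^n * pert_bound i" for f w
    proof -
      have c: "\<bar>f n i - w i\<bar> \<le> (1/2)^n" for n i
      proof -
        have "4 * (1/2)^n * pert_bound i \<le> 4 * (1/2)^n * (1/4)" by (intro mult_left_mono pert_bound_le) auto
        also have "4 * (1/2)^n * (1/4) = (1/2::real)^n" by simp
        finally show ?thesis using lim[of n i] by linarith
      qed
      have "(\<lambda>n. (1/2::real)^n) \<longlonglongrightarrow> 0" by (rule LIMSEQ_realpow_zero) auto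
      then have "(\<lambda>n. f n i - w i) \<longlonglongrightarrow> 0" for i
        by (rule Lim_null_comparison[rotated]) (use c in auto)
      then have "(\<lambda>n. f n i) \<longlonglongrightarrow> w i" for i by (rule LIM_zero_cancel)
      then have "(\<lambda>n. \<bar>f n i\<bar>) \<longlonglongrightarrow> \<bar>w i\<bar>" for i by (rule tendsto_rabs)
      then have bd: "\<bar>w i\<bar> \<le> pert_bound i" for i
        by (rule LIMSEQ_le_const2) (use f in \<open>unfold perts_def, blast\<close>)
      have "continuous_on {0<..1} (\<lambda>x. w (False, x))"
        by (rule continuous_on_dominated_limit[of _ "\<lambda>n x. f n (False, x)"]) (use f c in \<open>auto simp: perts_def head_ok_def\<close>)
      moreover have "continuous_on {1..} (\<lambda>x. w (True, x))"
        by (rule continuous_on_dominated_limit[of _ "\<lambda>n x. f n (True, x)"]) (use f c in \<open>auto simp: perts_def tail_ok_def\<close>)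
      ultimately show ?thesis using bd by (intro perts_intro)
    qed
  qed
  then obtain u where u: "u \<in> perts" "pert_map \<rho> u = u" by auto
  have "head_map \<rho> (\<lambda>x. u (False, x)) (\<lambda>x. u (True, x)) \<xi> = u (False, \<xi>)" if "0 < \<xi>" "\<xi> \<le> 1" for \<xi>
    using fun_cong[OF u(2), of "(False, \<xi>)"] that by (simp add: pert_map_def)
  moreover have "tail_map \<rho> (\<lambda>x. u (False, x)) (\<lambda>x. u (True, x)) \<xi> = u (True, \<xi>)" if "1 \<le> \<xi>" for \<xi>
    using fun_cong[OF u(2), of "(True, \<xi>)"] that by (simp add: pert_map_def)
  ultimately show ?thesis using u(1) unfolding perts_def by blast
qed

lemma profile_exists:
  "\<exists>\<rho>0>0. \<forall>\<rho>. 0 < \<rho> \<longrightarrow> \<rho> < \<rho>0 \<longrightarrow> small \<rho> \<and> (\<exists>v z. head_ok v \<and> tail_ok z \<and>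
     (\<forall>\<xi>>0. coag_op (profile \<rho> v z) (profile \<rho> v z) \<xi> = profile \<rho> v z \<xi>))"
proof -
  \<comment> \<open>The first bound gives \<open>small\<close>, the other two the hypotheses of the
    fixed point theorem; adding 1 keeps the denominators positive.\<close>
  define \<rho>0 where "\<rho>0 = min (\<delta> / 5) (min (1 / (4 * (head_const + 1))) (1 / (8 * (tail_const + 1))))"
  have D: "0 \<le> head_const" "0 \<le> tail_const" using const_nonneg by auto
  have "0 < \<rho>0" using \<delta>_pos D by (auto simp: \<rho>0_def)
  moreover have "small \<rho> \<and> (\<exists>v z. head_ok v \<and> tail_ok z \<and> (\<forall>\<xi>>0. coag_op (profile \<rho> v z) (profile \<rho> v z) \<xi> = profile \<rho> v z \<xi>))"
    if r: "0 < \<rho>" "\<rho> < \<rho>0" for \<rho>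
  proof
    show \<rho>: "small \<rho>" using r by (auto simp: \<rho>0_def small_def)
    have "\<rho> \<le> 1 / (4 * (head_const + 1))" "\<rho> \<le> 1 / (8 * (tail_const + 1))" using r by (auto simp: \<rho>0_def)
    then have "(head_const + 1) * \<rho> \<le> 1/4" "(tail_const + 1) * \<rho> \<le> 1/8" using D by (auto simp: field_simps)
    then have "head_const * \<rho> \<le> 1/4" "tail_const * \<rho> \<le> 1/8" using r by (auto simp: distrib_right)
    then obtain v z where vz: "head_ok v" "tail_ok z"
      and 1: "\<And>\<xi>. 0 < \<xi> \<Longrightarrow> \<xi> \<le> 1 \<Longrightarrow> head_map \<rho> v z \<xi> = v \<xi>" and 2: "\<And>\<xi>. 1 \<le> \<xi> \<Longrightarrow> tail_map \<rho> v z \<xi> = z \<xi>"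
      using fixed_point_exists[OF \<rho>] by blast
    have "coag_op (profile \<rho> v z) (profile \<rho> v z) \<xi> = profile \<rho> v z \<xi>" if "0 < \<xi>" for \<xi>
    proof (cases "\<xi> \<le> 1")
      case True
      have p: "0 < b * (head_coeff \<rho> z * head_decay v \<xi>)" using b_pos head_coeff_bounds(3)[OF \<rho> vz(2)] head_decay_bounds(3)[OF vz(1) that True] by simp
      have "coag_op (profile \<rho> v z) (profile \<rho> v z) \<xi> / (b * (head_coeff \<rho> z * head_decay v \<xi>)) = 1 + v \<xi>"
        using 1[OF that True] by (simp add: head_map_def lower_profile_small[OF vz(1) that True])
      then have "coag_op (profile \<rho> v z) (profile \<rho> v z) \<xi> = (1 + v \<xi>) * (b * (head_coeff \<rho> z * head_decay v \<xi>))"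
        using p by (metis nonzero_divide_eq_eq less_irrefl)
      then show ?thesis using that True by (simp add: profile_head mult_ac)
    next
      case False
      then have x: "1 \<le> \<xi>" by simp
      have p: "0 < \<rho> * (b * tail_decay \<rho> z \<xi>)" using b_pos r tail_decay_bounds(3)[OF \<rho> vz(2) x] by simp
      have "coag_op (profile \<rho> v z) (profile \<rho> v z) \<xi> / (\<rho> * (b * tail_decay \<rho> z \<xi>)) = 1 + z \<xi>"
        using 2[OF x] by (simp add: tail_map_def upper_profile[OF \<rho> vz x])
      then have "coag_op (profile \<rho> v z) (profile \<rho> v z) \<xi> = (1 + z \<xi>) * (\<rho> * (b * tail_decay \<rho> z \<xi>))"
        using p by (metis nonzero_divide_eq_eq less_irrefl)
      then show ?thesis using False by (simp add: profile_tail tail_value_def mult_ac)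
    qed
    then show "\<exists>v z. head_ok v \<and> tail_ok z \<and> (\<forall>\<xi>>0. coag_op (profile \<rho> v z) (profile \<rho> v z) \<xi> = profile \<rho> v z \<xi>)"
      using vz by blast
  qed
  ultimately show ?thesis by blast
qed

section \<open>Convergence of the tail exponent and properties of the solution\<close>

lemma tail_exponent_increment:
  assumes "tail_ok z" "1 < x" "x \<le> y"
  shows "\<bar>tail_exponent z y - tail_exponent z x\<bar> \<le> x powr (-\<delta>) / (4 * \<delta>)"
proof -
  define p where "p s = - (s powr (-\<delta>) / (4 * \<delta>))" for s :: real
  have p: "DERIV p s :> s powr (-1-\<delta>) / 4" if "1 < s" for s
  proof -
    have "-\<delta>-1 = -1-\<delta>" by simp
    note [simp] = arg_cong[OF this, of "\<lambda>t. s powr t"]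
    show ?thesis unfolding p_def using that \<delta>_pos by (auto intro!: derivative_eq_intros)
  qed
  have b: "\<bar>z s * s powr (-1)\<bar> \<le> s powr (-1-\<delta>) / 4" if "1 < s" for s
  proof -
    have "\<bar>z s\<bar> * s powr (-1) \<le> (s powr (-\<delta>) / 4) * s powr (-1)" using that tail_okD(1)[OF assms(1), of s] by (intro mult_right_mono) auto
    also have "\<dots> = (s powr (-\<delta>) * s powr (-1)) / 4" by simp
    also have "s powr (-\<delta>) * s powr (-1) = s powr (-1-\<delta>)" by (rule powr_mult_powr) simp
    finally show ?thesis by (simp add: abs_mult)
  qed
  \<comment> \<open>The function p is an antiderivative of the bound s^(-1-\<delta>) / 4, so both p
    + tail_exponent and p - tail_exponent are nondecreasing.\<close>
  have "p x + tail_exponent z x \<le> p y + tail_exponent z y"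
  proof (rule DERIV_nonneg_imp_nondecreasing[OF assms(3)])
    fix s assume "x \<le> s" "s \<le> y"
    then have s: "1 < s" using assms by simp
    show "\<exists>D. DERIV (\<lambda>s. p s + tail_exponent z s) s :> D \<and> 0 \<le> D"
      using DERIV_add[OF p[OF s] tail_exponent_deriv[OF assms(1) s]] b[OF s] by (auto simp: abs_le_iff)
  qed
  moreover have "p x - tail_exponent z x \<le> p y - tail_exponent z y"
  proof (rule DERIV_nonneg_imp_nondecreasing[OF assms(3)])
    fix s assume "x \<le> s" "s \<le> y"
    then have s: "1 < s" using assms by simp
    show "\<exists>D. DERIV (\<lambda>s. p s - tail_exponent z s) s :> D \<and> 0 \<le> D"
      using DERIV_diff[OF p[OF s] tail_exponent_deriv[OF assms(1) s]] b[OF s] by (auto simp: abs_le_iff)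
  qed
  moreover have "p y - p x \<le> x powr (-\<delta>) / (4 * \<delta>)" using \<delta>_pos by (simp add: p_def)
  ultimately show ?thesis by (simp add: abs_le_iff)
qed

lemma tail_exponent_limit:
  assumes "tail_ok z"
  shows "\<exists>L. (tail_exponent z \<longlongrightarrow> L) at_top \<and> \<bar>L\<bar> \<le> 1 / (4 * \<delta>)"
proof -
  have lim0: "((\<lambda>x. x powr (-\<delta>) / (4 * \<delta>)) \<longlongrightarrow> 0) at_top"
  proof -
    have "((\<lambda>x. x powr (-\<delta>)) \<longlongrightarrow> 0) at_top"
      using \<delta>_pos tendsto_neg_powr[of "-\<delta>" "\<lambda>x. x" at_top] by (simp add: filterlim_ident)
    from tendsto_mult_left[OF this, of "1/(4*\<delta>)"] show ?thesis by simp
  qed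
  \<comment> \<open>The limit is found along the integers. The increment bound, with its right
    endpoint sent to infinity, then gives convergence along all real arguments.\<close>
  have "Cauchy (\<lambda>n. tail_exponent z (real n))"
  proof (rule metric_CauchyI)
    fix e :: real assume "0 < e"
    have "((\<lambda>n. real n powr (-\<delta>) / (4 * \<delta>)) \<longlonglongrightarrow> 0)"
      using filterlim_compose[OF lim0 filterlim_real_sequentially] .
    then have "\<forall>\<^sub>F n in sequentially. real n powr (-\<delta>) / (4 * \<delta>) < e / 2" using \<open>0 < e\<close> by (intro order_tendstoD(2)) auto
    then obtain N where N: "\<And>n. N \<le> n \<Longrightarrow> real n powr (-\<delta>) / (4 * \<delta>) < e / 2" by (auto simp: eventually_sequentially)
    define N' where "N' = max N 2"
    have *: "\<bar>tail_exponent z (real n) - tail_exponent z (real N')\<bar> < e / 2" if "N' \<le> n" for n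
    proof -
      have "1 < real N'" "N \<le> N'" by (auto simp: N'_def)
      then show ?thesis using tail_exponent_increment[OF assms, of "real N'" "real n"] N[of N'] that by simp
    qed
    have "dist (tail_exponent z (real m)) (tail_exponent z (real n)) < e" if "N' \<le> m" "N' \<le> n" for m n
      using *[OF that(1)] *[OF that(2)] unfolding dist_real_def by linarith
    then show "\<exists>M. \<forall>m\<ge>M. \<forall>n\<ge>M. dist (tail_exponent z (real m)) (tail_exponent z (real n)) < e" by blast
  qed
  then obtain L where L: "(\<lambda>n. tail_exponent z (real n)) \<longlonglongrightarrow> L" using Cauchy_convergent_iff convergent_def by blast
  have "(tail_exponent z \<longlongrightarrow> L) at_top"
  proof (rule LIM_zero_cancel, rule Lim_null_comparison[OF _ lim0])
    show "\<forall>\<^sub>F x in at_top. norm (tail_exponent z x - L) \<le> x powr (-\<delta>) / (4 * \<delta>)"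
      using eventually_gt_at_top[of 1]
    proof eventually_elim
      case (elim x)
      have "(\<lambda>n. \<bar>tail_exponent z x - tail_exponent z (real n)\<bar>) \<longlonglongrightarrow> \<bar>tail_exponent z x - L\<bar>" by (intro tendsto_intros L)
      then show ?case unfolding real_norm_def
      proof (rule LIMSEQ_le_const2)
        show "\<exists>N. \<forall>n\<ge>N. \<bar>tail_exponent z x - tail_exponent z (real n)\<bar> \<le> x powr (-\<delta>) / (4 * \<delta>)"
          using tail_exponent_increment[OF assms elim] unfolding abs_minus_commute[of "tail_exponent z x"]
          by (intro exI[of _ "nat \<lceil>x\<rceil>"]) (auto simp: nat_le_iff ceiling_le_iff)
      qed
    qed
  qed
  moreover have "\<bar>L\<bar> \<le> 1 / (4 * \<delta>)"
  proof (rule LIMSEQ_le_const2[OF tendsto_rabs[OF L]])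
    show "\<exists>N. \<forall>n\<ge>N. \<bar>tail_exponent z (real n)\<bar> \<le> 1 / (4 * \<delta>)"
      using tail_exponent_bound[OF assms] by (intro exI[of _ 1]) auto
  qed
  ultimately show ?thesis by blast
qed

text \<open>The interface to the rescaling: the ansatz is forgotten, and integrals become
  nonnegative ones as in the claim. The constants 3/16 and 5/4 combine the bounds 1/4 and 1 for
  head_coeff / \<rho> with 3/4 and 5/4 for 1 + v.\<close>

lemma profile_solution:
  assumes \<rho>: "small \<rho>" and v: "head_ok v" and z: "tail_ok z"
    and fp: "\<And>\<xi>. 0 < \<xi> \<Longrightarrow> coag_op (profile \<rho> v z) (profile \<rho> v z) \<xi> = profile \<rho> v z \<xi>"
  shows "\<exists>f \<mu> L. f \<in> borel_measurable borel \<and> (\<forall>x\<le>0. f x = 0) \<and> (\<forall>x>0. 0 < f x) \<and> continuous_on {0<..} f \<and>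
    (\<forall>X>0. ennreal (f X) = (\<integral>\<^sup>+x. \<integral>\<^sup>+y. ennreal (if x < X \<and> X < x + y then k x y * f x * f y else 0) \<partial>lborel \<partial>lborel)) \<and>
    (\<integral>\<^sup>+x. ennreal (x powr (-1) * f x) \<partial>lborel) = ennreal \<mu> \<and> b \<le> \<mu> \<and> \<mu> \<le> b + F_const * \<rho> \<and>
    (\<integral>\<^sup>+x. ennreal (x powr (-1-a) * f x) \<partial>lborel) = ennreal (\<rho> / (1 + \<rho>)) \<and>
    (\<forall>x. 0 < x \<longrightarrow> x \<le> 1 \<longrightarrow> 3/16 * b * \<rho> * exp (- (5/4) * b * (prim x - prim 1)) \<le> f x \<and> f x \<le> 5/4 * b * \<rho> * exp (- (3/4) * b * (prim x - prim 1))) \<and>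
    ((\<lambda>x. f x * x powr \<rho>) \<longlongrightarrow> b * \<rho> * exp (- \<rho> * L)) at_top \<and> \<bar>L\<bar> \<le> 1 / (4 * \<delta>)"
proof -
  define f where "f = profile \<rho> v z"
  note Wf = profile_Wbounded[OF \<rho> v z, folded f_def]
  note \<rho>0 = smallD(1)[OF \<rho>]
  have fm [measurable]: "f \<in> borel_measurable borel" using WboundedD(1)[OF Wf] .
  have f0: "f x = 0" if "x \<le> 0" for x using Wbounded_nonpos[OF Wf that] .
  have fpos: "0 < f x" if "0 < x" for x using profile_pos[OF \<rho> v z that] by (simp add: f_def)
  have fnn: "0 \<le> f x" for x using f0[of x] fpos[of x] by (cases "x \<le> 0") auto
  \<comment> \<open>Continuity across 1 is not built into the profile; it is inherited from the
    operator, whose value f equals.\<close>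
  have cont: "continuous_on {0<..} f"
    by (rule continuous_on_eq[OF continuous_on_subset[OF coag_op_continuous[OF \<rho>0 Wf Wf]]]) (auto simp: fp f_def)
  have eq: "ennreal (f X) = (\<integral>\<^sup>+x. \<integral>\<^sup>+y. ennreal (if x < X \<and> X < x + y then k x y * f x * f y else 0) \<partial>lborel \<partial>lborel)" if "0 < X" for X
  proof -
    have "ennreal (f X) = ennreal (coag_op f f X)" using fp[OF that] by (simp add: f_def)
    also have "\<dots> = (\<integral>\<^sup>+z. ennreal (case z of (x,y) \<Rightarrow> if x < X \<and> X < x + y then k x y * f x * f y else 0) \<partial>(lborel \<Otimes>\<^sub>M lborel))"
      unfolding coag_op_def
      by (rule nn_integral_eq_integral[OF coag_op_integrable[OF \<rho>0 Wf Wf], symmetric]) (auto intro!: AE_I2 simp: k_nonneg fnn)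
    also have "\<dots> = (\<integral>\<^sup>+x. \<integral>\<^sup>+y. ennreal (if x < X \<and> X < x + y then k x y * f x * f y else 0) \<partial>lborel \<partial>lborel)"
      by (subst lborel.nn_integral_fst[symmetric]) auto
    finally show ?thesis .
  qed
  define \<mu> where "\<mu> = (\<integral>x. x powr (-1) * f x \<partial>lborel)"
  have mass: "(\<integral>\<^sup>+x. ennreal (x powr (-1) * f x) \<partial>lborel) = ennreal \<mu>"
    unfolding \<mu>_def by (rule nn_integral_eq_integral[OF upper_integrable[OF \<rho>0 Wf]]) (simp add: fnn)
  \<comment> \<open>The mass is Q(0), which exceeds Q(1) = b by at most the O(\<rho>) contribution
    of (0,1].\<close>
  have "\<mu> = upper f 0" unfolding \<mu>_def upper_def
    by (intro Bochner_Integration.integral_cong) (auto simp: f0 split: split_indicator)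
  then have \<mu>2: "\<mu> \<le> b + F_const * \<rho>" using upper_small[OF \<rho>0 Wf, of 0] upper_profile[OF \<rho> v z, of 1] by (simp add: f_def abs_le_iff)
  have "upper f 1 \<le> \<mu>" unfolding \<mu>_def upper_def using fnn
    by (intro integral_mono upper_integrable[OF \<rho>0 Wf] upper_set_integrable[OF \<rho>0 Wf]) (auto split: split_indicator)
  then have \<mu>1: "b \<le> \<mu>" using upper_profile[OF \<rho> v z, of 1] by (simp add: f_def)
  have moment: "(\<integral>\<^sup>+x. ennreal (x powr (-1-a) * f x) \<partial>lborel) = ennreal (\<rho> / (1 + \<rho>))"
    unfolding profile_moment[OF \<rho> v z, folded f_def, symmetric]
    by (rule nn_integral_eq_integral[OF lower_integrable[OF smallD(3)[OF \<rho>] Wf]]) (simp add: fnn)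
  have small: "3/16 * b * \<rho> * exp (- (5/4) * b * (prim x - prim 1)) \<le> f x \<and> f x \<le> 5/4 * b * \<rho> * exp (- (3/4) * b * (prim x - prim 1))"
    if x: "0 < x" "x \<le> 1" for x
  proof -
    have f: "f x = head_coeff \<rho> z * (b * ((1 + v x) * head_decay v x))" using x by (simp add: f_def profile_head)
    note e = head_decay_bounds[OF v x] and vb = head_okD[OF v x] and A = head_coeff_bounds[OF \<rho> z]
    have "\<rho> / 4 * (b * (3/4 * exp (- (5/4) * b * (prim x - prim 1)))) \<le> f x"
      unfolding f using e vb A b_pos \<rho>0 by (intro mult_mono mult_nonneg_nonneg) auto
    moreover have "f x \<le> \<rho> * (b * (5/4 * exp (- (3/4) * b * (prim x - prim 1))))"
      unfolding f using e vb A b_pos \<rho>0 by (intro mult_mono mult_nonneg_nonneg) auto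
    ultimately show ?thesis by (simp add: mult_ac)
  qed
  obtain L where L: "(tail_exponent z \<longlongrightarrow> L) at_top" "\<bar>L\<bar> \<le> 1 / (4 * \<delta>)" using tail_exponent_limit[OF z] by blast
  have "((\<lambda>x. f x * x powr \<rho>) \<longlongrightarrow> b * \<rho> * exp (- \<rho> * L)) at_top"
  proof (rule Lim_transform_eventually)
    have z0: "(z \<longlongrightarrow> 0) at_top"
    proof (rule Lim_null_comparison)
      show "\<forall>\<^sub>F x in at_top. norm (z x) \<le> x powr (-\<delta>)"
        using eventually_ge_at_top[of 1]
      proof eventually_elim
        case (elim x)
        have "x powr (-\<delta>) / 4 \<le> x powr (-\<delta>)" by simp
        then show ?case using tail_okD(1)[OF z elim] unfolding real_norm_def by linarith
      qed
      show "((\<lambda>x. x powr (-\<delta>)) \<longlongrightarrow> 0) at_top"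
        using \<delta>_pos tendsto_neg_powr[of "-\<delta>" "\<lambda>x. x" at_top] by (simp add: filterlim_ident)
    qed
    have "((\<lambda>x. b * \<rho> * (1 + z x) * exp (- \<rho> * tail_exponent z x)) \<longlongrightarrow> b * \<rho> * (1 + 0) * exp (- \<rho> * L)) at_top"
      by (intro tendsto_intros z0 L)
    then show "((\<lambda>x. b * \<rho> * (1 + z x) * exp (- \<rho> * tail_exponent z x)) \<longlongrightarrow> b * \<rho> * exp (- \<rho> * L)) at_top" by simp
    show "\<forall>\<^sub>F x in at_top. b * \<rho> * (1 + z x) * exp (- \<rho> * tail_exponent z x) = f x * x powr \<rho>"
      using eventually_gt_at_top[of 1]
    proof eventually_elim
      case (elim x)
      have "f x * x powr \<rho> = b * \<rho> * (1 + z x) * exp (- \<rho> * tail_exponent z x) * (x powr (-\<rho>) * x powr \<rho>)"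
        using elim by (simp add: f_def profile_tail tail_value_def tail_decay_def)
      also have "x powr (-\<rho>) * x powr \<rho> = 1" using elim by (simp flip: powr_add)
      finally show ?case by simp
    qed
  qed
  then show ?thesis using fm f0 fpos cont eq mass \<mu>1 \<mu>2 moment small L by blast
qed

section \<open>Rescaling to unit mass\<close>

text \<open>The scaling factor l satisfies l^(-a) = 1 / \<mu>, so the exponent b * prim becomes (b /
  \<mu>) * \<xi>^(-a) / a. The contribution of prim 1 is the constant b / a = 1/40, which exp 1
  absorbs. The prefactors arise from 3/16 * 2/3 = 1/8 and 5/4 \<le> 2.\<close>

lemma scaled_small_bounds:
  assumes \<rho>: "0 < \<rho>" and \<mu>: "b \<le> \<mu>" "\<mu> \<le> 3/2 * b" and \<xi>: "0 < \<xi>" "\<mu> powr (1/a) * \<xi> \<le> 1"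
    and f: "\<And>x. 0 < x \<Longrightarrow> x \<le> 1 \<Longrightarrow> 3/16 * b * \<rho> * exp (- (5/4) * b * (prim x - prim 1)) \<le> f x \<and> f x \<le> 5/4 * b * \<rho> * exp (- (3/4) * b * (prim x - prim 1))"
  shows "1/8 * \<rho> / \<xi>\<^sup>2 * exp (- (2 / a) * \<xi> powr (- a)) \<le> f (\<mu> powr (1/a) * \<xi>) / (\<mu> * \<xi>\<^sup>2)"
    and "f (\<mu> powr (1/a) * \<xi>) / (\<mu> * \<xi>\<^sup>2) \<le> (2 * exp 1) * \<rho> / \<xi>\<^sup>2 * exp (- (1 / (2 * a)) * \<xi> powr (- a))"
proof -
  define l where "l = \<mu> powr (1/a)"
  define P where "P = \<xi> powr (-a) / a"
  have \<mu>0: "0 < \<mu>" using \<mu> b_pos by simp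
  have l: "0 < l" using \<mu>0 by (simp add: l_def)
  have P: "0 \<le> P" using a_pos by (simp add: P_def)
  have "l powr (-a) = 1 / \<mu>" using a_pos \<mu>0 by (simp add: l_def powr_powr powr_neg_one)
  then have prim: "prim (l * \<xi>) - prim 1 = P / \<mu> - 1 / a" using l \<xi> by (simp add: prim_def P_def powr_mult)
  \<comment> \<open>The lower bound 2/3 is where \<mu> \<le> 3/2 * b enters: 3/4 * 2/3 = 1/2 is just
    the rate required from above, while 5/4 stays below the rate 2 allowed from below.\<close>
  have r: "b / \<mu> \<le> 1" "2/3 \<le> b / \<mu>" using \<mu> \<mu>0 by (auto simp: field_simps)
  have e: "b * (P / \<mu> - 1 / a) = (b / \<mu>) * P - 1 / 40" using a_pos by (simp add: b_def field_simps)
  have m1: "(b / \<mu>) * P \<le> 1 * P" and m2: "2/3 * P \<le> (b / \<mu>) * P" using mult_right_mono[OF r(1) P] mult_right_mono[OF r(2) P] by auto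
  note F = f[of "l * \<xi>", unfolded prim]
  have x: "0 < l * \<xi>" "l * \<xi> \<le> 1" using l \<xi> by (auto simp: l_def)
  have d: "0 < \<mu> * \<xi>\<^sup>2" using \<mu>0 \<xi> by simp
  have "3/16 * b * \<rho> * exp (- 2 * P) \<le> 3/16 * b * \<rho> * exp (- (5/4) * b * (P / \<mu> - 1 / a))"
    using e m1 P b_pos \<rho> by (intro mult_left_mono) auto
  also have "\<dots> \<le> f (l * \<xi>)" using F x by blast
  finally have h1: "3/16 * b * \<rho> * exp (- 2 * P) / (\<mu> * \<xi>\<^sup>2) \<le> f (l * \<xi>) / (\<mu> * \<xi>\<^sup>2)" using d by (intro divide_right_mono) auto
  have h2: "1/8 * \<rho> / \<xi>\<^sup>2 * exp (- 2 * P) \<le> 3/16 * b * \<rho> * exp (- 2 * P) / (\<mu> * \<xi>\<^sup>2)"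
  proof -
    have "(3/16 * (\<rho> / \<xi>\<^sup>2 * exp (- 2 * P))) * (2/3) \<le> (3/16 * (\<rho> / \<xi>\<^sup>2 * exp (- 2 * P))) * (b / \<mu>)"
      using r \<rho> by (intro mult_left_mono) auto
    then show ?thesis by (simp add: mult_ac)
  qed
  have h3: "- (2 / a) * \<xi> powr (- a) = - 2 * P" by (simp add: P_def)
  show "1/8 * \<rho> / \<xi>\<^sup>2 * exp (- (2 / a) * \<xi> powr (- a)) \<le> f (\<mu> powr (1/a) * \<xi>) / (\<mu> * \<xi>\<^sup>2)"
    unfolding h3 l_def[symmetric] by (rule order_trans[OF h2 h1])
  have "f (l * \<xi>) \<le> 5/4 * b * \<rho> * exp (- (3/4) * b * (P / \<mu> - 1 / a))" using F x by blast
  also have "\<dots> \<le> 5/4 * b * \<rho> * exp (1 + - (P / 2))"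
  proof -
    have "- (3/4) * b * (P / \<mu> - 1 / a) = - (3/4) * ((b / \<mu>) * P - 1/40)" by (simp only: mult.assoc e)
    also have "\<dots> \<le> 1 + - (P / 2)"
    proof -
      have "- (3/4) * (X - 1/40) \<le> 1 + - (P / 2)" if "2/3 * P \<le> X" for X using that by (simp add: field_simps)
      then show ?thesis using m2 by blast
    qed
    finally show ?thesis using b_pos \<rho> by (intro mult_left_mono) auto
  qed
  also have "\<dots> = 5/4 * b * \<rho> * (exp 1 * exp (- (P/2)))" by (simp only: exp_add)
  finally have h1: "f (l * \<xi>) / (\<mu> * \<xi>\<^sup>2) \<le> 5/4 * b * \<rho> * (exp 1 * exp (- (P/2))) / (\<mu> * \<xi>\<^sup>2)" using d by (intro divide_right_mono) auto
  have h2: "5/4 * b * \<rho> * (exp 1 * exp (- (P/2))) / (\<mu> * \<xi>\<^sup>2) \<le> (2 * exp 1) * \<rho> / \<xi>\<^sup>2 * exp (- (P/2))"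
  proof -
    have "(5/4 * (\<rho> / \<xi>\<^sup>2 * (exp 1 * exp (- (P/2))))) * (b / \<mu>) \<le> (5/4 * (\<rho> / \<xi>\<^sup>2 * (exp 1 * exp (- (P/2))))) * 1"
      using r \<rho> by (intro mult_left_mono) auto
    also have "\<dots> \<le> 2 * (\<rho> / \<xi>\<^sup>2 * (exp 1 * exp (- (P/2))))"
      unfolding mult_1_right using \<rho> by (intro mult_right_mono) auto
    finally show ?thesis by (simp add: mult_ac)
  qed
  have h3: "- (1 / (2 * a)) * \<xi> powr (- a) = - (P / 2)" by (simp add: P_def)
  show "f (\<mu> powr (1/a) * \<xi>) / (\<mu> * \<xi>\<^sup>2) \<le> (2 * exp 1) * \<rho> / \<xi>\<^sup>2 * exp (- (1 / (2 * a)) * \<xi> powr (- a))"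
    unfolding h3 l_def[symmetric] by (rule order_trans[OF h1 h2])
qed

lemma scaled_tail:
  assumes \<mu>: "0 < \<mu>" and f: "((\<lambda>x. f x * x powr \<rho>) \<longlongrightarrow> b * \<rho> * exp (- \<rho> * L)) at_top"
  shows "(\<lambda>\<xi>. f (\<mu> powr (1/a) * \<xi>) / (\<mu> * \<xi>\<^sup>2) - (b / \<mu> * \<mu> powr (-\<rho> / a) * exp (- \<rho> * L)) * \<rho> / \<xi> powr (2 + \<rho>)) \<in> o[at_top](\<lambda>\<xi>. 1 / \<xi> powr (2 + \<rho>))"
proof (rule smalloI_tendsto)
  define l where "l = \<mu> powr (1/a)"
  define \<kappa> where "\<kappa> = b / \<mu> * \<mu> powr (-\<rho> / a) * exp (- \<rho> * L)"
  have l: "0 < l" using \<mu> by (simp add: l_def)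
  have lr: "l powr (-\<rho>) = \<mu> powr (-\<rho> / a)" by (simp add: l_def powr_powr)
  have "filterlim (\<lambda>\<xi>. l * \<xi>) at_top at_top" using l by (rule filterlim_tendsto_pos_mult_at_top[OF tendsto_const _ filterlim_ident])
  from filterlim_compose[OF f this] have "((\<lambda>\<xi>. f (l * \<xi>) * (l * \<xi>) powr \<rho>) \<longlongrightarrow> b * \<rho> * exp (- \<rho> * L)) at_top" .
  from tendsto_mult_left[OF this, of "l powr (-\<rho>) / \<mu>"]
  have "((\<lambda>\<xi>. l powr (-\<rho>) / \<mu> * (f (l * \<xi>) * (l * \<xi>) powr \<rho>) - \<kappa> * \<rho>) \<longlongrightarrow> l powr (-\<rho>) / \<mu> * (b * \<rho> * exp (- \<rho> * L)) - \<kappa> * \<rho>) at_top"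
    by (rule tendsto_diff[OF _ tendsto_const])
  then have lim: "((\<lambda>\<xi>. l powr (-\<rho>) / \<mu> * (f (l * \<xi>) * (l * \<xi>) powr \<rho>) - \<kappa> * \<rho>) \<longlongrightarrow> 0) at_top"
    by (simp add: \<kappa>_def lr mult_ac)
  have head_decay: "\<forall>\<^sub>F \<xi> in at_top. l powr (-\<rho>) / \<mu> * (f (l * \<xi>) * (l * \<xi>) powr \<rho>) - \<kappa> * \<rho> =
    (f (l * \<xi>) / (\<mu> * \<xi>\<^sup>2) - \<kappa> * \<rho> / \<xi> powr (2 + \<rho>)) / (1 / \<xi> powr (2 + \<rho>))"
    using eventually_gt_at_top[of 0]
  proof eventually_elim
    case (elim \<xi>)
    have "l powr (-\<rho>) * (l * \<xi>) powr \<rho> = \<xi> powr \<rho>" using l elim by (simp add: powr_mult powr_minus)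
    then have "l powr (-\<rho>) / \<mu> * (f (l * \<xi>) * (l * \<xi>) powr \<rho>) = f (l * \<xi>) / \<mu> * \<xi> powr \<rho>"
      by (metis (no_types, opaque_lifting) mult.commute mult.left_commute times_divide_eq_left)
    moreover have "\<xi> powr (2 + \<rho>) = \<xi>\<^sup>2 * \<xi> powr \<rho>" using elim by (simp add: powr_add powr_numeral)
    ultimately show ?case using elim \<mu> by (simp add: field_simps)
  qed
  show "((\<lambda>\<xi>. (f (\<mu> powr (1/a) * \<xi>) / (\<mu> * \<xi>\<^sup>2) - (b / \<mu> * \<mu> powr (-\<rho> / a) * exp (- \<rho> * L)) * \<rho> / \<xi> powr (2 + \<rho>)) / (1 / \<xi> powr (2 + \<rho>))) \<longlongrightarrow> 0) at_top"
    using Lim_transform_eventually[OF lim head_decay] by (simp only: l_def \<kappa>_def)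
  show "\<forall>\<^sub>F \<xi> in at_top. 1 / \<xi> powr (2 + \<rho>) \<noteq> 0" using eventually_gt_at_top[of 0] by eventually_elim simp
qed

text \<open>The sum of the rates, in \<rho>, of the logarithms of the three factors of the tail
  constant.\<close>

definition k_const :: real where "k_const = F_const / b + (\<bar>ln b\<bar> + \<bar>ln (2 * b)\<bar>) / a + 1 / (4 * \<delta>)"

text \<open>Each of b / \<mu>, \<mu>^(-\<rho>/a) and exp(-\<rho> L) has a logarithm of order \<rho>:
  the first since \<mu> = b + O(\<rho>), the others since ln \<mu> and L are bounded independently
  of \<rho>.\<close>

lemma tail_constant_bounds:
  assumes \<rho>: "0 < \<rho>" and \<mu>: "b \<le> \<mu>" "\<mu> \<le> b + F_const * \<rho>" "\<mu> \<le> 3/2 * b" and L: "\<bar>L\<bar> \<le> 1 / (4 * \<delta>)"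
  shows "exp (- k_const * \<rho>) \<le> b / \<mu> * \<mu> powr (-\<rho> / a) * exp (- \<rho> * L)"
    and "b / \<mu> * \<mu> powr (-\<rho> / a) * exp (- \<rho> * L) \<le> exp (k_const * \<rho>)"
proof -
  have \<mu>0: "0 < \<mu>" using \<mu> b_pos by simp
  define t where "t = - (F_const / b * \<rho>)"
  define q where "q = (-\<rho> / a) * ln \<mu>"
  define p where "p = - \<rho> * L"
  have CFb: "0 \<le> F_const / b * \<rho>" using F_const_pos b_pos \<rho> by simp
  have 1: "b / \<mu> \<le> exp 0" using \<mu> \<mu>0 by simp
  have 2: "exp t \<le> b / \<mu>"
  proof -
    have "\<mu> / b \<le> 1 + F_const / b * \<rho>" using \<mu> b_pos by (simp add: field_simps)
    also have "\<dots> \<le> exp (F_const / b * \<rho>)" by (rule exp_ge_add_one_self)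
    finally have "1 / exp (F_const / b * \<rho>) \<le> 1 / (\<mu> / b)" using \<mu>0 b_pos by (intro divide_left_mono) auto
    then show ?thesis by (simp add: t_def exp_minus inverse_eq_divide)
  qed
  have q: "\<bar>q\<bar> \<le> (\<bar>ln b\<bar> + \<bar>ln (2 * b)\<bar>) / a * \<rho>"
  proof -
    have "ln b \<le> ln \<mu>" "ln \<mu> \<le> ln (2 * b)" using \<mu> \<mu>0 b_pos by auto
    then have "\<bar>ln \<mu>\<bar> \<le> \<bar>ln b\<bar> + \<bar>ln (2 * b)\<bar>" by linarith
    then have "\<rho> / a * \<bar>ln \<mu>\<bar> \<le> \<rho> / a * (\<bar>ln b\<bar> + \<bar>ln (2 * b)\<bar>)" using \<rho> a_pos by (intro mult_left_mono) auto
    then show ?thesis using \<rho> a_pos by (simp add: q_def abs_mult mult.commute)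
  qed
  have p: "\<bar>p\<bar> \<le> 1 / (4 * \<delta>) * \<rho>"
    using mult_left_mono[OF L, of \<rho>] \<rho> by (simp add: p_def abs_mult)
  have k: "b / \<mu> * \<mu> powr (-\<rho> / a) * exp (- \<rho> * L) = b / \<mu> * exp (q + p)"
    using \<mu>0 by (simp add: powr_def q_def p_def flip: exp_add)
  have k_const: "k_const * \<rho> = F_const / b * \<rho> + (\<bar>ln b\<bar> + \<bar>ln (2 * b)\<bar>) / a * \<rho> + 1 / (4 * \<delta>) * \<rho>"
    by (simp add: k_const_def distrib_right)
  have "exp (- k_const * \<rho>) \<le> exp (t + (q + p))" using p q k_const by (simp add: t_def abs_le_iff)
  also have "\<dots> = exp t * exp (q + p)" by (rule exp_add)
  also have "\<dots> \<le> b / \<mu> * exp (q + p)" using 2 by (intro mult_right_mono) auto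
  finally show "exp (- k_const * \<rho>) \<le> b / \<mu> * \<mu> powr (-\<rho> / a) * exp (- \<rho> * L)" unfolding k .
  have "b / \<mu> * exp (q + p) \<le> exp 0 * exp (q + p)" using 1 by (intro mult_right_mono) auto
  also have "\<dots> = exp (q + p)" by simp
  also have "\<dots> \<le> exp (k_const * \<rho>)" using p q k_const CFb by (simp add: abs_le_iff)
  finally show "b / \<mu> * \<mu> powr (-\<rho> / a) * exp (- \<rho> * L) \<le> exp (k_const * \<rho>)" unfolding k .
qed

end

section \<open>Return to the kernel \<open>K\<close> and to unit mass\<close>

lemma nn_integral_scale:
  fixes g :: "real \<Rightarrow> ennreal"
  assumes "g \<in> borel_measurable borel" "0 < c"
  shows "(\<integral>\<^sup>+x. ennreal c * g (c * x) \<partial>lborel) = (\<integral>\<^sup>+x. g x \<partial>lborel)"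
proof -
  have [measurable]: "g \<in> borel_measurable borel" by (rule assms)
  have "(\<integral>\<^sup>+x. ennreal c * g (c * x) \<partial>lborel) = ennreal c * (\<integral>\<^sup>+x. g (c * x) \<partial>lborel)"
    by (rule nn_integral_cmult) measurable
  also have "\<dots> = (\<integral>\<^sup>+x. g x \<partial>lborel)"
    using nn_integral_real_affine[OF assms(1), of c 0] assms(2) by simp
  finally show ?thesis .
qed

text \<open>Replacing f(x) by f(l * x) leaves the integral of f / x unchanged and multiplies that of
  x^(-1-a) * f by l^a. With l^a = \<mu>, division by \<mu> normalises the mass and restores the
  moment.\<close>

lemma rescaled_solution:
  fixes K :: "real \<Rightarrow> real \<Rightarrow> real" and \<gamma> a \<mu> :: real and f :: "real \<Rightarrow> real"
  assumes a: "a = 1 - \<gamma>" "0 < a" and \<mu>: "0 < \<mu>"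
    and K_hom: "\<And>\<alpha> x y. 0 < \<alpha> \<Longrightarrow> 0 < x \<Longrightarrow> 0 < y \<Longrightarrow> K (\<alpha> * x) (\<alpha> * y) = \<alpha> powr \<gamma> * K x y"
    and k: "\<And>x y. k x y = (if 0 < x \<and> 0 < y then K x y / (x * y\<^sup>2) else 0)"
    and k_meas: "(\<lambda>(x,y). k x y) \<in> borel_measurable (borel \<Otimes>\<^sub>M borel)"
    and f_meas: "f \<in> borel_measurable borel" and f0: "\<And>x. x \<le> 0 \<Longrightarrow> f x = 0" and fpos: "\<And>x. 0 < x \<Longrightarrow> 0 < f x"
    and eq: "\<And>X. 0 < X \<Longrightarrow> ennreal (f X) = (\<integral>\<^sup>+x. \<integral>\<^sup>+y. ennreal (if x < X \<and> X < x + y then k x y * f x * f y else 0) \<partial>lborel \<partial>lborel)"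
    and mass: "(\<integral>\<^sup>+x. ennreal (x powr (-1) * f x) \<partial>lborel) = ennreal \<mu>"
    and moment: "(\<integral>\<^sup>+x. ennreal (x powr (-1-a) * f x) \<partial>lborel) = ennreal M"
    and \<Phi>: "\<And>\<xi>. \<Phi> \<xi> = f (\<mu> powr (1/a) * \<xi>) / (\<mu> * \<xi>\<^sup>2)"
  shows "\<forall>\<xi>>0. ennreal (\<xi>\<^sup>2 * \<Phi> \<xi>) = (\<integral>\<^sup>+\<eta>\<in>{0<..<\<xi>}. (\<integral>\<^sup>+\<zeta>\<in>{\<xi> - \<eta><..}.
              ennreal (K \<eta> \<zeta> * \<eta> * \<Phi> \<eta> * \<Phi> \<zeta>) \<partial>lborel) \<partial>lborel)"
    and "(\<integral>\<^sup>+\<xi>\<in>{0<..}. ennreal (\<xi> * \<Phi> \<xi>) \<partial>lborel) = 1"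
    and "(\<integral>\<^sup>+\<xi>\<in>{0<..}. ennreal (\<xi> powr \<gamma> * \<Phi> \<xi>) \<partial>lborel) = ennreal M"
proof -
  define l where "l = \<mu> powr (1/a)"
  have l: "0 < l" using \<mu> by (simp add: l_def)
  have la: "l powr a = \<mu>" using \<mu> a by (simp add: l_def powr_powr powr_one')
  have [measurable]: "f \<in> borel_measurable borel" by (rule f_meas)
  have [measurable]: "(\<lambda>(x,y). k x y) \<in> borel_measurable (borel \<Otimes>\<^sub>M borel)" by (rule k_meas)
  have \<Phi>': "\<Phi> \<xi> = f (l * \<xi>) / (\<mu> * \<xi>\<^sup>2)" for \<xi> by (simp add: \<Phi> l_def)
  have fnn: "0 \<le> f x" for x using f0[of x] fpos[of x] by (cases "x \<le> 0") auto

  have ennreal_l: "ennreal (l * X) = ennreal l * ennreal X" for X using l by (intro ennreal_mult') simp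
  have ennreal_\<mu>: "ennreal (1 / \<mu> * X) = ennreal (1 / \<mu>) * ennreal X" for X using \<mu> by (intro ennreal_mult') simp

  show "\<forall>\<xi>>0. ennreal (\<xi>\<^sup>2 * \<Phi> \<xi>) = (\<integral>\<^sup>+\<eta>\<in>{0<..<\<xi>}. (\<integral>\<^sup>+\<zeta>\<in>{\<xi> - \<eta><..}.
              ennreal (K \<eta> \<zeta> * \<eta> * \<Phi> \<eta> * \<Phi> \<zeta>) \<partial>lborel) \<partial>lborel)"
  proof (intro allI impI)
    fix \<xi> :: real assume \<xi>: "0 < \<xi>"
    define F where "F x y = ennreal (if x < l * \<xi> \<and> l * \<xi> < x + y then k x y * f x * f y else 0)" for x y
    have [measurable]: "(\<lambda>(x,y). F x y) \<in> borel_measurable (borel \<Otimes>\<^sub>M borel)" unfolding F_def by measurable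
    have Fx [measurable]: "F x \<in> borel_measurable borel" for x unfolding F_def by measurable
    have val: "K \<eta> \<zeta> * \<eta> * \<Phi> \<eta> * \<Phi> \<zeta> = 1 / \<mu> * (l * (l * (k (l * \<eta>) (l * \<zeta>) * f (l * \<eta>) * f (l * \<zeta>))))"
      if "0 < \<eta>" "0 < \<zeta>" for \<eta> \<zeta>
    proof -
      \<comment> \<open>The relation \<gamma> + a = 1 makes homogeneity match the factor 1 / \<mu>;
        the two remaining factors l are the Jacobians of the two substitutions.\<close>
      have "l powr \<gamma> * \<mu> = l powr 1" unfolding la[symmetric] using powr_mult_powr[of \<gamma> a 1 l] a by simp
      then have lg: "l powr \<gamma> = l / \<mu>" using l \<mu> by (simp add: powr_one' field_simps)
      have "k (l * \<eta>) (l * \<zeta>) = l / \<mu> * K \<eta> \<zeta> / (l * \<eta> * (l * \<zeta>)\<^sup>2)"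
        using that l by (simp add: k K_hom lg)
      then show ?thesis using that l \<mu> by (simp add: \<Phi>' power2_eq_square field_simps)
    qed
    have "(\<integral>\<^sup>+\<eta>\<in>{0<..<\<xi>}. (\<integral>\<^sup>+\<zeta>\<in>{\<xi> - \<eta><..}. ennreal (K \<eta> \<zeta> * \<eta> * \<Phi> \<eta> * \<Phi> \<zeta>) \<partial>lborel) \<partial>lborel)
      = (\<integral>\<^sup>+\<eta>. ennreal (1 / \<mu>) * (ennreal l * (\<integral>\<^sup>+\<zeta>. ennreal l * F (l * \<eta>) (l * \<zeta>) \<partial>lborel)) \<partial>lborel)"
    proof (rule nn_integral_cong)
      fix \<eta> :: real
      have "(\<integral>\<^sup>+\<zeta>\<in>{\<xi> - \<eta><..}. ennreal (K \<eta> \<zeta> * \<eta> * \<Phi> \<eta> * \<Phi> \<zeta>) \<partial>lborel) * indicator {0<..<\<xi>} \<eta>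
        = (\<integral>\<^sup>+\<zeta>. ennreal (1 / \<mu>) * (ennreal l * (ennreal l * F (l * \<eta>) (l * \<zeta>))) \<partial>lborel)"
      proof (cases "\<eta> \<in> {0<..<\<xi>}")
        case True
        have "ennreal (K \<eta> \<zeta> * \<eta> * \<Phi> \<eta> * \<Phi> \<zeta>) * indicator {\<xi> - \<eta><..} \<zeta> = ennreal (1 / \<mu>) * (ennreal l * (ennreal l * F (l * \<eta>) (l * \<zeta>)))" for \<zeta>
        proof (cases "\<xi> - \<eta> < \<zeta>")
          case z: True
          have "l * \<eta> < l * \<xi>" using True l by simp
          moreover have "l * \<xi> < l * (\<eta> + \<zeta>)" using z l by (intro mult_strict_left_mono) auto
          ultimately have "F (l * \<eta>) (l * \<zeta>) = ennreal (k (l * \<eta>) (l * \<zeta>) * f (l * \<eta>) * f (l * \<zeta>))"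
            by (simp add: F_def distrib_left)
          moreover have "K \<eta> \<zeta> * \<eta> * \<Phi> \<eta> * \<Phi> \<zeta> = 1 / \<mu> * (l * (l * (k (l * \<eta>) (l * \<zeta>) * f (l * \<eta>) * f (l * \<zeta>))))"
            using True z by (intro val) auto
          ultimately show ?thesis using z by (simp only: ennreal_\<mu> ennreal_l) simp
        next
          case z: False
          have "l * (\<eta> + \<zeta>) \<le> l * \<xi>" using z l by (intro mult_left_mono) auto
          then have "F (l * \<eta>) (l * \<zeta>) = 0" by (simp add: F_def distrib_left)
          then show ?thesis using z by simp
        qed
        then show ?thesis using True by simp
      next
        case False
        have "F (l * \<eta>) (l * \<zeta>) = 0" for \<zeta>
        proof (cases "\<eta> \<le> 0")
          case True
          then have "f (l * \<eta>) = 0" using l by (intro f0) (simp add: mult_nonneg_nonpos)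
          then show ?thesis by (simp add: F_def)
        next
          case 2: False
          then have "l * \<xi> \<le> l * \<eta>" using False l by (intro mult_left_mono) auto
          then show ?thesis by (simp add: F_def)
        qed
        then show ?thesis using False by simp
      qed
      also have "\<dots> = ennreal (1 / \<mu>) * (ennreal l * (\<integral>\<^sup>+\<zeta>. ennreal l * F (l * \<eta>) (l * \<zeta>) \<partial>lborel))"
        by (simp add: nn_integral_cmult)
      finally show "(\<integral>\<^sup>+\<zeta>\<in>{\<xi> - \<eta><..}. ennreal (K \<eta> \<zeta> * \<eta> * \<Phi> \<eta> * \<Phi> \<zeta>) \<partial>lborel) * indicator {0<..<\<xi>} \<eta>
        = ennreal (1 / \<mu>) * (ennreal l * (\<integral>\<^sup>+\<zeta>. ennreal l * F (l * \<eta>) (l * \<zeta>) \<partial>lborel))" .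
    qed
    also have "\<dots> = (\<integral>\<^sup>+\<eta>. ennreal (1 / \<mu>) * (ennreal l * (\<integral>\<^sup>+y. F (l * \<eta>) y \<partial>lborel)) \<partial>lborel)"
      using nn_integral_scale[OF Fx l] by simp
    also have "\<dots> = ennreal (1 / \<mu>) * (\<integral>\<^sup>+\<eta>. ennreal l * (\<integral>\<^sup>+y. F (l * \<eta>) y \<partial>lborel) \<partial>lborel)"
      by (rule nn_integral_cmult) measurable
    also have "(\<integral>\<^sup>+\<eta>. ennreal l * (\<integral>\<^sup>+y. F (l * \<eta>) y \<partial>lborel) \<partial>lborel) = (\<integral>\<^sup>+x. \<integral>\<^sup>+y. F x y \<partial>lborel \<partial>lborel)"
      by (rule nn_integral_scale[of "\<lambda>x. \<integral>\<^sup>+y. F x y \<partial>lborel", OF _ l]) measurable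
    also have "\<dots> = ennreal (f (l * \<xi>))" using eq[of "l * \<xi>"] l \<xi> by (simp add: F_def)
    also have "ennreal (1 / \<mu>) * ennreal (f (l * \<xi>)) = ennreal (\<xi>\<^sup>2 * \<Phi> \<xi>)"
      using \<mu> \<xi> fnn by (simp add: \<Phi>' flip: ennreal_mult)
    finally show "ennreal (\<xi>\<^sup>2 * \<Phi> \<xi>) = (\<integral>\<^sup>+\<eta>\<in>{0<..<\<xi>}. (\<integral>\<^sup>+\<zeta>\<in>{\<xi> - \<eta><..}.
              ennreal (K \<eta> \<zeta> * \<eta> * \<Phi> \<eta> * \<Phi> \<zeta>) \<partial>lborel) \<partial>lborel)" ..
  qed

  show "(\<integral>\<^sup>+\<xi>\<in>{0<..}. ennreal (\<xi> * \<Phi> \<xi>) \<partial>lborel) = 1"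
  proof -
    have "ennreal (\<xi> * \<Phi> \<xi>) * indicator {0<..} \<xi> = ennreal (1/\<mu>) * (ennreal l * ennreal ((l * \<xi>) powr (-1) * f (l * \<xi>)))" for \<xi>
    proof (cases "0 < \<xi>")
      case True
      have "\<xi> * \<Phi> \<xi> = 1 / \<mu> * (l * ((l * \<xi>) powr (-1) * f (l * \<xi>)))"
        using True l \<mu> by (simp add: \<Phi>' powr_neg_one power2_eq_square)
      then show ?thesis using True by (simp only: ennreal_\<mu> ennreal_l) simp
    next
      case False
      then have "f (l * \<xi>) = 0" using l by (intro f0) (simp add: mult_nonneg_nonpos)
      then show ?thesis using False by simp
    qed
    then have "(\<integral>\<^sup>+\<xi>\<in>{0<..}. ennreal (\<xi> * \<Phi> \<xi>) \<partial>lborel)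
       = ennreal (1/\<mu>) * (\<integral>\<^sup>+\<xi>. ennreal l * ennreal ((l * \<xi>) powr (-1) * f (l * \<xi>)) \<partial>lborel)"
      by (simp add: nn_integral_cmult)
    also have "(\<integral>\<^sup>+\<xi>. ennreal l * ennreal ((l * \<xi>) powr (-1) * f (l * \<xi>)) \<partial>lborel) = ennreal \<mu>"
      using nn_integral_scale[of "\<lambda>x. ennreal (x powr (-1) * f x)", OF _ l] mass by simp
    also have "ennreal (1/\<mu>) * ennreal \<mu> = 1" using \<mu> by (simp flip: ennreal_mult)
    finally show ?thesis .
  qed

  show "(\<integral>\<^sup>+\<xi>\<in>{0<..}. ennreal (\<xi> powr \<gamma> * \<Phi> \<xi>) \<partial>lborel) = ennreal M"
  proof -
    have "ennreal (\<xi> powr \<gamma> * \<Phi> \<xi>) * indicator {0<..} \<xi> = ennreal l * ennreal ((l * \<xi>) powr (-1-a) * f (l * \<xi>))" for \<xi>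
    proof (cases "0 < \<xi>")
      case True
      have "l powr (-1-a) * \<mu> = l powr (-1)" unfolding la[symmetric] by (rule powr_mult_powr) simp
      then have l1: "l powr (-1-a) = 1 / (l * \<mu>)" using l \<mu> by (simp add: powr_neg_one field_simps)
      have "\<xi> powr (-1-a) * \<xi>\<^sup>2 = \<xi> powr (-1-a) * \<xi> powr 2" using True by (simp add: powr_numeral)
      also have "\<dots> = \<xi> powr \<gamma>" using a by (intro powr_mult_powr) simp
      finally have x1: "\<xi> powr \<gamma> = \<xi> powr (-1-a) * \<xi>\<^sup>2" ..
      have "\<xi> powr \<gamma> * \<Phi> \<xi> = l * ((l * \<xi>) powr (-1-a) * f (l * \<xi>))"
        using True l \<mu> by (simp add: \<Phi>' powr_mult l1 x1)
      then show ?thesis using True by (simp only: ennreal_l) simp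
    next
      case False
      then have "f (l * \<xi>) = 0" using l by (intro f0) (simp add: mult_nonneg_nonpos)
      then show ?thesis using False by simp
    qed
    then have "(\<integral>\<^sup>+\<xi>\<in>{0<..}. ennreal (\<xi> powr \<gamma> * \<Phi> \<xi>) \<partial>lborel)
       = (\<integral>\<^sup>+\<xi>. ennreal l * ennreal ((l * \<xi>) powr (-1-a) * f (l * \<xi>)) \<partial>lborel)" by simp
    also have "\<dots> = ennreal M"
      using nn_integral_scale[of "\<lambda>x. ennreal (x powr (-1-a) * f x)", OF _ l] moment by simp
    finally show ?thesis .
  qed
qed

text \<open>Homogeneity carries the asymptotics of K(r, 1) at r = x / y to all pairs with x \<le> y,
  and symmetry covers y \<le> x. Lowering \<delta>' to at most a/2 only weakens the hypothesis,
  because r \<le> 1, and secures \<delta> < a.\<close>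

lemma coagulation_kernel_of_homogeneous:
  fixes K :: "real \<Rightarrow> real \<Rightarrow> real" and \<gamma> a :: real
  assumes gamma: "\<gamma> < 1" and a: "a = 1 - \<gamma>"
    and K_nonneg: "\<And>x y. 0 < x \<Longrightarrow> 0 < y \<Longrightarrow> 0 \<le> K x y"
    and K_cont: "continuous_on ({0<..} \<times> {0<..}) (\<lambda>(x, y). K x y)"
    and K_sym: "\<And>x y. 0 < x \<Longrightarrow> 0 < y \<Longrightarrow> K x y = K y x"
    and K_hom: "\<And>\<alpha> x y. 0 < \<alpha> \<Longrightarrow> 0 < x \<Longrightarrow> 0 < y \<Longrightarrow>
                  K (\<alpha> * x) (\<alpha> * y) = \<alpha> powr \<gamma> * K x y"
    and K0: "0 < K0" and \<delta>': "0 < \<delta>'" "\<delta>' < 1"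
    and asymp: "\<And>x. 0 < x \<Longrightarrow> x \<le> 1 \<Longrightarrow> \<bar>x powr a * K x 1 - 1\<bar> \<le> K0 * x powr \<delta>'"
  shows "coagulation_kernel (\<lambda>x y. if 0 < x \<and> 0 < y then K x y / (x * y\<^sup>2) else 0) a (min \<delta>' (a/2)) K0"
proof -
  define \<delta> where "\<delta> = min \<delta>' (a/2)"
  have \<delta>: "0 < \<delta>" "\<delta> < 1" "\<delta> < a" "\<delta> \<le> \<delta>'"
  proof -
    have "0 < a" using gamma a by simp
    then show "0 < \<delta>" "\<delta> < 1" "\<delta> < a" "\<delta> \<le> \<delta>'" using \<delta>' by (auto simp: \<delta>_def)
  qed
  have dev: "\<bar>K x y - x powr (-a) * y\<bar> \<le> K0 * (x powr (-a) * y) * (x powr \<delta> * y powr (-\<delta>))" if xy: "0 < x" "x \<le> y" for x y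
  proof -
    define r where "r = x / y"
    have y: "0 < y" and r: "0 < r" "r \<le> 1" using xy by (auto simp: r_def)
    have "K x y = y powr \<gamma> * K r 1" using K_hom[of y r 1] y r by (simp add: r_def)
    moreover have "x powr (-a) * y = y powr \<gamma> * r powr (-a)"
    proof -
      have "y powr \<gamma> * y powr a = y" using powr_mult_powr[of \<gamma> a 1 y] a y by (simp add: powr_one')
      then show ?thesis using xy y by (simp add: r_def powr_divide powr_minus field_simps)
    qed
    moreover have "r powr (-a) * r powr a = 1" using r by (simp flip: powr_add)
    then have "(y powr \<gamma> * r powr (-a)) * (r powr a * K r 1 - 1) = y powr \<gamma> * K r 1 - y powr \<gamma> * r powr (-a)"
      by (simp add: algebra_simps)
    ultimately have eq: "K x y - x powr (-a) * y = (x powr (-a) * y) * (r powr a * K r 1 - 1)"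
      by simp
    have "\<bar>r powr a * K r 1 - 1\<bar> \<le> K0 * r powr \<delta>'" by (rule asymp[OF r])
    also have "\<dots> \<le> K0 * r powr \<delta>" using K0 r \<delta> by (intro mult_left_mono powr_mono') auto
    also have "r powr \<delta> = x powr \<delta> * y powr (-\<delta>)" using xy y by (simp add: r_def powr_divide powr_minus field_simps)
    finally have "(x powr (-a) * y) * \<bar>r powr a * K r 1 - 1\<bar> \<le> (x powr (-a) * y) * (K0 * (x powr \<delta> * y powr (-\<delta>)))"
      using y by (intro mult_left_mono) auto
    then show ?thesis unfolding eq using y by (simp add: abs_mult mult_ac)
  qed
  show ?thesis unfolding \<delta>_def[symmetric]
  proof
    show "0 < a" using gamma a by simp
    show "(\<lambda>(x, y). if 0 < x \<and> 0 < y then K x y / (x * y\<^sup>2) else 0) \<in> borel_measurable (borel \<Otimes>\<^sub>M borel)"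
    proof -
      have "continuous_on ({0<..} \<times> {0<..}) (\<lambda>p. (case p of (x,y) \<Rightarrow> K x y) / (fst p * (snd p)\<^sup>2))"
        by (intro continuous_intros K_cont) auto
      then have "(\<lambda>p. indicator ({0<..} \<times> {0<..}) p *\<^sub>R ((case p of (x,y) \<Rightarrow> K x y) / (fst p * (snd p)\<^sup>2))) \<in> borel_measurable borel"
        by (intro borel_measurable_continuous_on_indicator) (auto simp: borel_open open_Times)
      also have "(\<lambda>p. indicator ({0<..} \<times> {0<..}) p *\<^sub>R ((case p of (x,y) \<Rightarrow> K x y) / (fst p * (snd p)\<^sup>2)))
        = (\<lambda>(x, y). if 0 < x \<and> 0 < y then K x y / (x * y\<^sup>2) else 0)"
        by (auto simp: fun_eq_iff indicator_def)
      finally show ?thesis by (simp add: borel_prod)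
    qed
    show "\<bar>(if 0 < x \<and> 0 < y then K x y / (x * y\<^sup>2) else 0) - x powr (-1-a) * y powr (-1)\<bar> \<le> K0 * x powr (-1-a+\<delta>) * y powr (-1-\<delta>)"
      if xy: "0 < x" "x \<le> y" for x y
    proof -
      have y: "0 < y" using xy by simp
      have e1: "x powr (-1-a) = x powr (-a) / x" using xy powr_mult_powr[of "-a" "-1" "-1-a" x] by (simp add: powr_neg_one)
      have e2: "x powr (-1-a+\<delta>) = x powr (-a) * x powr \<delta> / x"
        using xy powr_mult_powr[of "-1-a" \<delta> "-1-a+\<delta>" x] by (simp add: e1)
      have e3: "y powr (-1-\<delta>) = y powr (-\<delta>) / y" using y powr_mult_powr[of "-\<delta>" "-1" "-1-\<delta>" y] by (simp add: powr_neg_one)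
      have "K x y / (x * y\<^sup>2) - x powr (-1-a) * y powr (-1) = (K x y - x powr (-a) * y) / (x * y\<^sup>2)"
        using xy y by (simp add: e1 powr_neg_one power2_eq_square field_simps)
      moreover have "\<bar>K x y - x powr (-a) * y\<bar> / (x * y\<^sup>2) \<le> K0 * (x powr (-a) * y) * (x powr \<delta> * y powr (-\<delta>)) / (x * y\<^sup>2)"
        using xy y by (intro divide_right_mono dev) auto
      moreover have "K0 * (x powr (-a) * y) * (x powr \<delta> * y powr (-\<delta>)) / (x * y\<^sup>2) = K0 * x powr (-1-a+\<delta>) * y powr (-1-\<delta>)"
        unfolding e2 e3 using xy y by (simp add: power2_eq_square)
      ultimately show ?thesis using xy y by (simp add: abs_mult)
    qed
    show "\<bar>(if 0 < x \<and> 0 < y then K x y / (x * y\<^sup>2) else 0) - y powr (-2-a)\<bar> \<le> K0 * y powr (-2-a+\<delta>) * x powr (-\<delta>)"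
      if xy: "0 < y" "y \<le> x" for x y
    proof -
      have x: "0 < x" using xy by simp
      have e1: "y powr (-2-a) = y powr (-a) / y\<^sup>2" using xy powr_mult_powr[of "-2" "-a" "-2-a" y]
        by (simp add: powr_minus_divide[of y 2] powr_numeral)
      have e2: "y powr (-2-a+\<delta>) = y powr (-a) * y powr \<delta> / y\<^sup>2"
        using xy powr_mult_powr[of "-2-a" \<delta> "-2-a+\<delta>" y] by (simp add: e1)
      have "K x y / (x * y\<^sup>2) - y powr (-2-a) = (K y x - y powr (-a) * x) / (x * y\<^sup>2)"
        using xy x K_sym[of x y] by (simp add: e1 field_simps)
      moreover have "\<bar>K y x - y powr (-a) * x\<bar> / (x * y\<^sup>2) \<le> K0 * (y powr (-a) * x) * (y powr \<delta> * x powr (-\<delta>)) / (x * y\<^sup>2)"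
        using xy x by (intro divide_right_mono dev) auto
      moreover have "K0 * (y powr (-a) * x) * (y powr \<delta> * x powr (-\<delta>)) / (x * y\<^sup>2) = K0 * y powr (-2-a+\<delta>) * x powr (-\<delta>)"
        unfolding e2 using xy x by simp
      ultimately show ?thesis using xy x by (simp add: abs_mult)
    qed
  qed (use \<delta> K0 K_nonneg in auto)
qed

theorem theorem1p2:
  fixes K :: "real \<Rightarrow> real \<Rightarrow> real" and \<gamma> a :: real
  assumes gamma: "\<gamma> < 1" and a: "a = 1 - \<gamma>"
    and K_nonneg: "\<And>x y. 0 < x \<Longrightarrow> 0 < y \<Longrightarrow> 0 \<le> K x y"
    and K_cont: "continuous_on ({0<..} \<times> {0<..}) (\<lambda>(x, y). K x y)"
    and K_sym: "\<And>x y. 0 < x \<Longrightarrow> 0 < y \<Longrightarrow> K x y = K y x"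
    and K_hom: "\<And>\<alpha> x y. 0 < \<alpha> \<Longrightarrow> 0 < x \<Longrightarrow> 0 < y \<Longrightarrow>
                  K (\<alpha> * x) (\<alpha> * y) = \<alpha> powr \<gamma> * K x y"
    and K_asymp: "\<exists>K\<^sub>0>0. \<exists>\<delta>\<in>{0<..<1}. \<forall>x\<in>{0<..<2}.
                    \<bar>x powr a * K x 1 - 1\<bar> \<le> K\<^sub>0 * x powr \<delta>"
  shows "\<exists>\<rho>0>0. \<exists>c\<^sub>1>0. \<exists>c\<^sub>2>0. \<exists>(\<Phi> :: real \<Rightarrow> real \<Rightarrow> real) (k :: real \<Rightarrow> real).
    (\<forall>\<rho>\<in>{0<..<\<rho>0}.
        (\<forall>\<xi>>0. 0 < \<Phi> \<rho> \<xi>) \<and>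
        continuous_on {0<..} (\<Phi> \<rho>) \<and>
        (\<forall>\<xi>>0. ennreal (\<xi>\<^sup>2 * \<Phi> \<rho> \<xi>) =
           (\<integral>\<^sup>+\<eta>\<in>{0<..<\<xi>}. (\<integral>\<^sup>+\<zeta>\<in>{\<xi> - \<eta><..}.
              ennreal (K \<eta> \<zeta> * \<eta> * \<Phi> \<rho> \<eta> * \<Phi> \<rho> \<zeta>) \<partial>lborel) \<partial>lborel)) \<and>
        (\<integral>\<^sup>+\<xi>\<in>{0<..}. ennreal (\<xi> * \<Phi> \<rho> \<xi>) \<partial>lborel) = 1 \<and>
        (\<integral>\<^sup>+\<xi>\<in>{0<..}. ennreal (\<xi> powr \<gamma> * \<Phi> \<rho> \<xi>) \<partial>lborel) = ennreal (\<rho> / (1 + \<rho>)) \<and>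
        (\<forall>\<^sub>F \<xi> in at_right 0.
           c\<^sub>1 * \<rho> / \<xi>\<^sup>2 * exp (- (2 / a) * \<xi> powr (- a)) \<le> \<Phi> \<rho> \<xi> \<and>
           \<Phi> \<rho> \<xi> \<le> c\<^sub>2 * \<rho> / \<xi>\<^sup>2 * exp (- (1 / (2 * a)) * \<xi> powr (- a))) \<and>
        (\<lambda>\<xi>. \<Phi> \<rho> \<xi> - k \<rho> * \<rho> / \<xi> powr (2 + \<rho>)) \<in> o[at_top](\<lambda>\<xi>. 1 / \<xi> powr (2 + \<rho>))) \<and>
    (k \<longlongrightarrow> 1) (at_right 0)"
proof -
  obtain K0 \<delta>' where K0: "0 < K0" and \<delta>': "0 < \<delta>'" "\<delta>' < 1"
    and asymp: "\<And>x. 0 < x \<Longrightarrow> x < 2 \<Longrightarrow> \<bar>x powr a * K x 1 - 1\<bar> \<le> K0 * x powr \<delta>'"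
    using K_asymp by (auto simp: Ball_def)
  define \<delta> where "\<delta> = min \<delta>' (a/2)"
  define k where "k x y = (if 0 < x \<and> 0 < y then K x y / (x * y\<^sup>2) else 0)" for x y
  interpret coagulation_kernel k a \<delta> K0
    unfolding k_def[abs_def] \<delta>_def
    by (rule coagulation_kernel_of_homogeneous[OF gamma a K_nonneg K_cont K_sym K_hom K0 \<delta>']) (use asymp in auto)
  obtain \<rho>1 where \<rho>1: "0 < \<rho>1" and sol: "\<And>\<rho>. 0 < \<rho> \<Longrightarrow> \<rho> < \<rho>1 \<Longrightarrow> small \<rho> \<and> (\<exists>v z. head_ok v \<and> tail_ok z \<and>
     (\<forall>\<xi>>0. coag_op (profile \<rho> v z) (profile \<rho> v z) \<xi> = profile \<rho> v z \<xi>))"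
    using profile_exists by blast
  \<comment> \<open>The second bound gives F_const * \<rho> \<le> b / 2, hence \<mu> \<le> 3/2 *
    b.\<close>
  define \<rho>0 where "\<rho>0 = min \<rho>1 (b / (2 * F_const))"
  have \<rho>0: "0 < \<rho>0" using \<rho>1 b_pos F_const_pos by (simp add: \<rho>0_def)
  \<comment> \<open>Besides the claimed properties this contains two-sided bounds for \<kappa>. The
    functions \<Phi> and \<kappa> are chosen separately for each \<rho>, so whatever is needed for
    the limit \<rho> \<rightarrow> 0 has to be part of the chosen property.\<close>
  define R where "R \<rho> \<Phi> \<kappa> \<longleftrightarrow> (\<forall>\<xi>>0. 0 < \<Phi> \<xi>) \<and> continuous_on {0<..} \<Phi> \<and>
        (\<forall>\<xi>>0. ennreal (\<xi>\<^sup>2 * \<Phi> \<xi>) = (\<integral>\<^sup>+\<eta>\<in>{0<..<\<xi>}. (\<integral>\<^sup>+\<zeta>\<in>{\<xi> - \<eta><..}.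
              ennreal (K \<eta> \<zeta> * \<eta> * \<Phi> \<eta> * \<Phi> \<zeta>) \<partial>lborel) \<partial>lborel)) \<and>
        (\<integral>\<^sup>+\<xi>\<in>{0<..}. ennreal (\<xi> * \<Phi> \<xi>) \<partial>lborel) = 1 \<and>
        (\<integral>\<^sup>+\<xi>\<in>{0<..}. ennreal (\<xi> powr \<gamma> * \<Phi> \<xi>) \<partial>lborel) = ennreal (\<rho> / (1 + \<rho>)) \<and>
        (\<forall>\<^sub>F \<xi> in at_right 0.
           1/8 * \<rho> / \<xi>\<^sup>2 * exp (- (2 / a) * \<xi> powr (- a)) \<le> \<Phi> \<xi> \<and>
           \<Phi> \<xi> \<le> (2 * exp 1) * \<rho> / \<xi>\<^sup>2 * exp (- (1 / (2 * a)) * \<xi> powr (- a))) \<and>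
        (\<lambda>\<xi>. \<Phi> \<xi> - \<kappa> * \<rho> / \<xi> powr (2 + \<rho>)) \<in> o[at_top](\<lambda>\<xi>. 1 / \<xi> powr (2 + \<rho>)) \<and>
        exp (- k_const * \<rho>) \<le> \<kappa> \<and> \<kappa> \<le> exp (k_const * \<rho>)" for \<rho> \<kappa> :: real and \<Phi> :: "real \<Rightarrow> real"
  have ex: "\<exists>\<Phi> \<kappa>. R \<rho> \<Phi> \<kappa>" if \<rho>: "0 < \<rho>" "\<rho> < \<rho>0" for \<rho>
  proof -
    have "\<rho> < \<rho>1" "\<rho> < b / (2 * F_const)" using \<rho> by (auto simp: \<rho>0_def)
    then have F_const\<rho>: "F_const * \<rho> \<le> b / 2" using F_const_pos by (simp add: field_simps)
    from sol[OF \<rho>(1) \<open>\<rho> < \<rho>1\<close>] obtain v z where small: "small \<rho>" and vz: "head_ok v" "tail_ok z"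
      and fp: "\<And>\<xi>. 0 < \<xi> \<Longrightarrow> coag_op (profile \<rho> v z) (profile \<rho> v z) \<xi> = profile \<rho> v z \<xi>" by blast
    obtain f \<mu> L where f: "f \<in> borel_measurable borel" "\<forall>x\<le>0. f x = 0" "\<forall>x>0. 0 < f x" "continuous_on {0<..} f"
      "\<forall>X>0. ennreal (f X) = (\<integral>\<^sup>+x. \<integral>\<^sup>+y. ennreal (if x < X \<and> X < x + y then k x y * f x * f y else 0) \<partial>lborel \<partial>lborel)"
      "(\<integral>\<^sup>+x. ennreal (x powr (-1) * f x) \<partial>lborel) = ennreal \<mu>"
      "(\<integral>\<^sup>+x. ennreal (x powr (-1-a) * f x) \<partial>lborel) = ennreal (\<rho> / (1 + \<rho>))"
      and fs: "\<forall>x. 0 < x \<longrightarrow> x \<le> 1 \<longrightarrow> 3/16 * b * \<rho> * exp (- (5/4) * b * (prim x - prim 1)) \<le> f x \<and> f x \<le> 5/4 * b * \<rho> * exp (- (3/4) * b * (prim x - prim 1))"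
      and fl: "((\<lambda>x. f x * x powr \<rho>) \<longlongrightarrow> b * \<rho> * exp (- \<rho> * L)) at_top"
      and \<mu>: "b \<le> \<mu>" "\<mu> \<le> b + F_const * \<rho>" and L: "\<bar>L\<bar> \<le> 1 / (4 * \<delta>)"
      using profile_solution[OF small vz fp] by blast
    have \<mu>0: "0 < \<mu>" and \<mu>3: "\<mu> \<le> 3/2 * b" using \<mu> b_pos F_const\<rho> by auto
    define l where "l = \<mu> powr (1/a)"
    have l: "0 < l" using \<mu>0 by (simp add: l_def)
    define \<Phi> where "\<Phi> \<xi> = f (\<mu> powr (1/a) * \<xi>) / (\<mu> * \<xi>\<^sup>2)" for \<xi>
    define \<kappa> where "\<kappa> = b / \<mu> * \<mu> powr (-\<rho> / a) * exp (- \<rho> * L)"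
    have km: "(\<lambda>(x,y). k x y) \<in> borel_measurable (borel \<Otimes>\<^sub>M borel)" by (rule k_meas)
    note res = rescaled_solution[OF a a_pos \<mu>0 K_hom k_def km f(1) f(2)[rule_format] f(3)[rule_format] f(5)[rule_format] f(6) f(7) \<Phi>_def]
    have "R \<rho> \<Phi> \<kappa>"
      unfolding R_def
    proof (intro conjI)
      show "\<forall>\<xi>>0. 0 < \<Phi> \<xi>" using f(3) \<mu>0 l by (auto simp: \<Phi>_def l_def[symmetric])
      have "continuous_on {0<..} (\<lambda>\<xi>. f (l * \<xi>))"
        by (rule continuous_on_compose2[OF f(4)]) (use l in \<open>auto intro!: continuous_intros\<close>)
      then show "continuous_on {0<..} \<Phi>" unfolding \<Phi>_def l_def[symmetric] using \<mu>0 by (intro continuous_intros) auto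
      show "\<forall>\<^sub>F \<xi> in at_right 0.
           1/8 * \<rho> / \<xi>\<^sup>2 * exp (- (2 / a) * \<xi> powr (- a)) \<le> \<Phi> \<xi> \<and>
           \<Phi> \<xi> \<le> (2 * exp 1) * \<rho> / \<xi>\<^sup>2 * exp (- (1 / (2 * a)) * \<xi> powr (- a))"
      proof (rule eventually_mono)
        show "\<forall>\<^sub>F \<xi> in at_right 0. \<xi> \<in> {0<..<1/l}" using l by (intro eventually_at_right_real) simp
        fix \<xi> assume "\<xi> \<in> {0<..<1/l}"
        then have \<xi>: "0 < \<xi>" "\<mu> powr (1/a) * \<xi> \<le> 1" using l by (auto simp: l_def[symmetric] field_simps)
        show "1/8 * \<rho> / \<xi>\<^sup>2 * exp (- (2 / a) * \<xi> powr (- a)) \<le> \<Phi> \<xi> \<and>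
           \<Phi> \<xi> \<le> (2 * exp 1) * \<rho> / \<xi>\<^sup>2 * exp (- (1 / (2 * a)) * \<xi> powr (- a))"
          unfolding \<Phi>_def using fs by (intro conjI scaled_small_bounds[OF \<rho>(1) \<mu>(1) \<mu>3 \<xi>]) blast+
      qed
      show "(\<lambda>\<xi>. \<Phi> \<xi> - \<kappa> * \<rho> / \<xi> powr (2 + \<rho>)) \<in> o[at_top](\<lambda>\<xi>. 1 / \<xi> powr (2 + \<rho>))"
        unfolding \<Phi>_def \<kappa>_def by (rule scaled_tail[OF \<mu>0 fl])
      show "exp (- k_const * \<rho>) \<le> \<kappa>" "\<kappa> \<le> exp (k_const * \<rho>)"
        unfolding \<kappa>_def by (rule tail_constant_bounds[OF \<rho>(1) \<mu> \<mu>3 L])+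
      show "\<forall>\<xi>>0. ennreal (\<xi>\<^sup>2 * \<Phi> \<xi>) = (\<integral>\<^sup>+\<eta>\<in>{0<..<\<xi>}. (\<integral>\<^sup>+\<zeta>\<in>{\<xi> - \<eta><..}.
              ennreal (K \<eta> \<zeta> * \<eta> * \<Phi> \<eta> * \<Phi> \<zeta>) \<partial>lborel) \<partial>lborel)"
        by (rule res(1))
      show "(\<integral>\<^sup>+\<xi>\<in>{0<..}. ennreal (\<xi> * \<Phi> \<xi>) \<partial>lborel) = 1"
        by (rule res(2))
      show "(\<integral>\<^sup>+\<xi>\<in>{0<..}. ennreal (\<xi> powr \<gamma> * \<Phi> \<xi>) \<partial>lborel) = ennreal (\<rho> / (1 + \<rho>))"
        by (rule res(3))
    qed
    then show ?thesis by blast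
  qed
  then obtain \<Phi> \<kappa> where R: "\<And>\<rho>. 0 < \<rho> \<Longrightarrow> \<rho> < \<rho>0 \<Longrightarrow> R \<rho> (\<Phi> \<rho>) (\<kappa> \<rho>)" by metis
  have lim: "(\<kappa> \<longlongrightarrow> 1) (at_right 0)"
  proof (rule tendsto_sandwich)
    show "\<forall>\<^sub>F \<rho> in at_right 0. exp (- k_const * \<rho>) \<le> \<kappa> \<rho>"
      using eventually_at_right_real[OF \<rho>0] by eventually_elim (use R in \<open>auto simp: R_def\<close>)
    show "\<forall>\<^sub>F \<rho> in at_right 0. \<kappa> \<rho> \<le> exp (k_const * \<rho>)"
      using eventually_at_right_real[OF \<rho>0] by eventually_elim (use R in \<open>auto simp: R_def\<close>)
    show "((\<lambda>\<rho>. exp (- k_const * \<rho>)) \<longlongrightarrow> 1) (at_right 0)" "((\<lambda>\<rho>. exp (k_const * \<rho>)) \<longlongrightarrow> 1) (at_right 0)"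
      by (auto intro!: tendsto_eq_intros)
  qed
  show ?thesis
  proof (rule exI[of _ \<rho>0], intro conjI \<rho>0, rule exI[of _ "1/8"], intro conjI, simp, rule exI[of _ "2 * exp 1"], intro conjI, simp,
      rule exI[of _ \<Phi>], rule exI[of _ \<kappa>], rule conjI[OF _ lim], rule ballI)
    fix \<rho> assume "\<rho> \<in> {0<..<\<rho>0}"
    then have "R \<rho> (\<Phi> \<rho>) (\<kappa> \<rho>)" using R by simp
    then show "(\<forall>\<xi>>0. 0 < \<Phi> \<rho> \<xi>) \<and>
        continuous_on {0<..} (\<Phi> \<rho>) \<and>
        (\<forall>\<xi>>0. ennreal (\<xi>\<^sup>2 * \<Phi> \<rho> \<xi>) =
           (\<integral>\<^sup>+\<eta>\<in>{0<..<\<xi>}. (\<integral>\<^sup>+\<zeta>\<in>{\<xi> - \<eta><..}.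
              ennreal (K \<eta> \<zeta> * \<eta> * \<Phi> \<rho> \<eta> * \<Phi> \<rho> \<zeta>) \<partial>lborel) \<partial>lborel)) \<and>
        (\<integral>\<^sup>+\<xi>\<in>{0<..}. ennreal (\<xi> * \<Phi> \<rho> \<xi>) \<partial>lborel) = 1 \<and>
        (\<integral>\<^sup>+\<xi>\<in>{0<..}. ennreal (\<xi> powr \<gamma> * \<Phi> \<rho> \<xi>) \<partial>lborel) = ennreal (\<rho> / (1 + \<rho>)) \<and>
        (\<forall>\<^sub>F \<xi> in at_right 0.
           1/8 * \<rho> / \<xi>\<^sup>2 * exp (- (2 / a) * \<xi> powr (- a)) \<le> \<Phi> \<rho> \<xi> \<and>
           \<Phi> \<rho> \<xi> \<le> (2 * exp 1) * \<rho> / \<xi>\<^sup>2 * exp (- (1 / (2 * a)) * \<xi> powr (- a))) \<and>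
        (\<lambda>\<xi>. \<Phi> \<rho> \<xi> - \<kappa> \<rho> * \<rho> / \<xi> powr (2 + \<rho>)) \<in> o[at_top](\<lambda>\<xi>. 1 / \<xi> powr (2 + \<rho>))"
      unfolding R_def by blast
  qed
qed

end
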